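(* (i) Let $\sigma=0$ and $\frac{q}{s+1}<\min\left\{1,\frac2n\right\}$. Then there are positive constants $c,\gamma$ independent of $d_1,d_2$ such that every positive smooth solution $(u,v)$ of the stationary system satisfies $$u\le c\left(1+d_1^{-\gamma}\right),\qquad v\le c\left(1+d_1^{-\frac{r}{s+1}\gamma}\right).$$ (ii) Let $\sigma>0$ and $\frac{p-1}{r}<\min\left\{1,\frac2n\right\}$. Then there are positive constants $c,\gamma$ independent of $d_1,d_2$ such that every positive smooth solution $(u,v)$ of the stationary system satisfies $$u\le c\left(1+d_1^{-\gamma}\right),\qquad v\le c\left(1+d_1^{-\frac{r}{s+1}\gamma}\right).$$
   Context: $\Omega\subset\mathbb{R}^n$, $n\ge1$, is a bounded smooth domain with unit outer normal $\nu$ on $\partial\Omega$; $d_1,d_2>0$; $\sigma\ge0$ is a constant; $p,q,r,s\ge0$ satisfy $0<\frac{p-1}{r}<\frac{q}{s+1}$. The stationary system is $$d_1\Delta u-u+\frac{u^p}{v^q}+\sigma=0,\quad d_2\Delta v-v+\frac{u^r}{v^s}=0\ \text{ in }\Omega,\qquad \frac{\partial u}{\partial\nu}=\frac{\partial v}{\partial\nu}=0\ \text{ on }\partial\Omega.$$ A positive smooth solution is a pair $u,v\in C^\infty(\overline\Omega)$ with $u,v>0$ in $\overline\Omega$ solving it. *)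

theory Defs
  imports "HOL-Analysis.Analysis"
begin

text \<open>Partial derivatives of arbitrary order: a list of basis vectors plays the role of a
  multi-index; the head of the list is the variable differentiated last.\<close>

primrec partial_derivs :: "'a list \<Rightarrow> ('a::euclidean_space \<Rightarrow> real) \<Rightarrow> 'a \<Rightarrow> real" where
  "partial_derivs [] f = f"
| "partial_derivs (b # bs) f = (\<lambda>x. frechet_derivative (partial_derivs bs f) (at x) b)"

definition smooth_on :: "'a::euclidean_space set \<Rightarrow> ('a \<Rightarrow> real) \<Rightarrow> bool" where
  "smooth_on S f \<longleftrightarrow>
     (\<forall>bs. set bs \<subseteq> Basis \<longrightarrow> (\<forall>x\<in>S. partial_derivs bs f differentiable (at x)))"

text \<open>The class \<open>C\<^sup>\<infinity>\<close> of the closure of an open set \<open>\<Omega>\<close>, in the usual PDE sense: the function is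
  smooth in \<open>\<Omega>\<close>, and all its partial derivatives have continuous extensions to the closure of \<open>\<Omega>\<close>;
  on the boundary the function itself takes the values of its extension. No values outside the
  closure of \<open>\<Omega>\<close> are constrained.\<close>

definition smooth_up_to_boundary :: "'a::euclidean_space set \<Rightarrow> ('a \<Rightarrow> real) \<Rightarrow> bool" where
  "smooth_up_to_boundary \<Omega> f \<longleftrightarrow>
     smooth_on \<Omega> f \<and> continuous_on (closure \<Omega>) f \<and>
     (\<forall>bs. set bs \<subseteq> Basis \<longrightarrow>
        (\<exists>g. continuous_on (closure \<Omega>) g \<and> (\<forall>x\<in>\<Omega>. g x = partial_derivs bs f x)))"

definition gradient :: "('a::euclidean_space \<Rightarrow> real) \<Rightarrow> 'a \<Rightarrow> 'a" where
  "gradient f x = (\<Sum>b\<in>Basis. partial_derivs [b] f x *\<^sub>R b)"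

definition laplacian :: "('a::euclidean_space \<Rightarrow> real) \<Rightarrow> 'a \<Rightarrow> real" where
  "laplacian f x = (\<Sum>b\<in>Basis. partial_derivs [b, b] f x)"

text \<open>\<open>\<phi>\<close> describes \<open>\<Omega>\<close> near its boundary point \<open>x\<close> as a strict sublevel set. By the implicit function
  theorem the boundary near \<open>x\<close> is then the smooth hypersurface \<open>\<phi> = 0\<close>, with \<open>\<Omega>\<close> on one side of it
  only, and the gradient of \<open>\<phi>\<close> points out of \<open>\<Omega>\<close>.\<close>

definition local_defining_function ::
    "'a::euclidean_space set \<Rightarrow> 'a \<Rightarrow> 'a set \<Rightarrow> ('a \<Rightarrow> real) \<Rightarrow> bool" where
  "local_defining_function \<Omega> x U \<phi> \<longleftrightarrow>
     open U \<and> x \<in> U \<and> smooth_on U \<phi> \<and> gradient \<phi> x \<noteq> 0 \<and> \<Omega> \<inter> U = {y \<in> U. \<phi> y < 0}"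

definition bounded_smooth_domain :: "'a::euclidean_space set \<Rightarrow> bool" where
  "bounded_smooth_domain \<Omega> \<longleftrightarrow>
     \<Omega> \<noteq> {} \<and> open \<Omega> \<and> connected \<Omega> \<and> bounded \<Omega> \<and>
     (\<forall>x\<in>frontier \<Omega>. \<exists>U \<phi>. local_defining_function \<Omega> x U \<phi>)"

text \<open>The normal does not depend on the choice of the defining function.\<close>

definition unit_outer_normal :: "'a::euclidean_space set \<Rightarrow> ('a \<Rightarrow> 'a) \<Rightarrow> bool" where
  "unit_outer_normal \<Omega> \<nu> \<longleftrightarrow>
     (\<forall>x\<in>frontier \<Omega>. \<exists>U \<phi>. local_defining_function \<Omega> x U \<phi> \<and>
        \<nu> x = gradient \<phi> x /\<^sub>R norm (gradient \<phi> x))"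

text \<open>The derivative in direction \<open>\<nu> x\<close> is taken from the left, since only the points
  \<open>x + t *\<^sub>R \<nu> x\<close> with \<open>t < 0\<close> near 0 lie in \<open>\<Omega>\<close>.\<close>

definition has_normal_derivative ::
    "('a::euclidean_space \<Rightarrow> 'a) \<Rightarrow> ('a \<Rightarrow> real) \<Rightarrow> real \<Rightarrow> 'a \<Rightarrow> bool" where
  "has_normal_derivative \<nu> f D x \<longleftrightarrow>
     ((\<lambda>t. f (x + t *\<^sub>R \<nu> x)) has_real_derivative D) (at_left 0)"

definition positive_smooth_solution ::
    "'a::euclidean_space set \<Rightarrow> ('a \<Rightarrow> 'a) \<Rightarrow> real \<Rightarrow> real \<Rightarrow> real \<Rightarrow>
     real \<Rightarrow> real \<Rightarrow> real \<Rightarrow> real \<Rightarrow> ('a \<Rightarrow> real) \<Rightarrow> ('a \<Rightarrow> real) \<Rightarrow> bool" where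
  "positive_smooth_solution \<Omega> \<nu> d\<^sub>1 d\<^sub>2 \<sigma> p q r s u v \<longleftrightarrow>
     smooth_up_to_boundary \<Omega> u \<and> smooth_up_to_boundary \<Omega> v \<and>
     (\<forall>x\<in>closure \<Omega>. u x > 0 \<and> v x > 0) \<and>
     (\<forall>x\<in>\<Omega>. d\<^sub>1 * laplacian u x - u x + u x powr p / v x powr q + \<sigma> = 0) \<and>
     (\<forall>x\<in>\<Omega>. d\<^sub>2 * laplacian v x - v x + u x powr r / v x powr s = 0) \<and>
     (\<forall>x\<in>frontier \<Omega>. has_normal_derivative \<nu> u 0 x \<and> has_normal_derivative \<nu> v 0 x)"

end

theory Submission
  imports Defs
begin

text \<open>
  What makes the bounds uniform in \<open>d\<^sub>2\<close> is that the inhibitor enters the estimate of \<open>u\<close> through a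
  single integral. Dividing the equation of \<open>v\<close> by \<open>v\<close> and integrating shows that
  \<open>g = u powr r / v powr (s + 1)\<close> has integral at most \<open>|\<Omega>|\<close>, for all diffusion constants
  (\<open>solution_ratio_integral_le\<close>). The reaction term is \<open>g powr \<kappa>\<close> times \<open>u powr (1 - \<delta>)\<close> times a power of \<open>v\<close>,
  with \<open>\<delta> = r * \<kappa> - (p - 1)\<close>, where \<open>\<kappa>\<close> may be chosen above \<open>(p - 1) / r\<close> and below \<open>1\<close> and \<open>2 / n\<close>. If \<open>\<sigma> = 0\<close>,
  the choice \<open>\<kappa> = q / (s + 1)\<close> makes the power of \<open>v\<close> disappear. If \<open>\<sigma> > 0\<close>, a value of \<open>\<kappa>\<close> slightly above
  \<open>(p - 1) / r\<close> makes the exponent of \<open>v\<close> negative, and the maximum principle gives \<open>u \<ge> \<sigma>\<close> and hence a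
  positive lower bound for \<open>v\<close> (\<open>solution_lower_bounds\<close>). In both cases the reaction is sublinear in \<open>u\<close>, with
  a coefficient bounded in \<open>L\<^bsup>1/\<kappa>\<^esup>\<close> for some \<open>1/\<kappa> > n/2\<close>; where \<open>u \<ge> 1\<close>, this remains true for any smaller
  positive \<open>\<delta>\<close>, so \<open>\<delta> < 1\<close> may be assumed.

  The linear estimate behind this is that a solution of \<open>- d \<Delta>w + w \<le> f\<close> on \<open>{w > 1}\<close> with Neumann condition is
  bounded by \<open>C * N * (1 + 1 / d)\<close>, where \<open>N\<close> measures \<open>f\<close> in weak \<open>L\<^bsup>1/\<kappa>\<^esup>\<close> (\<open>neumann_sup_bound\<close>). Applied to \<open>u\<close> with
  maximum \<open>M\<close>, it gives \<open>M \<le> C * M powr (1 - \<delta>) * (1 + 1 / d\<^sub>1)\<close>, hence a power bound for \<open>M\<close>, and the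
  maximum principle for the second equation bounds \<open>v\<close> by \<open>M powr (r / (s + 1))\<close>.

  The proof of the linear estimate is De Giorgi's. It needs two facts about a smooth domain. One is
  integration by parts for functions satisfying the Neumann condition (\<open>neumann_weak_form\<close>), obtained from a
  divergence theorem for fields tangential to the boundary; for such fields the boundary term is absent,
  and cutoffs near the boundary suffice instead of surface integrals. The other is an inequality of
  Faber--Krahn type (\<open>superlevel_measure_estimate\<close>), which follows from the interior cone property by
  averaging along segments and takes the place of the Sobolev embedding.
\<close>

section \<open>Integration over the whole space\<close>

lemma set_integrable_bounded_continuous:
  fixes f :: "'a::euclidean_space \<Rightarrow> real"
  assumes "V \<in> sets borel" "bounded V" "continuous_on V f" "\<And>x. x \<in> V \<Longrightarrow> \<bar>f x\<bar> \<le> B"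
  shows "set_integrable lborel V f"
proof -
  have fin: "emeasure lborel V < \<infinity>"
    using assms(1,2) emeasure_bounded_finite by blast
  have "set_borel_measurable lborel V f"
    using borel_measurable_continuous_on_indicator[OF assms(1,3)]
    by (simp add: set_borel_measurable_def)
  then show ?thesis
    unfolding set_integrable_def set_borel_measurable_def
  proof (rule Bochner_Integration.integrable_bound[rotated 1])
    show "integrable lborel (\<lambda>x. B * indicator V x)"
      using assms(1) fin by simp
    show "AE x in lborel. norm (indicator V x *\<^sub>R f x) \<le> norm (B * indicator V x)"
      using order_trans[OF assms(4) abs_ge_self] by (intro AE_I2) (auto simp: indicator_def)
  qed
qed

lemma nn_integral_lborel_translation:
  fixes f :: "'a::euclidean_space \<Rightarrow> ennreal"
  assumes [measurable]: "f \<in> borel_measurable borel"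
  shows "(\<integral>\<^sup>+ x. f (x + c) \<partial>lborel) = (\<integral>\<^sup>+ x. f x \<partial>lborel)"
  by (subst lborel_distr_plus[of c, symmetric]) (simp add: nn_integral_distr add.commute)

lemma lborel_integrable_translation:
  fixes f :: "'a::euclidean_space \<Rightarrow> real"
  assumes "integrable lborel f"
  shows "integrable lborel (\<lambda>x. f (x + c))"
  using assms integrable_distr_eq[of "(+) c" lborel borel f]
  by (simp add: lborel_distr_plus add.commute)

lemma lborel_integral_translation:
  fixes f :: "'a::euclidean_space \<Rightarrow> real"
  assumes "integrable lborel f"
  shows "(\<integral>x. f (x + c) \<partial>lborel) = (\<integral>x. f x \<partial>lborel)"
  using assms integral_distr[of "(+) c" lborel borel f]
  by (simp add: lborel_distr_plus add.commute)

text \<open>Translation invariance makes every difference quotient of \<open>f\<close> have integral 0, and dominated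
  convergence passes this to the derivative. No iterated integration is involved, so the direction
  \<open>b\<close> is arbitrary.\<close>

lemma integral_directional_derivative_eq_0:
  fixes f g :: "'a::euclidean_space \<Rightarrow> real"
  assumes "compact C" and f: "continuous_on UNIV f" and g: "continuous_on UNIV g"
    and f0: "\<And>x. x \<notin> C \<Longrightarrow> f x = 0" and g0: "\<And>x. x \<notin> C \<Longrightarrow> g x = 0"
    and der: "\<And>x. ((\<lambda>t. f (x + t *\<^sub>R b)) has_real_derivative g x) (at 0)"
  shows "integrable lborel g" "integral\<^sup>L lborel g = 0"
proof -
  have "compact (g ` C)"
    using assms(1) g compact_continuous_image continuous_on_subset by blast
  then obtain B where "\<And>x. x \<in> C \<Longrightarrow> \<bar>g x\<bar> \<le> B"
    using compact_imp_bounded bounded_iff by (metis imageI real_norm_def)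
  then have B: "\<bar>g x\<bar> \<le> \<bar>B\<bar>" for x
    using g0[of x] by (cases "x \<in> C") force+
  have "compact (f ` C)"
    using assms(1) f compact_continuous_image continuous_on_subset by blast
  then obtain A where A: "\<And>x. x \<in> C \<Longrightarrow> \<bar>f x\<bar> \<le> A"
    using compact_imp_bounded bounded_iff by (metis imageI real_norm_def)
  have Cb: "C \<in> sets borel" "bounded C"
    using assms(1) by (auto intro: borel_compact compact_imp_bounded)
  have int: "integrable lborel h" if "continuous_on UNIV h" "\<And>x. x \<notin> C \<Longrightarrow> h x = 0"
    "\<And>x. x \<in> C \<Longrightarrow> \<bar>h x\<bar> \<le> A" for h :: "'a \<Rightarrow> real" and A
  proof -
    have "set_integrable lborel C h"
      using Cb that by (intro set_integrable_bounded_continuous[where B=A])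
        (auto intro: continuous_on_subset)
    moreover have "(\<lambda>x. indicator C x *\<^sub>R h x) = h"
      using that(2) by (auto simp: indicator_def fun_eq_iff)
    ultimately show ?thesis by (simp add: set_integrable_def)
  qed
  show "integrable lborel g" using int[OF g g0, of "\<bar>B\<bar>"] B by auto
  have fint: "integrable lborel f" using int[OF f f0 A] .
  \<comment> \<open>The quotients for step sizes at most 1 all vanish outside this compact set.\<close>
  define K where "K = {x - t *\<^sub>R b |x t. x \<in> C \<and> t \<in> {0..1::real}}"
  have "K = (\<lambda>(x,t). x - t *\<^sub>R b) ` (C \<times> {0..1::real})" by (force simp: K_def)
  then have Kc: "compact K"
    using assms(1) by (auto intro!: compact_continuous_image compact_Times continuous_intros
      simp: case_prod_unfold)
  define h where "h k = inverse (real (Suc k))" for k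
  have h: "0 < h k" "h k \<le> 1" for k by (auto simp: h_def inverse_le_1_iff)
  have hlim: "h \<longlonglongrightarrow> 0"
    unfolding h_def by (rule LIMSEQ_inverse_real_of_nat)
  define Q where "Q k x = (f (x + h k *\<^sub>R b) - f x) / h k" for k x
  have dl: "((\<lambda>t. f (x + t *\<^sub>R b)) has_real_derivative g (x + t0 *\<^sub>R b)) (at t0)" for x t0
    using DERIV_shift[of "\<lambda>t. f (x + t *\<^sub>R b)" "g (x + t0 *\<^sub>R b)" 0 t0] der[of "x + t0 *\<^sub>R b"]
    by (simp add: algebra_simps scaleR_add_left)
  have Qb: "\<bar>Q k x\<bar> \<le> \<bar>B\<bar> * indicator K x" for k x
  proof (cases "x \<in> K")
    case True
    obtain z where z: "0 < z" "z < h k"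
      "f (x + h k *\<^sub>R b) - f (x + 0 *\<^sub>R b) = (h k - 0) * g (x + z *\<^sub>R b)"
      using MVT2[OF h(1)[of k], of "\<lambda>t. f (x + t *\<^sub>R b)" "\<lambda>t. g (x + t *\<^sub>R b)"] dl by metis
    then have "Q k x = g (x + z *\<^sub>R b)" using h(1)[of k] by (simp add: Q_def)
    then show ?thesis using B True by auto
  next
    case False
    then have "x + h k *\<^sub>R b \<notin> C"
      using h[of k] unfolding K_def by (auto simp: algebra_simps)
    moreover have "x \<notin> C"
    proof
      assume "x \<in> C" then have "x - 0 *\<^sub>R b \<in> K" unfolding K_def by force
      then show False using False by simp
    qed
    ultimately show ?thesis using f0 by (simp add: Q_def)
  qed
  have "(\<lambda>k. Q k x) \<longlonglongrightarrow> g x" for x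
  proof -
    have "((\<lambda>t. (f (x + t *\<^sub>R b) - f (x + 0 *\<^sub>R b)) / (t - 0)) \<longlongrightarrow> g x) (at 0)"
      using der[of x] by (simp add: has_field_derivative_iff)
    moreover have "filterlim h (at 0) sequentially"
      using hlim h by (auto simp: filterlim_at less_imp_neq[symmetric])
    ultimately show ?thesis
      unfolding Q_def by (auto dest: filterlim_compose)
  qed
  moreover have "integrable lborel (\<lambda>x. \<bar>B\<bar> * indicator K x)"
    using Kc emeasure_compact_finite[of K] borel_compact[of K] by simp
  moreover have "Q k \<in> borel_measurable lborel" for k
    unfolding Q_def using f h(1)[of k] by (auto intro!: borel_measurable_continuous_onI continuous_intros
      continuous_on_compose2[OF f])
  ultimately have "(\<lambda>k. integral\<^sup>L lborel (Q k)) \<longlonglongrightarrow> integral\<^sup>L lborel g"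
    using Qb borel_measurable_continuous_onI[OF g]
    by (intro integral_dominated_convergence[where w="\<lambda>x. \<bar>B\<bar> * indicator K x"]) auto
  moreover have "integral\<^sup>L lborel (Q k) = 0" for k
    unfolding Q_def using lborel_integrable_translation[OF fint] lborel_integral_translation[OF fint] fint
    by simp
  ultimately show "integral\<^sup>L lborel g = 0"
    by (simp add: LIMSEQ_const_iff)
qed

section \<open>Continuously differentiable cutoffs\<close>

text \<open>The square of the positive part is the building block for everything that has to be cut off: it is
  continuously differentiable, which the positive part itself is not.\<close>

definition pos_sq :: "real \<Rightarrow> real" where
  "pos_sq x = (max 0 x)\<^sup>2"

lemma pos_sq_simps:
  "x \<le> 0 \<Longrightarrow> pos_sq x = 0" "0 \<le> x \<Longrightarrow> pos_sq x = x\<^sup>2" "0 \<le> pos_sq x" "0 < x \<Longrightarrow> 0 < pos_sq x"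
  by (auto simp: pos_sq_def)

lemma pos_sq_has_real_derivative: "(pos_sq has_real_derivative 2 * max 0 x) (at x)"
proof -
  consider "x < 0" | "x = 0" | "0 < x" by linarith
  then show ?thesis
  proof cases
    case 1
    have "((\<lambda>_. 0) has_real_derivative 2 * max 0 x) (at x)" using 1 by simp
    then show ?thesis
      by (rule DERIV_cong_ev[OF refl _ refl, THEN iffD1, rotated])
         (use 1 eventually_nhds_in_open[of "{..<0}" x] in \<open>auto elim!: eventually_mono simp: pos_sq_simps\<close>)
  next
    case 2
    have "((\<lambda>h. max 0 h * max 0 h / h) \<longlongrightarrow> 0) (at (0::real))"
    proof (rule Lim_null_comparison)
      show "\<forall>\<^sub>F h::real in at 0. norm (max 0 h * max 0 h / h) \<le> \<bar>h\<bar>"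
        by (intro always_eventually) (auto simp: max_def)
    qed (auto intro!: tendsto_eq_intros)
    then show ?thesis using 2
      by (simp add: has_field_derivative_iff pos_sq_def power2_eq_square)
  next
    case 3
    have "((\<lambda>x. x\<^sup>2) has_real_derivative 2 * max 0 x) (at x)" using 3
      by (auto intro!: derivative_eq_intros)
    then show ?thesis
      by (rule DERIV_cong_ev[OF refl _ refl, THEN iffD1, rotated])
         (use 3 eventually_nhds_in_open[of "{0<..}" x] in \<open>auto elim!: eventually_mono simp: pos_sq_simps\<close>)
  qed
qed

lemma continuous_on_pos_sq [continuous_intros]:
  "continuous_on A f \<Longrightarrow> continuous_on A (\<lambda>x. pos_sq (f x))"
  unfolding pos_sq_def by (intro continuous_intros)

definition smoothstep :: "real \<Rightarrow> real" where
  "smoothstep s = pos_sq s / (pos_sq s + pos_sq (1 - s))"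

definition smoothstep' :: "real \<Rightarrow> real" where
  "smoothstep' s = 2 * (max 0 s * pos_sq (1 - s) + max 0 (1 - s) * pos_sq s)
     / (pos_sq s + pos_sq (1 - s))\<^sup>2"

text \<open>The denominator of the smooth step never vanishes, since \<open>s\<close> and \<open>1 - s\<close> are not both
  nonpositive.\<close>

lemma pos_sq_partition_pos: "0 < pos_sq s + pos_sq (1 - s)"
  using pos_sq_simps(3)[of s] pos_sq_simps(3)[of "1-s"] pos_sq_simps(4)[of s] pos_sq_simps(4)[of "1-s"]
  by (cases "s > 0") (auto intro: add_pos_nonneg add_nonneg_pos)

lemma smoothstep_has_real_derivative:
  "(smoothstep has_real_derivative smoothstep' s) (at s)"
proof -
  have "((\<lambda>s. pos_sq (1 - s)) has_real_derivative 2 * max 0 (1 - s) * (0 - 1)) (at s)"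
    by (rule DERIV_chain'[of "\<lambda>s. 1 - s", OF _ pos_sq_has_real_derivative]) (auto intro!: derivative_eq_intros)
  then show ?thesis
    unfolding smoothstep_def smoothstep'_def
    using pos_sq_partition_pos[of s]
    by (auto intro!: derivative_eq_intros pos_sq_has_real_derivative
        simp: power2_eq_square field_simps)
qed

lemma continuous_on_smoothstep [continuous_intros]:
  "continuous_on A f \<Longrightarrow> continuous_on A (\<lambda>x. smoothstep (f x))"
  unfolding smoothstep_def
  using pos_sq_partition_pos by (intro continuous_intros) (auto simp: less_imp_neq[symmetric])

lemma continuous_on_smoothstep' [continuous_intros]:
  "continuous_on A f \<Longrightarrow> continuous_on A (\<lambda>x. smoothstep' (f x))"
  unfolding smoothstep'_def
  using pos_sq_partition_pos by (intro continuous_intros) (auto simp: less_imp_neq[symmetric])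

lemma smoothstep_le_0: "s \<le> 0 \<Longrightarrow> smoothstep s = 0"
  and smoothstep_ge_1: "1 \<le> s \<Longrightarrow> smoothstep s = 1"
  by (auto simp: smoothstep_def pos_sq_simps)

lemma smoothstep_bounds: "0 \<le> smoothstep s" "smoothstep s \<le> 1"
  using pos_sq_partition_pos[of s] pos_sq_simps(3)[of s] pos_sq_simps(3)[of "1-s"]
  by (auto simp: smoothstep_def field_simps)

lemma smoothstep'_outside: "s \<le> 0 \<or> 1 \<le> s \<Longrightarrow> smoothstep' s = 0"
  by (auto simp: smoothstep'_def pos_sq_simps)

lemma smoothstep'_nonneg: "0 \<le> smoothstep' s"
  by (auto simp: smoothstep'_def pos_sq_simps)

lemma smoothstep'_le: "smoothstep' s \<le> 2"
proof (cases "s \<le> 0 \<or> 1 \<le> s")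
  case True then show ?thesis using smoothstep'_outside by simp
next
  case False
  have "1 / 4 \<le> (s\<^sup>2 + (1 - s)\<^sup>2)\<^sup>2"
  proof -
    have "(s\<^sup>2 + (1 - s)\<^sup>2) = 1/2 + (2 * s - 1)\<^sup>2 / 2" by (simp add: power2_eq_square field_simps)
    then have "1/2 \<le> (s\<^sup>2 + (1 - s)\<^sup>2)" by simp
    from power_mono[OF this, of 2] show ?thesis by (simp add: power2_eq_square)
  qed
  moreover have "s * (1 - s) \<le> 1 / 4"
  proof -
    have "0 \<le> (2 * s - 1)\<^sup>2" by simp
    then show ?thesis by (simp add: power2_eq_square algebra_simps)
  qed
  moreover have "s * (1 - s)\<^sup>2 + (1 - s) * s\<^sup>2 = s * (1 - s)" by (simp add: power2_eq_square algebra_simps)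
  ultimately have "2 * (s * (1 - s)\<^sup>2 + (1 - s) * s\<^sup>2) \<le> 2 * (s\<^sup>2 + (1 - s)\<^sup>2)\<^sup>2"
    by (metis mult_left_mono order_trans zero_le_numeral)
  moreover have "0 < (s\<^sup>2 + (1 - s)\<^sup>2)\<^sup>2" using \<open>1/4 \<le> _\<close> by linarith
  ultimately show ?thesis using False
    by (simp add: smoothstep'_def pos_sq_simps(2) divide_le_eq)
qed

text \<open>A continuously differentiable bump, positive exactly on the ball of radius \<open>R\<close> around \<open>z\<close>. It is
  defined on the whole space and so needs no chart.\<close>

definition bump :: "'a::euclidean_space \<Rightarrow> real \<Rightarrow> 'a \<Rightarrow> real" where
  "bump z R x = pos_sq (R\<^sup>2 - (x - z) \<bullet> (x - z))"

definition bump_grad :: "'a::euclidean_space \<Rightarrow> real \<Rightarrow> 'a \<Rightarrow> 'a" where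
  "bump_grad z R x = (- 4 * max 0 (R\<^sup>2 - (x - z) \<bullet> (x - z))) *\<^sub>R (x - z)"

lemma bump_has_derivative: "(bump z R has_derivative (\<lambda>h. bump_grad z R x \<bullet> h)) (at x)"
proof -
  have "((\<lambda>x. R\<^sup>2 - (x - z) \<bullet> (x - z)) has_derivative (\<lambda>h. - 2 * ((x - z) \<bullet> h))) (at x)"
    by (auto intro!: derivative_eq_intros simp: inner_commute algebra_simps)
  from DERIV_compose_FDERIV[OF pos_sq_has_real_derivative this]
  show ?thesis unfolding bump_def bump_grad_def
    by (simp add: algebra_simps bump_def)
qed

lemma continuous_on_bump: "continuous_on A (bump z R)"
  and continuous_on_bump_grad: "continuous_on A (bump_grad z R)"
  unfolding bump_def bump_grad_def by (intro continuous_intros)+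

lemma bump_nonneg: "0 \<le> bump z R x"
  by (simp add: bump_def pos_sq_simps)

lemma bump_eq_0:
  assumes "0 \<le> R" "x \<notin> ball z R" shows "bump z R x = 0" "bump_grad z R x = 0"
proof -
  have "R \<le> norm (x - z)" using assms(2) by (simp add: dist_norm norm_minus_commute)
  then have "R\<^sup>2 \<le> (x - z) \<bullet> (x - z)"
    using assms(1) by (simp add: power2_norm_eq_inner[symmetric] power_mono)
  then show "bump z R x = 0" "bump_grad z R x = 0"
    by (auto simp: bump_def bump_grad_def pos_sq_simps max_def)
qed

lemma bump_pos: "x \<in> ball z R \<Longrightarrow> 0 < bump z R x"
  unfolding bump_def
  by (intro pos_sq_simps(4)) (simp add: power2_norm_eq_inner[symmetric] dist_norm norm_minus_commute
      power_strict_mono)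

section \<open>The divergence theorem for tangential fields\<close>

text \<open>\<open>X' b x\<close> is the derivative at \<open>x\<close> of the component \<open>X \<bullet> b\<close>. Continuity is
  asked of the diagonal entries \<open>X' b x b\<close>, which make up the divergence.\<close>

definition C1_field_on :: "'a::euclidean_space set \<Rightarrow> ('a \<Rightarrow> 'a) \<Rightarrow> ('a \<Rightarrow> 'a \<Rightarrow> 'a \<Rightarrow> real) \<Rightarrow> bool" where
  "C1_field_on V X X' \<longleftrightarrow> (\<forall>b\<in>Basis. (\<forall>x\<in>V. ((\<lambda>y. X y \<bullet> b) has_derivative X' b x) (at x)) \<and>
      continuous_on V (\<lambda>x. X' b x b))"

definition divergence :: "('a::euclidean_space \<Rightarrow> 'a \<Rightarrow> 'a \<Rightarrow> real) \<Rightarrow> 'a \<Rightarrow> real" where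
  "divergence X' x = (\<Sum>b\<in>Basis. X' b x b)"

lemma C1_field_on_subset: "C1_field_on V X X' \<Longrightarrow> W \<subseteq> V \<Longrightarrow> C1_field_on W X X'"
  unfolding C1_field_on_def by (meson continuous_on_subset subsetD)

lemma C1_field_on_continuous:
  assumes "C1_field_on V X X'" shows "continuous_on V X"
proof -
  have "continuous_on V (\<lambda>x. X x \<bullet> b)" if "b \<in> Basis" for b
    unfolding continuous_on_eq_continuous_within
  proof
    fix x assume "x \<in> V"
    then show "continuous (at x within V) (\<lambda>x. X x \<bullet> b)"
      using assms that has_derivative_continuous continuous_at_imp_continuous_at_within
      unfolding C1_field_on_def by blast
  qed
  then show ?thesis using continuous_on_componentwise by blast
qed

lemma continuous_on_divergence: "C1_field_on V X X' \<Longrightarrow> continuous_on V (divergence X')"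
  unfolding divergence_def C1_field_on_def by (intro continuous_on_sum) blast

lemma C1_field_on_scale:
  assumes "C1_field_on V X X'"
    and "\<And>x. x \<in> V \<Longrightarrow> (\<eta> has_derivative (\<lambda>h. E x \<bullet> h)) (at x)" "continuous_on V E"
  shows "C1_field_on V (\<lambda>x. \<eta> x *\<^sub>R X x) (\<lambda>b x h. \<eta> x * X' b x h + (E x \<bullet> h) * (X x \<bullet> b))"
    and "divergence (\<lambda>b x h. \<eta> x * X' b x h + (E x \<bullet> h) * (X x \<bullet> b)) = (\<lambda>x. \<eta> x * divergence X' x + E x \<bullet> X x)"
proof -
  have "continuous_on V \<eta>"
    unfolding continuous_on_eq_continuous_within
    using assms(2) has_derivative_continuous continuous_at_imp_continuous_at_within by blast
  moreover have "continuous_on V X" using assms(1) by (rule C1_field_on_continuous)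
  ultimately show "C1_field_on V (\<lambda>x. \<eta> x *\<^sub>R X x) (\<lambda>b x h. \<eta> x * X' b x h + (E x \<bullet> h) * (X x \<bullet> b))"
    using assms unfolding C1_field_on_def
    by (auto intro!: has_derivative_mult[THEN has_derivative_eq_rhs] continuous_intros)
  show "divergence (\<lambda>b x h. \<eta> x * X' b x h + (E x \<bullet> h) * (X x \<bullet> b)) = (\<lambda>x. \<eta> x * divergence X' x + E x \<bullet> X x)"
    unfolding divergence_def
    by (rule ext) (simp add: sum.distrib sum_distrib_left euclidean_inner[of "E _" "X _"])
qed

text \<open>A field that vanishes outside a compact subset of \<open>V\<close> extends by zero to the whole space without
  losing differentiability, so each component can be integrated there separately.\<close>

lemma integral_divergence_compact_support:
  fixes X :: "'a::euclidean_space \<Rightarrow> 'a"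
  assumes "open V" "C1_field_on V X X'" "compact C" "C \<subseteq> V" "\<And>x. x \<in> V - C \<Longrightarrow> X x = 0"
  shows "(LINT x:V|lborel. divergence X' x) = 0"
proof -
  have *: "integrable lborel (\<lambda>x. indicator V x * X' b x b) \<and> (\<integral>x. indicator V x * X' b x b \<partial>lborel) = 0"
    if b: "b \<in> Basis" for b
  proof -
    define f where "f x = (if x \<in> V then X x \<bullet> b else 0)" for x
    define g where "g x = indicator V x * X' b x b" for x
    have der: "(f has_derivative (if x \<in> V then X' b x else (\<lambda>_. 0))) (at x)" for x
    proof (cases "x \<in> C")
      case True
      then have x: "x \<in> V" using assms(4) by blast
      have "((\<lambda>y. X y \<bullet> b) has_derivative X' b x) (at x)" using assms(2) b x by (auto simp: C1_field_on_def)
      then have "(f has_derivative X' b x) (at x)"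
        by (rule has_derivative_transform_within_open[OF _ assms(1) x]) (simp add: f_def)
      then show ?thesis using x by simp
    next
      case False
      have 0: "(f has_derivative (\<lambda>_. 0)) (at x)"
        by (rule has_derivative_transform_within_open[of "\<lambda>_. 0" _ _ _ "- C"])
           (use False assms(3,5) in \<open>auto simp: f_def compact_imp_closed open_Compl\<close>)
      show ?thesis
      proof (cases "x \<in> V")
        case True
        have "((\<lambda>y. X y \<bullet> b) has_derivative X' b x) (at x)" using assms(2) b True by (auto simp: C1_field_on_def)
        then have "(f has_derivative X' b x) (at x)"
          by (rule has_derivative_transform_within_open[OF _ assms(1) True]) (simp add: f_def)
        then show ?thesis using True by simp
      qed (use 0 in simp)
    qed
    have g0: "g x = 0" if "x \<notin> C" for x
    proof -
      have "(f has_derivative (\<lambda>_. 0)) (at x)"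
        by (rule has_derivative_transform_within_open[of "\<lambda>_. 0" _ _ _ "- C"])
           (use that assms(3,5) in \<open>auto simp: f_def compact_imp_closed open_Compl\<close>)
      with der[of x] have "(if x \<in> V then X' b x else (\<lambda>_. 0)) = (\<lambda>_. 0)"
        by (rule has_derivative_unique)
      then show ?thesis by (auto simp: g_def indicator_def split: if_splits)
    qed
    have "continuous_on (V \<union> - C) g"
    proof (rule continuous_on_open_Un)
      show "continuous_on V g"
        using assms(2) b by (auto simp: g_def C1_field_on_def cong: continuous_on_cong)
      show "continuous_on (- C) g"
        by (rule continuous_on_eq[OF continuous_on_const[of _ 0]]) (simp add: g0)
    qed (use assms compact_imp_closed in auto)
    moreover have "V \<union> - C = UNIV" using assms(4) by auto
    ultimately have gc: "continuous_on UNIV g" by simp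
    have fc: "continuous_on UNIV f"
      unfolding continuous_on_eq_continuous_within using der has_derivative_continuous by blast
    have line: "((\<lambda>t. f (x + t *\<^sub>R b)) has_real_derivative g x) (at 0)" for x
    proof -
      have "((\<lambda>t. f (x + t *\<^sub>R b)) has_derivative (\<lambda>t. (if x \<in> V then X' b x else (\<lambda>_. 0)) (t *\<^sub>R b))) (at (0::real))"
        by (rule has_derivative_compose[of "\<lambda>t. x + t *\<^sub>R b" "\<lambda>t. t *\<^sub>R b" 0 UNIV f, simplified])
           (use der in \<open>auto intro!: derivative_eq_intros\<close>)
      moreover have lin: "linear (if x \<in> V then X' b x else (\<lambda>_. 0))"
        using der[of x] has_derivative_linear by blast
      then have "(\<lambda>t. (if x \<in> V then X' b x else (\<lambda>_. 0)) (t *\<^sub>R b)) = (*) (g x)"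
        by (auto simp: g_def linear_scale fun_eq_iff split: if_splits)
      ultimately show ?thesis
        unfolding has_field_derivative_def by (simp only:)
    qed
    have f0: "f x = 0" if "x \<notin> C" for x using that assms(5) by (auto simp: f_def)
    have "integrable lborel g" "integral\<^sup>L lborel g = 0"
      by (rule integral_directional_derivative_eq_0[OF assms(3) fc gc f0 g0 line]; assumption)+
    then show ?thesis by (simp add: g_def[abs_def])
  qed
  have "(LINT x:V|lborel. divergence X' x) = (\<integral>x. (\<Sum>b\<in>Basis. indicator V x * X' b x b) \<partial>lborel)"
    by (simp add: set_lebesgue_integral_def divergence_def sum_distrib_left)
  also have "\<dots> = (\<Sum>b\<in>Basis. \<integral>x. indicator V x * X' b x b \<partial>lborel)"
    using * by (intro Bochner_Integration.integral_sum) auto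
  finally show ?thesis using * by simp
qed

lemma smooth_on_partial_has_derivative:
  assumes "smooth_on S f" "x \<in> S" "set bs \<subseteq> Basis"
  shows "(partial_derivs bs f has_derivative (\<lambda>h. \<Sum>b\<in>Basis. (h \<bullet> b) * partial_derivs (b # bs) f x)) (at x)"
proof -
  let ?D = "frechet_derivative (partial_derivs bs f) (at x)"
  have D: "(partial_derivs bs f has_derivative ?D) (at x)"
    using assms by (simp add: smooth_on_def frechet_derivative_works[symmetric])
  have "?D h = (\<Sum>b\<in>Basis. (h \<bullet> b) * ?D b)" for h
    by (subst euclidean_representation[of h, symmetric], subst linear_sum[OF has_derivative_linear[OF D]])
       (simp add: linear_scale[OF has_derivative_linear[OF D]])
  then have "?D = (\<lambda>h. \<Sum>b\<in>Basis. (h \<bullet> b) * ?D b)" by blast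
  with D show ?thesis by simp
qed

lemma gradient_inner_Basis: "b \<in> Basis \<Longrightarrow> gradient f x \<bullet> b = partial_derivs [b] f x"
  unfolding gradient_def by simp

lemma smooth_on_has_gradient:
  assumes "smooth_on S f" "x \<in> S"
  shows "(f has_derivative (\<lambda>h. gradient f x \<bullet> h)) (at x)"
proof -
  have "(\<lambda>h. gradient f x \<bullet> h) = (\<lambda>h. \<Sum>b\<in>Basis. (h \<bullet> b) * partial_derivs [b] f x)"
    by (rule ext, subst euclidean_inner) (simp add: gradient_inner_Basis mult.commute)
  then show ?thesis using smooth_on_partial_has_derivative[OF assms, of "[]"] by simp
qed

lemma smooth_on_continuous_partial:
  assumes "smooth_on S f" "set bs \<subseteq> Basis"
  shows "continuous_on S (partial_derivs bs f)"
  unfolding continuous_on_eq_continuous_within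
  using smooth_on_partial_has_derivative[OF assms(1) _ assms(2)] has_derivative_continuous
    continuous_at_imp_continuous_at_within by blast

lemma smooth_on_continuous_gradient: "smooth_on S f \<Longrightarrow> continuous_on S (gradient f)"
  unfolding gradient_def
  by (intro continuous_intros smooth_on_continuous_partial) auto

lemma bounded_if_vanishing_outside_compact:
  fixes f :: "'a::euclidean_space \<Rightarrow> real"
  assumes "continuous_on K f" "compact K" "\<And>x. x \<in> V - K \<Longrightarrow> f x = 0"
  obtains B where "0 \<le> B" "\<And>x. x \<in> V \<union> K \<Longrightarrow> \<bar>f x\<bar> \<le> B"
proof -
  have "compact (f ` K)" using assms by (simp add: compact_continuous_image)
  then obtain B where "\<And>x. x \<in> K \<Longrightarrow> \<bar>f x\<bar> \<le> B"
    using compact_imp_bounded bounded_iff by (metis imageI real_norm_def)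
  then have "\<bar>f x\<bar> \<le> \<bar>B\<bar>" if "x \<in> V \<union> K" for x
    using assms(3)[of x] that by (cases "x \<in> K") force+
  then show ?thesis using that by (meson abs_ge_zero)
qed

text \<open>The integrand is the divergence of the field multiplied by the bump. By partition of unity, the
  divergence theorem follows once this integral vanishes for one radius around each point of the
  closure.\<close>

definition localized_divergence_vanishes :: "'a::euclidean_space set \<Rightarrow> ('a \<Rightarrow> 'a) \<Rightarrow> ('a \<Rightarrow> 'a \<Rightarrow> 'a \<Rightarrow> real) \<Rightarrow> 'a \<Rightarrow> real \<Rightarrow> bool" where
  "localized_divergence_vanishes \<Omega> X X' z R \<longleftrightarrow>
     (LINT x:\<Omega>|lborel. bump z R x * divergence X' x + bump_grad z R x \<bullet> X x) = 0"

lemma localized_divergence_interior: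
  assumes "open \<Omega>" "z \<in> \<Omega>"
  obtains R where "0 < R" "\<And>X X'. C1_field_on \<Omega> X X' \<Longrightarrow> localized_divergence_vanishes \<Omega> X X' z R"
proof -
  obtain R where R: "0 < R" "cball z R \<subseteq> \<Omega>" using assms open_contains_cball by blast
  have "localized_divergence_vanishes \<Omega> X X' z R" if "C1_field_on \<Omega> X X'" for X X'
    using integral_divergence_compact_support[OF assms(1)
        C1_field_on_scale(1)[OF that bump_has_derivative continuous_on_bump_grad, of z R] compact_cball[of z R]] R bump_eq_0(1)[of R _ z]
    unfolding localized_divergence_vanishes_def C1_field_on_scale(2)[OF that bump_has_derivative continuous_on_bump_grad]
    by auto
  then show ?thesis using that R(1) by blast
qed

text \<open>Near a boundary point with defining function \<open>\<phi>\<close>, multiply the bump by a cutoff \<open>\<eta> k\<close>, a smooth step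
  of \<open>- k * \<phi> - 1\<close>. The product has compact support in \<open>\<Omega>\<close>, so the divergence theorem holds for it, and
  as \<open>k\<close> grows the only error term is the integral of the flux of \<open>X\<close> through the transition layer,
  where the gradient of \<open>\<eta> k\<close> is of order \<open>k\<close>. That layer shrinks to the boundary, where the flux density
  \<open>X \<bullet> \<nabla>\<phi>\<close> is zero; so it is enough that the integral of the size of \<open>\<nabla>(\<eta> k)\<close> stays bounded. This needs
  no estimate of the volume of the layer: the gradient of \<open>\<eta> k\<close> has positive component along a fixed
  vector, and the integral of that component is bounded by applying the same compact support
  identity to a constant field. The radius \<open>R\<close> depends on \<open>\<phi>\<close> only, not on \<open>X\<close>.\<close>

lemma localized_divergence_chart:
  fixes \<Omega> :: "'a::euclidean_space set"
  assumes "open \<Omega>" "bounded \<Omega>" and chart: "local_defining_function \<Omega> z U \<phi>"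
  obtains R where "0 < R" "\<And>X X' B. C1_field_on \<Omega> X X' \<Longrightarrow> continuous_on (closure \<Omega>) X \<Longrightarrow>
      (\<And>x. x \<in> \<Omega> \<Longrightarrow> \<bar>divergence X' x\<bar> \<le> B) \<Longrightarrow>
      (\<And>y. y \<in> frontier \<Omega> \<inter> U \<Longrightarrow> gradient \<phi> y \<noteq> 0 \<Longrightarrow> X y \<bullet> gradient \<phi> y = 0) \<Longrightarrow>
      localized_divergence_vanishes \<Omega> X X' z R"
proof -
  have U: "open U" "z \<in> U" "smooth_on U \<phi>" and g0: "gradient \<phi> z \<noteq> 0"
    and \<Omega>U: "\<Omega> \<inter> U = {y \<in> U. \<phi> y < 0}"
    using chart by (auto simp: local_defining_function_def)
  define a where "a = gradient \<phi> z"
  define \<Phi> where "\<Phi> = gradient \<phi>"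
  have \<Phi>c: "continuous_on U \<Phi>" using U smooth_on_continuous_gradient by (auto simp: \<Phi>_def)
  have \<phi>d: "(\<phi> has_derivative (\<lambda>h. \<Phi> x \<bullet> h)) (at x)" if "x \<in> U" for x
    using smooth_on_has_gradient[OF U(3) that] by (simp add: \<Phi>_def)
  have \<phi>c: "continuous_on U \<phi>" using smooth_on_continuous_partial[OF U(3), of "[]"] by simp
  define c where "c = (a \<bullet> a) / 2"
  have c: "0 < c" using g0 by (simp add: c_def a_def)
  have "open {x \<in> U. c < \<Phi> x \<bullet> a}"
  proof -
    have "continuous_on U (\<lambda>x. \<Phi> x \<bullet> a)" using \<Phi>c by (intro continuous_intros)
    from continuous_open_preimage[OF this U(1) open_greaterThan[of c]]
    moreover have "U \<inter> (\<lambda>x. \<Phi> x \<bullet> a) -` {c<..} = {x \<in> U. c < \<Phi> x \<bullet> a}" by auto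
    ultimately show ?thesis by simp
  qed
  moreover have "z \<in> {x \<in> U. c < \<Phi> x \<bullet> a}"
  proof -
    have "c < a \<bullet> a" using c unfolding c_def by linarith
    then show ?thesis using U(2) by (simp add: \<Phi>_def a_def)
  qed
  ultimately obtain R where R: "0 < R" "cball z R \<subseteq> {x \<in> U. c < \<Phi> x \<bullet> a}"
    using open_contains_cball by blast
  then have RU: "cball z R \<subseteq> U" and Rc: "\<And>x. x \<in> cball z R \<Longrightarrow> c < \<Phi> x \<bullet> a" by auto
  let ?b = "bump z R" and ?bg = "bump_grad z R"
  have b0: "?b x = 0" "?bg x = 0" if "x \<notin> cball z R" for x
    using bump_eq_0[of R x z] R(1) that by auto
  define V where "V = \<Omega> \<inter> U"
  have V: "open V" "bounded V" "V \<subseteq> U" "V \<subseteq> \<Omega>" "V \<in> sets borel"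
    using assms(1,2) U(1) by (auto simp: V_def bounded_Int)
  have Vneg: "\<phi> x < 0" if "x \<in> V" for x using that \<Omega>U by (auto simp: V_def)
  \<comment> \<open>\<open>- S k\<close> is the derivative of the cutoff with respect to \<open>\<phi>\<close>; it is supported in the layer \<open>- 2 / k \<le> \<phi> \<le> - 1 / k\<close>.\<close>
  define \<eta> where "\<eta> k x = smoothstep (- real k * \<phi> x - 1)" for k x
  define S where "S k x = real k * smoothstep' (- real k * \<phi> x - 1)" for k x
  have \<eta>c: "continuous_on U (\<eta> k)" and Sc: "continuous_on U (S k)" for k
    unfolding \<eta>_def S_def using \<phi>c by (auto intro!: continuous_intros)
  note cs = continuous_on_subset[OF \<eta>c V(3)] continuous_on_subset[OF Sc V(3)] continuous_on_subset[OF \<Phi>c V(3)]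
  have S0: "0 \<le> S k x" for k x by (simp add: S_def smoothstep'_nonneg)
  have \<eta>d: "(\<eta> k has_derivative (\<lambda>h. (- S k x *\<^sub>R \<Phi> x) \<bullet> h)) (at x)" if "x \<in> U" for k x
  proof -
    have "((\<lambda>x. - real k * \<phi> x - 1) has_derivative (\<lambda>h. - real k * (\<Phi> x \<bullet> h))) (at x)"
      using \<phi>d[OF that] by (auto intro!: derivative_eq_intros)
    from DERIV_compose_FDERIV[OF smoothstep_has_real_derivative this]
    show ?thesis unfolding \<eta>_def S_def by (simp add: algebra_simps)
  qed
  define \<psi> where "\<psi> k x = ?b x * \<eta> k x" for k x
  define G where "G k x = \<eta> k x *\<^sub>R ?bg x - (?b x * S k x) *\<^sub>R \<Phi> x" for k x
  have \<psi>d: "(\<psi> k has_derivative (\<lambda>h. G k x \<bullet> h)) (at x)" if "x \<in> V" for k x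
  proof -
    have "x \<in> U" using that V by auto
    from has_derivative_mult[OF bump_has_derivative \<eta>d[OF this]]
    show ?thesis unfolding \<psi>_def G_def by (simp add: algebra_simps)
  qed
  have Gc: "continuous_on V (G k)" for k
    unfolding G_def
    by (intro continuous_intros continuous_on_bump continuous_on_bump_grad cs)
  have IBP: "(LINT x:V|lborel. \<psi> k x * divergence Y' x + G k x \<bullet> Y x) = 0"
    if "C1_field_on V Y Y'" for k Y Y'
  proof -
    define C where "C = cball z R \<inter> \<phi> -` {x. 1 \<le> - real k * x}"
    have "closed {x. 1 \<le> - real k * x}" by (intro closed_Collect_le continuous_intros)
    then have "closed C" unfolding C_def using \<phi>c RU
      by (intro continuous_closed_preimage[rotated, OF closed_cball]) (auto intro: continuous_on_subset)
    moreover have "C \<subseteq> cball z R" by (auto simp: C_def)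
    ultimately have "compact C" using bounded_subset[OF bounded_cball] compact_eq_bounded_closed by blast
    moreover have "C \<subseteq> V"
    proof
      fix x assume x: "x \<in> C"
      then have "1 \<le> - real k * \<phi> x" by (simp add: C_def)
      then have "\<phi> x < 0" by (smt (verit) mult_nonneg_nonneg of_nat_0_le_iff mult_minus_left)
      then show "x \<in> V" using x RU \<Omega>U unfolding V_def C_def by blast
    qed
    moreover have "\<psi> k x *\<^sub>R Y x = 0" if "x \<in> V - C" for x
    proof (cases "x \<in> cball z R")
      case True
      then have "\<eta> k x = 0" using that by (auto simp: C_def \<eta>_def intro!: smoothstep_le_0)
      then show ?thesis by (simp add: \<psi>_def)
    qed (simp add: \<psi>_def b0)
    ultimately have "(LINT x:V|lborel. divergence (\<lambda>b x h. \<psi> k x * Y' b x h + (G k x \<bullet> h) * (Y x \<bullet> b)) x) = 0"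
      by (intro integral_divergence_compact_support[OF V(1) C1_field_on_scale(1)[OF that \<psi>d Gc]])
    then show ?thesis
      by (simp add: C1_field_on_scale(2)[OF that \<psi>d Gc])
  qed
  have \<eta>01: "0 \<le> \<eta> k x" "\<eta> k x \<le> 1" for k x by (auto simp: \<eta>_def smoothstep_bounds)
  have bint: "set_integrable lborel V f" if fg: "continuous_on V f" "continuous_on U g" "\<And>x. x \<in> V \<Longrightarrow> \<bar>f x\<bar> \<le> g x * B"
     "\<And>x. x \<notin> cball z R \<Longrightarrow> g x = 0" "0 \<le> B" for f g :: "'a \<Rightarrow> real" and B
  proof -
    have "continuous_on (cball z R) g" using fg(2) RU by (rule continuous_on_subset)
    then obtain A where A': "0 \<le> A" "\<And>x. x \<in> U \<union> cball z R \<Longrightarrow> \<bar>g x\<bar> \<le> A"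
      using bounded_if_vanishing_outside_compact[of "cball z R" g U] fg(4) by auto
    then have A: "g x \<le> A" if "x \<in> V" for x using A'(2)[of x] that V(3) by force
    show ?thesis
    proof (rule set_integrable_bounded_continuous[OF V(5,2) fg(1)])
      fix x assume "x \<in> V"
      then have "\<bar>f x\<bar> \<le> g x * B" using fg(3) by simp
      also have "\<dots> \<le> A * B" using A[OF \<open>x \<in> V\<close>] fg(5) by (intro mult_right_mono)
      finally show "\<bar>f x\<bar> \<le> A * B" .
    qed
  qed
  define J where "J k = (LINT x:V|lborel. ?b x * S k x * (\<Phi> x \<bullet> a))" for k
  define Q where "Q = (LINT x:V|lborel. \<bar>?bg x \<bullet> a\<bar>)"
  have contb: "continuous_on A ?b" "continuous_on A ?bg" for A
    by (auto simp: continuous_on_bump continuous_on_bump_grad)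
  have Jint: "set_integrable lborel V (\<lambda>x. ?b x * S k x * (\<Phi> x \<bullet> a))" for k
    by (rule bint[where g="\<lambda>x. \<bar>?b x * S k x * (\<Phi> x \<bullet> a)\<bar>" and B=1])
       (auto intro!: continuous_intros contb cs Sc \<Phi>c simp: b0)
  \<comment> \<open>The constant field \<open>a\<close> bounds the total variation of the cutoff independently of \<open>k\<close>.\<close>
  have JQ: "J k \<le> Q" for k
  proof -
    have "C1_field_on V (\<lambda>_. a) (\<lambda>_ _ _. 0)" by (auto simp: C1_field_on_def)
    from IBP[OF this, of k]
    have 0: "(LINT x:V|lborel. \<eta> k x * (?bg x \<bullet> a) - ?b x * S k x * (\<Phi> x \<bullet> a)) = 0"
      by (simp add: divergence_def G_def inner_diff_left)
    have i1: "set_integrable lborel V (\<lambda>x. \<eta> k x * (?bg x \<bullet> a))"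
    proof (rule bint[where g="\<lambda>x. \<bar>?bg x \<bullet> a\<bar>" and B=1])
      show "\<bar>\<eta> k x * (?bg x \<bullet> a)\<bar> \<le> \<bar>?bg x \<bullet> a\<bar> * 1" for x
        using \<eta>01[of k x] mult_left_le_one_le[of "\<bar>?bg x \<bullet> a\<bar>" "\<eta> k x"] by (simp add: abs_mult)
    qed (intro continuous_intros contb cs, intro continuous_intros contb, simp_all add: b0)
    have i2: "set_integrable lborel V (\<lambda>x. \<bar>?bg x \<bullet> a\<bar>)"
      by (rule bint[where g="\<lambda>x. \<bar>?bg x \<bullet> a\<bar>" and B=1])
         (auto intro!: continuous_intros contb simp: b0)
    have "J k = (LINT x:V|lborel. \<eta> k x * (?bg x \<bullet> a))"
      using 0 set_integral_diff(2)[OF i1 Jint[of k]] by (simp add: J_def)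
    also have "\<dots> \<le> Q" unfolding Q_def
    proof (rule set_integral_mono[OF i1 i2])
      fix x assume "x \<in> V"
      have "\<eta> k x * (?bg x \<bullet> a) \<le> \<eta> k x * \<bar>?bg x \<bullet> a\<bar>" using \<eta>01 by (intro mult_left_mono) auto
      also have "\<dots> \<le> \<bar>?bg x \<bullet> a\<bar>" using \<eta>01 by (intro mult_left_le_one_le) auto
      finally show "\<eta> k x * (?bg x \<bullet> a) \<le> \<bar>?bg x \<bullet> a\<bar>" .
    qed
    finally show ?thesis .
  qed
  have "localized_divergence_vanishes \<Omega> X X' z R"
    if X: "C1_field_on \<Omega> X X'" and Xc: "continuous_on (closure \<Omega>) X"
      and B: "\<And>x. x \<in> \<Omega> \<Longrightarrow> \<bar>divergence X' x\<bar> \<le> B"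
      and tan: "\<And>y. y \<in> frontier \<Omega> \<inter> U \<Longrightarrow> gradient \<phi> y \<noteq> 0 \<Longrightarrow> X y \<bullet> gradient \<phi> y = 0" for X X' B
  proof -
    have XV: "C1_field_on V X X'" using X V C1_field_on_subset by blast
    have XVc: "continuous_on V X" and DVc: "continuous_on V (divergence X')"
      using XV C1_field_on_continuous continuous_on_divergence by auto
    have ccl: "compact (closure \<Omega>)" using assms(2) by simp
    obtain A where "\<And>x. x \<in> closure \<Omega> \<Longrightarrow> norm (X x) \<le> A"
      using compact_continuous_image[OF Xc ccl] compact_imp_bounded bounded_iff by (metis imageI)
    then have A: "norm (X x) \<le> \<bar>A\<bar>" if "x \<in> V" for x
      using that V(4) closure_subset by (meson abs_ge_self order_trans subset_iff)
    define h where "h x = ?b x * divergence X' x + ?bg x \<bullet> X x" for x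
    have hc: "continuous_on V h" unfolding h_def by (intro continuous_intros contb XVc DVc)
    have hb: "\<bar>h x\<bar> \<le> (?b x + norm (?bg x)) * (\<bar>B\<bar> + \<bar>A\<bar>)" if "x \<in> V" for x
    proof -
      have "\<bar>?b x * divergence X' x\<bar> \<le> ?b x * \<bar>B\<bar>"
        using B[of x] that V(4) bump_nonneg[of z R x] by (auto simp: abs_mult intro!: mult_left_mono intro: order_trans)
      moreover have "\<bar>?bg x \<bullet> X x\<bar> \<le> norm (?bg x) * \<bar>A\<bar>"
        using Cauchy_Schwarz_ineq2[of "?bg x" "X x"] A[OF that] by (meson mult_left_mono norm_ge_zero order_trans)
      moreover have "0 \<le> ?b x * \<bar>A\<bar>" "0 \<le> norm (?bg x) * \<bar>B\<bar>" using bump_nonneg[of z R x] by auto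
      ultimately show ?thesis unfolding h_def distrib_left distrib_right by linarith
    qed
    define I where "I k = (LINT x:V|lborel. \<eta> k x * h x)" for k
    have hint: "set_integrable lborel V h"
      by (rule bint[OF hc _ hb]) (auto intro!: continuous_intros contb simp: b0)
    have \<eta>le: "\<bar>\<eta> k x * h x\<bar> \<le> \<bar>h x\<bar>" for k x
      using \<eta>01[of k x] by (simp add: abs_mult mult_left_le_one_le)
    have \<eta>hint: "set_integrable lborel V (\<lambda>x. \<eta> k x * h x)" for k
      by (rule bint[where g="\<lambda>x. ?b x + norm (?bg x)" and B="\<bar>B\<bar> + \<bar>A\<bar>"])
         (intro continuous_intros cs hc, intro continuous_intros contb, rule order_trans[OF \<eta>le hb], simp_all add: b0)
      have fluxint: "set_integrable lborel V (\<lambda>x. ?b x * S k x * (\<Phi> x \<bullet> X x))" for k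
      proof (rule bint[where g="\<lambda>x. ?b x * S k x * norm (\<Phi> x)" and B="\<bar>A\<bar>"])
        fix x assume "x \<in> V"
        have "\<bar>\<Phi> x \<bullet> X x\<bar> \<le> norm (\<Phi> x) * \<bar>A\<bar>"
          using Cauchy_Schwarz_ineq2[of "\<Phi> x" "X x"] A[OF \<open>x \<in> V\<close>] by (meson mult_left_mono norm_ge_zero order_trans)
        then show "\<bar>?b x * S k x * (\<Phi> x \<bullet> X x)\<bar> \<le> ?b x * S k x * norm (\<Phi> x) * \<bar>A\<bar>"
          using bump_nonneg[of z R x] S0[of k x] by (simp add: abs_mult mult.assoc mult_left_mono)
      qed (auto intro!: continuous_intros contb cs XVc Sc \<Phi>c simp: b0)
    have Ieq: "I k = (LINT x:V|lborel. ?b x * S k x * (\<Phi> x \<bullet> X x))" for k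
    proof -
      have 0: "(LINT x:V|lborel. \<eta> k x * h x - ?b x * S k x * (\<Phi> x \<bullet> X x)) = 0"
        using IBP[OF XV, of k] by (simp add: h_def \<psi>_def G_def inner_diff_left algebra_simps)
      show ?thesis using 0 set_integral_diff(2)[OF \<eta>hint[of k] fluxint[of k]] by (simp add: I_def)
    qed
    have small: "\<exists>k0. \<forall>k\<ge>k0. \<bar>I k\<bar> \<le> \<omega> / c * Q" if \<omega>: "0 < \<omega>" for \<omega>
    proof -
      have xc: "continuous_on (closure \<Omega> \<inter> cball z R) (\<lambda>x. \<bar>\<Phi> x \<bullet> X x\<bar>)"
        using RU by (intro continuous_intros continuous_on_subset[OF \<Phi>c] continuous_on_subset[OF Xc]) auto
      \<comment> \<open>\<open>\<phi>\<close> is negative on the compact set of points with flux density at least \<open>\<omega>\<close>, hence bounded away from 0 there: the layer misses this set when \<open>k\<close> is large.\<close>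
      define K where "K = (closure \<Omega> \<inter> cball z R) \<inter> (\<lambda>x. \<bar>\<Phi> x \<bullet> X x\<bar>) -` {\<omega>..}"
      have "closed K" unfolding K_def
        by (rule continuous_closed_preimage[OF xc]) auto
      moreover have "K \<subseteq> cball z R" by (auto simp: K_def)
      ultimately have Kc: "compact K" using bounded_subset[OF bounded_cball] compact_eq_bounded_closed by blast
      have Kneg: "\<phi> x < 0" if x: "x \<in> K" for x
      proof (rule ccontr)
        assume "\<not> \<phi> x < 0"
        moreover have "x \<in> U" using x RU by (auto simp: K_def)
        ultimately have "x \<notin> \<Omega>" using \<Omega>U by blast
        then have "x \<in> frontier \<Omega> \<inter> U" using x \<open>x \<in> U\<close> assms(1) by (auto simp: K_def frontier_def interior_open)
        moreover have "\<Phi> x \<noteq> 0" using Rc[of x] x c by (auto simp: K_def)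
        ultimately have "X x \<bullet> \<Phi> x = 0" using tan by (simp add: \<Phi>_def)
        then show False using x \<omega> by (simp add: K_def inner_commute)
      qed
      obtain m where m: "m < 0" "\<And>x. x \<in> K \<Longrightarrow> \<phi> x \<le> m"
      proof (cases "K = {}")
        case True then show ?thesis using that[of "-1"] by auto
      next
        case False
        have "continuous_on K \<phi>" using RU by (intro continuous_on_subset[OF \<phi>c]) (auto simp: K_def)
        from continuous_attains_sup[OF Kc False this] show ?thesis using that Kneg by blast
      qed
      obtain k0 :: nat where k0: "2 / (- m) < real k0" using reals_Archimedean2 by blast
      have "\<bar>I k\<bar> \<le> \<omega> / c * Q" if "k0 \<le> k" for k
      proof -
        have k: "2 \<le> - real k * m"
        proof -
          have "2 < real k0 * (- m)" using iffD1[OF pos_divide_less_eq k0] m(1) by linarith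
          also have "\<dots> \<le> real k * (- m)" using that m(1) by (intro mult_right_mono) auto
          finally show ?thesis by simp
        qed
        have "norm (I k) \<le> (LINT x:V|lborel. \<omega> / c * (?b x * S k x * (\<Phi> x \<bullet> a)))"
          unfolding Ieq set_lebesgue_integral_def
        proof (rule Bochner_Integration.integral_norm_bound_integral)
          show "integrable lborel (\<lambda>x. indicat_real V x *\<^sub>R (?b x * S k x * (\<Phi> x \<bullet> X x)))"
            using fluxint[of k] by (simp add: set_integrable_def)
          show "integrable lborel (\<lambda>x. indicat_real V x *\<^sub>R (\<omega> / c * (?b x * S k x * (\<Phi> x \<bullet> a))))"
            using set_integrable_mult_right[OF Jint, of "\<omega>/c" k] by (simp add: set_integrable_def)
          fix x
          have "\<bar>?b x * S k x * (\<Phi> x \<bullet> X x)\<bar> \<le> \<omega> / c * (?b x * S k x * (\<Phi> x \<bullet> a))" if xV: "x \<in> V"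
          proof (cases "x \<in> cball z R \<and> S k x \<noteq> 0")
            case False then show ?thesis using b0 by auto
          next
            case True
            then have "smoothstep' (- real k * \<phi> x - 1) \<noteq> 0" by (auto simp: S_def)
            then have "- real k * \<phi> x - 1 < 1" using smoothstep'_outside by (meson linorder_not_le)
            then have "real k * m < real k * \<phi> x" using k by simp
            then have "m < \<phi> x" by (simp add: mult_less_cancel_left)
            then have "x \<notin> K" using m(2) by force
            then have "\<bar>\<Phi> x \<bullet> X x\<bar> \<le> \<omega>" using True xV V(4) closure_subset by (auto simp: K_def)
            also have "\<dots> \<le> \<omega> / c * (\<Phi> x \<bullet> a)" using Rc[of x] True \<omega> c by (simp add: field_simps)
            finally have "?b x * S k x * \<bar>\<Phi> x \<bullet> X x\<bar> \<le> ?b x * S k x * (\<omega> / c * (\<Phi> x \<bullet> a))"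
              using bump_nonneg[of z R x] S0[of k x] by (intro mult_left_mono) auto
            then show ?thesis using bump_nonneg[of z R x] S0[of k x] by (simp add: abs_mult algebra_simps)
          qed
          then show "norm (indicat_real V x *\<^sub>R (?b x * S k x * (\<Phi> x \<bullet> X x)))
            \<le> indicat_real V x *\<^sub>R (\<omega> / c * (?b x * S k x * (\<Phi> x \<bullet> a)))"
            by (auto simp: indicator_def)
        qed
        also have "\<dots> = \<omega> / c * J k" unfolding J_def by simp
        also have "\<dots> \<le> \<omega> / c * Q" using JQ[of k] \<omega> c by (intro mult_left_mono) auto
        finally show ?thesis by simp
      qed
      then show ?thesis by blast
    qed
    have Q0: "0 \<le> Q" unfolding Q_def set_lebesgue_integral_def by (rule integral_nonneg_AE) auto
    have "I \<longlonglongrightarrow> 0"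
    proof (rule LIMSEQ_I)
      fix r :: real assume r: "0 < r"
      obtain k0 where k0: "\<forall>k\<ge>k0. \<bar>I k\<bar> \<le> (r * c / (2 * (Q + 1))) / c * Q"
        using small[of "r * c / (2 * (Q + 1))"] r c Q0 by auto
      have "(r * c / (2 * (Q + 1))) / c * Q < r"
      proof -
        have "(r * c / (2 * (Q + 1))) / c * Q = r * (Q / (2 * (Q + 1)))" using c by simp
        also have "\<dots> < r * 1" using r Q0 by (intro mult_strict_left_mono) (auto simp: divide_less_eq)
        finally show ?thesis by simp
      qed
      then show "\<exists>no. \<forall>n\<ge>no. norm (I n - 0) < r" using k0 by (auto intro: le_less_trans)
    qed
    moreover have "I \<longlonglongrightarrow> (LINT x:V|lborel. h x)"
      unfolding I_def set_lebesgue_integral_def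
    proof (rule integral_dominated_convergence[where w="\<lambda>x. \<bar>indicat_real V x *\<^sub>R h x\<bar>"])
      show "(\<lambda>x. indicat_real V x *\<^sub>R h x) \<in> borel_measurable lborel"
        "integrable lborel (\<lambda>x. \<bar>indicat_real V x *\<^sub>R h x\<bar>)"
        using hint by (auto simp: set_integrable_def)
      show "(\<lambda>x. indicat_real V x *\<^sub>R (\<eta> k x * h x)) \<in> borel_measurable lborel" for k
        using \<eta>hint[of k] by (auto simp: set_integrable_def)
      show "AE x in lborel. norm (indicat_real V x *\<^sub>R (\<eta> k x * h x)) \<le> \<bar>indicat_real V x *\<^sub>R h x\<bar>" for k
        using \<eta>01[of k] by (intro AE_I2) (auto simp: indicator_def abs_mult intro!: mult_left_le_one_le)
      show "AE x in lborel. (\<lambda>k. indicat_real V x *\<^sub>R (\<eta> k x * h x)) \<longlonglongrightarrow> indicat_real V x *\<^sub>R h x"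
      proof (rule AE_I2)
        fix x
        show "(\<lambda>k. indicat_real V x *\<^sub>R (\<eta> k x * h x)) \<longlonglongrightarrow> indicat_real V x *\<^sub>R h x"
        proof (cases "x \<in> V")
          case True
          obtain k0 :: nat where k0: "2 / (- \<phi> x) < real k0" using reals_Archimedean2 by blast
          have "\<eta> k x = 1" if "k0 \<le> k" for k
          proof -
            have "2 < real k0 * (- \<phi> x)" using iffD1[OF pos_divide_less_eq k0] Vneg[OF True] by linarith
            also have "\<dots> \<le> real k * (- \<phi> x)" using that Vneg[OF True] by (intro mult_right_mono) auto
            finally show ?thesis by (simp add: \<eta>_def smoothstep_ge_1)
          qed
          then have "\<forall>\<^sub>F k in sequentially. indicat_real V x *\<^sub>R (\<eta> k x * h x) = indicat_real V x *\<^sub>R h x"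
            by (auto simp: eventually_sequentially)
          then show ?thesis by (rule tendsto_eventually)
        qed auto
      qed
    qed
    ultimately have "(LINT x:V|lborel. h x) = 0" using LIMSEQ_unique by blast
    moreover have "h x = 0" if "x \<notin> U" for x
    proof -
      have "x \<notin> cball z R" using that RU by blast
      then show ?thesis by (simp add: h_def b0)
    qed
    then have "(\<lambda>x. indicat_real \<Omega> x *\<^sub>R h x) = (\<lambda>x. indicat_real V x *\<^sub>R h x)"
      by (auto simp: V_def indicator_def fun_eq_iff)
    ultimately show ?thesis
      unfolding localized_divergence_vanishes_def set_lebesgue_integral_def h_def by simp
  qed
  then show ?thesis using that R(1) by blast
qed

lemma set_integrable_continuous_closure:
  fixes f :: "'a::euclidean_space \<Rightarrow> real"
  assumes "open \<Omega>" "bounded \<Omega>" "continuous_on (closure \<Omega>) g" "\<And>x. x \<in> \<Omega> \<Longrightarrow> f x = g x"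
  shows "set_integrable lborel \<Omega> f"
proof -
  have "compact (closure \<Omega>)" using assms(2) by simp
  then obtain B where B: "\<And>x. x \<in> closure \<Omega> \<Longrightarrow> norm (g x) \<le> B"
    using continuous_on_compact_bound[OF _ assms(3)] by blast
  show ?thesis
  proof (rule set_integrable_bounded_continuous[where B=B])
    show "continuous_on \<Omega> f"
      by (rule continuous_on_eq[OF continuous_on_subset[OF assms(3) closure_subset]]) (simp add: assms(4))
    show "\<bar>f x\<bar> \<le> B" if "x \<in> \<Omega>" for x
      using B[of x] that closure_subset[of \<Omega>] assms(4)[OF that] by auto
  qed (use assms in auto)
qed

text \<open>Instead of normalizing the bumps to a partition of unity, the field is divided by their sum \<open>N\<close>;
  the localized identities for \<open>X / N\<close> then add up to the divergence of \<open>X\<close>.\<close>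

theorem integral_divergence_tangential_eq_0:
  fixes \<Omega> :: "'a::euclidean_space set"
  assumes dom: "bounded_smooth_domain \<Omega>" and X: "C1_field_on \<Omega> X X'"
    and Xc: "continuous_on (closure \<Omega>) X"
    and D: "continuous_on (closure \<Omega>) D" "\<And>x. x \<in> \<Omega> \<Longrightarrow> divergence X' x = D x"
    and tan: "\<And>y U \<phi>. y \<in> frontier \<Omega> \<Longrightarrow> local_defining_function \<Omega> y U \<phi> \<Longrightarrow> X y \<bullet> gradient \<phi> y = 0"
  shows "(LINT x:\<Omega>|lborel. divergence X' x) = 0"
proof -
  have \<Omega>: "open \<Omega>" "bounded \<Omega>" using dom by (auto simp: bounded_smooth_domain_def)
  have ccl: "compact (closure \<Omega>)" using \<Omega> by simp
  have bdd: "\<exists>B. \<forall>x\<in>\<Omega>. \<bar>f x\<bar> \<le> B" if "continuous_on (closure \<Omega>) f" for f :: "'a \<Rightarrow> real"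
    using continuous_on_compact_bound[OF ccl that] closure_subset[of \<Omega>] by (metis real_norm_def subsetD)
  have "\<exists>R>0. \<forall>X X' B. C1_field_on \<Omega> X X' \<longrightarrow> continuous_on (closure \<Omega>) X \<longrightarrow>
      (\<forall>x\<in>\<Omega>. \<bar>divergence X' x\<bar> \<le> B) \<longrightarrow>
      (\<forall>y\<in>frontier \<Omega>. \<forall>U \<phi>. local_defining_function \<Omega> y U \<phi> \<longrightarrow> X y \<bullet> gradient \<phi> y = 0) \<longrightarrow>
      localized_divergence_vanishes \<Omega> X X' z R" if z: "z \<in> closure \<Omega>" for z
  proof (cases "z \<in> \<Omega>")
    case True
    obtain R where "0 < R" "\<And>X X'. C1_field_on \<Omega> X X' \<Longrightarrow> localized_divergence_vanishes \<Omega> X X' z R"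
      using localized_divergence_interior[OF \<Omega>(1) True] by blast
    then show ?thesis by blast
  next
    case False
    then have "z \<in> frontier \<Omega>" using z \<Omega>(1) by (simp add: frontier_def interior_open)
    then obtain U \<phi> where ch: "local_defining_function \<Omega> z U \<phi>"
      using dom unfolding bounded_smooth_domain_def by blast
    obtain R where R: "0 < R" "\<And>X X' B. C1_field_on \<Omega> X X' \<Longrightarrow> continuous_on (closure \<Omega>) X \<Longrightarrow>
      (\<And>x. x \<in> \<Omega> \<Longrightarrow> \<bar>divergence X' x\<bar> \<le> B) \<Longrightarrow>
      (\<And>y. y \<in> frontier \<Omega> \<inter> U \<Longrightarrow> gradient \<phi> y \<noteq> 0 \<Longrightarrow> X y \<bullet> gradient \<phi> y = 0) \<Longrightarrow>
      localized_divergence_vanishes \<Omega> X X' z R"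
      using localized_divergence_chart[OF \<Omega> ch] by blast
    have "local_defining_function \<Omega> y U \<phi>" if "y \<in> U" "gradient \<phi> y \<noteq> 0" for y
      using ch that by (auto simp: local_defining_function_def)
    then show ?thesis using R by blast
  qed
  then obtain R where R: "\<And>z. z \<in> closure \<Omega> \<Longrightarrow> 0 < R z"
    and loc: "\<And>z X X' B. z \<in> closure \<Omega> \<Longrightarrow> C1_field_on \<Omega> X X' \<Longrightarrow> continuous_on (closure \<Omega>) X \<Longrightarrow>
      (\<forall>x\<in>\<Omega>. \<bar>divergence X' x\<bar> \<le> B) \<Longrightarrow>
      (\<forall>y\<in>frontier \<Omega>. \<forall>U \<phi>. local_defining_function \<Omega> y U \<phi> \<longrightarrow> X y \<bullet> gradient \<phi> y = 0) \<Longrightarrow>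
      localized_divergence_vanishes \<Omega> X X' z (R z)" by metis
  obtain T where T: "T \<subseteq> closure \<Omega>" "finite T" "closure \<Omega> \<subseteq> (\<Union>z\<in>T. ball z (R z))"
    using compactE_image[OF ccl, of "closure \<Omega>" "\<lambda>z. ball z (R z)"] R by force
  define N where "N x = (\<Sum>z\<in>T. bump z (R z) x)" for x
  define NG where "NG x = (\<Sum>z\<in>T. bump_grad z (R z) x)" for x
  have Nd: "(N has_derivative (\<lambda>h. NG x \<bullet> h)) (at x)" for x
    unfolding N_def NG_def inner_sum_left by (intro has_derivative_sum bump_has_derivative)
  have Nc: "continuous_on A N" and NGc: "continuous_on A NG" for A
    unfolding N_def NG_def by (intro continuous_intros continuous_on_bump continuous_on_bump_grad)+
  have Npos: "0 < N x" if x: "x \<in> closure \<Omega>" for x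
  proof -
    obtain z where z: "z \<in> T" "x \<in> ball z (R z)" using x T(3) by blast
    show ?thesis unfolding N_def by (rule sum_pos2[OF T(2) z(1)]) (use bump_pos[OF z(2)] bump_nonneg in auto)
  qed
  then have Nnz: "N x \<noteq> 0" if "x \<in> closure \<Omega>" for x using that by force
  define \<eta> where "\<eta> x = inverse (N x)" for x
  define E where "E x = (- inverse (N x) * inverse (N x)) *\<^sub>R NG x" for x
  have \<eta>d: "(\<eta> has_derivative (\<lambda>h. E x \<bullet> h)) (at x)" if "x \<in> \<Omega>" for x
    unfolding \<eta>_def E_def using Nnz[of x] that closure_subset[of \<Omega>]
    by (auto intro!: derivative_eq_intros Nd)
  have \<eta>c: "continuous_on (closure \<Omega>) \<eta>" and Ec: "continuous_on (closure \<Omega>) E"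
    unfolding \<eta>_def E_def using Nnz by (auto intro!: continuous_intros Nc NGc)
  define Y where "Y x = \<eta> x *\<^sub>R X x" for x
  define Y' where "Y' b x h = \<eta> x * X' b x h + (E x \<bullet> h) * (X x \<bullet> b)" for b x h
  have Y: "C1_field_on \<Omega> Y Y'" and Ydiv: "divergence Y' = (\<lambda>x. \<eta> x * divergence X' x + E x \<bullet> X x)"
    unfolding Y_def Y'_def
    by (intro C1_field_on_scale[OF X \<eta>d] continuous_on_subset[OF Ec closure_subset]; assumption)+
  have Yc: "continuous_on (closure \<Omega>) Y" unfolding Y_def by (intro continuous_intros \<eta>c Xc)
  have "\<exists>B. \<forall>x\<in>\<Omega>. \<bar>\<eta> x * D x + E x \<bullet> X x\<bar> \<le> B"
    by (intro bdd continuous_intros \<eta>c Xc Ec D)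
  then obtain B where "\<forall>x\<in>\<Omega>. \<bar>divergence Y' x\<bar> \<le> B" unfolding Ydiv using D(2) by auto
  then have loc0: "(LINT x:\<Omega>|lborel. bump z (R z) x * divergence Y' x + bump_grad z (R z) x \<bullet> Y x) = 0"
    if "z \<in> T" for z
    using loc[OF _ Y Yc, of z B] T(1) that tan unfolding localized_divergence_vanishes_def Y_def by auto
  have int: "set_integrable lborel \<Omega> (\<lambda>x. bump z (R z) x * divergence Y' x + bump_grad z (R z) x \<bullet> Y x)" for z
    by (rule set_integrable_continuous_closure[OF \<Omega>,
        where g="\<lambda>x. bump z (R z) x * (\<eta> x * D x + E x \<bullet> X x) + bump_grad z (R z) x \<bullet> Y x"])
       (auto simp: Ydiv D(2) intro!: continuous_intros \<eta>c Xc Yc Ec D continuous_on_bump continuous_on_bump_grad)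
  have "(LINT x:\<Omega>|lborel. divergence X' x) =
    (LINT x:\<Omega>|lborel. \<Sum>z\<in>T. bump z (R z) x * divergence Y' x + bump_grad z (R z) x \<bullet> Y x)"
  proof (rule set_lebesgue_integral_cong)
    show "\<forall>x. x \<in> \<Omega> \<longrightarrow> divergence X' x = (\<Sum>z\<in>T. bump z (R z) x * divergence Y' x + bump_grad z (R z) x \<bullet> Y x)"
    proof (intro allI impI)
      fix x assume "x \<in> \<Omega>"
      then have nz: "N x \<noteq> 0" using Nnz closure_subset by blast
      have "(\<Sum>z\<in>T. bump z (R z) x * divergence Y' x + bump_grad z (R z) x \<bullet> Y x) = N x * divergence Y' x + NG x \<bullet> Y x"
        by (simp add: N_def NG_def sum.distrib sum_distrib_right inner_sum_left)
      also have "\<dots> = divergence X' x"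
        using nz unfolding Ydiv Y_def \<eta>_def E_def by (simp add: field_simps)
      finally show "divergence X' x = (\<Sum>z\<in>T. bump z (R z) x * divergence Y' x + bump_grad z (R z) x \<bullet> Y x)" ..
    qed
  qed (use \<Omega> in auto)
  also have "\<dots> = (\<Sum>z\<in>T. (LINT x:\<Omega>|lborel. bump z (R z) x * divergence Y' x + bump_grad z (R z) x \<bullet> Y x))"
    using int T(2) unfolding set_lebesgue_integral_def set_integrable_def
    by (simp only: scaleR_sum_right) (rule Bochner_Integration.integral_sum, auto)
  also have "\<dots> = 0" using loc0 by simp
  finally show ?thesis .
qed

section \<open>Weak form of the Neumann problem\<close>

lemma defining_function_frontier_eq_0:
  assumes "open \<Omega>" "local_defining_function \<Omega> y U \<phi>" "y \<in> frontier \<Omega>"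
  shows "\<phi> y = 0"
proof -
  have U: "open U" "y \<in> U" "smooth_on U \<phi>" and \<Omega>U: "\<Omega> \<inter> U = {y \<in> U. \<phi> y < 0}"
    using assms(2) by (auto simp: local_defining_function_def)
  have "y \<notin> \<Omega>" "y \<in> closure \<Omega>" using assms(1,3) by (auto simp: frontier_def interior_open)
  then have "0 \<le> \<phi> y" using U \<Omega>U by force
  moreover have "\<not> 0 < \<phi> y"
  proof
    assume "0 < \<phi> y"
    have "continuous_on U \<phi>" using smooth_on_continuous_partial[OF U(3), of "[]"] by simp
    then have "open (U \<inter> \<phi> -` {0<..})" using U(1) by (intro continuous_open_preimage) auto
    moreover have "y \<in> U \<inter> \<phi> -` {0<..}" using U \<open>0 < \<phi> y\<close> by auto
    ultimately obtain x where "x \<in> \<Omega>" "x \<in> U \<inter> \<phi> -` {0<..}"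
      using \<open>y \<in> closure \<Omega>\<close> open_Int_closure_eq_empty by blast
    then show False using \<Omega>U by force
  qed
  ultimately show ?thesis by linarith
qed

lemma defining_function_line_derivative:
  assumes "local_defining_function \<Omega> y U \<phi>"
  shows "((\<lambda>t. \<phi> (y + t *\<^sub>R e)) has_real_derivative gradient \<phi> y \<bullet> e) (at 0)"
proof -
  have "(\<phi> has_derivative (\<lambda>h. gradient \<phi> y \<bullet> h)) (at y)"
    using assms smooth_on_has_gradient by (auto simp: local_defining_function_def)
  then have "((\<lambda>t. \<phi> (y + t *\<^sub>R e)) has_derivative (\<lambda>t. gradient \<phi> y \<bullet> (t *\<^sub>R e))) (at (0::real))"
    by (intro has_derivative_compose[of "\<lambda>t. y + t *\<^sub>R e" "\<lambda>t. t *\<^sub>R e" 0 UNIV \<phi>, simplified])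
       (auto intro!: derivative_eq_intros)
  then show ?thesis
    unfolding has_field_derivative_def by (rule has_derivative_eq_rhs) (auto simp: fun_eq_iff)
qed

lemma eventually_line_in_open:
  fixes y :: "'a::real_normed_vector"
  assumes "open U" "y \<in> U"
  obtains d where "0 < d" "\<And>t. \<bar>t\<bar> < d \<Longrightarrow> y + t *\<^sub>R e \<in> U"
proof -
  have "open ((\<lambda>t::real. y + t *\<^sub>R e) -` U)"
    by (intro continuous_open_vimage continuous_intros assms(1))
  moreover have "0 \<in> (\<lambda>t::real. y + t *\<^sub>R e) -` U" using assms by simp
  ultimately obtain d where "0 < d" "ball 0 d \<subseteq> (\<lambda>t::real. y + t *\<^sub>R e) -` U"
    using open_contains_ball by blast
  then show ?thesis using that by (force simp: subset_eq)
qed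

lemma inward_segment_in_domain:
  assumes "open \<Omega>" "local_defining_function \<Omega> y U \<phi>" "y \<in> frontier \<Omega>" "gradient \<phi> y \<bullet> e < 0"
  obtains d where "0 < d" "\<And>t. 0 < t \<Longrightarrow> t < d \<Longrightarrow> y + t *\<^sub>R e \<in> \<Omega>"
proof -
  have U: "open U" "y \<in> U" and \<Omega>U: "\<Omega> \<inter> U = {y \<in> U. \<phi> y < 0}"
    using assms(2) by (auto simp: local_defining_function_def)
  obtain d1 where d1: "0 < d1" "\<And>h. 0 < h \<Longrightarrow> h < d1 \<Longrightarrow> \<phi> (y + (0 + h) *\<^sub>R e) < \<phi> (y + 0 *\<^sub>R e)"
    using DERIV_neg_dec_right[OF defining_function_line_derivative[OF assms(2)] assms(4)] by blast
  obtain d2 where d2: "0 < d2" "\<And>t. \<bar>t\<bar> < d2 \<Longrightarrow> y + t *\<^sub>R e \<in> U"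
    using eventually_line_in_open[OF U] by blast
  have "y + t *\<^sub>R e \<in> \<Omega>" if "0 < t" "t < min d1 d2" for t
    using d1(2)[of t] d2(2)[of t] that defining_function_frontier_eq_0[OF assms(1-3)] \<Omega>U by auto
  then show ?thesis using that[of "min d1 d2"] d1 d2 by auto
qed

text \<open>The normal at \<open>y\<close> is read off from one defining function, while the divergence theorem uses another.
  Directions that decrease \<open>\<phi>\<close> point into \<open>\<Omega>\<close> and so cannot increase \<open>\<psi>\<close>; a vector tangent for \<open>\<psi>\<close> but
  decreasing \<open>\<phi>\<close> would violate this after a small tilt along \<open>\<nabla>\<psi>\<close>.\<close>

lemma defining_function_tangent_unique:
  assumes "open \<Omega>" "y \<in> frontier \<Omega>"
    and \<phi>: "local_defining_function \<Omega> y U \<phi>" and \<psi>: "local_defining_function \<Omega> y V \<psi>"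
    and "e \<bullet> gradient \<psi> y = 0"
  shows "e \<bullet> gradient \<phi> y = 0"
proof -
  let ?a = "gradient \<phi> y" and ?b = "gradient \<psi> y"
  have b0: "?b \<noteq> 0" using \<psi> by (simp add: local_defining_function_def)
  have half: "e \<bullet> ?b \<le> 0" if "e \<bullet> ?a < 0" for e
  proof (rule ccontr)
    assume "\<not> e \<bullet> ?b \<le> 0"
    then have "0 < ?b \<bullet> e" by (simp add: inner_commute)
    have V: "open V" "y \<in> V" and \<Omega>V: "\<Omega> \<inter> V = {y \<in> V. \<psi> y < 0}"
      using \<psi> by (auto simp: local_defining_function_def)
    obtain d1 where d1: "0 < d1" "\<And>h. 0 < h \<Longrightarrow> h < d1 \<Longrightarrow> \<psi> (y + 0 *\<^sub>R e) < \<psi> (y + (0 + h) *\<^sub>R e)"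
      using DERIV_pos_inc_right[OF defining_function_line_derivative[OF \<psi>] \<open>0 < ?b \<bullet> e\<close>] by blast
    obtain d2 where d2: "0 < d2" "\<And>t. \<bar>t\<bar> < d2 \<Longrightarrow> y + t *\<^sub>R e \<in> V"
      using eventually_line_in_open[OF V] by blast
    obtain d3 where d3: "0 < d3" "\<And>t. 0 < t \<Longrightarrow> t < d3 \<Longrightarrow> y + t *\<^sub>R e \<in> \<Omega>"
      using inward_segment_in_domain[OF assms(1) \<phi> assms(2), of e] \<open>e \<bullet> ?a < 0\<close> by (metis inner_commute)
    define t where "t = min d1 (min d2 d3) / 2"
    have t: "0 < t" "t < d1" "t < d2" "t < d3" using d1 d2 d3 by (auto simp: t_def)
    have "0 < \<psi> (y + t *\<^sub>R e)"
      using d1(2)[of t] t defining_function_frontier_eq_0[OF assms(1) \<psi> assms(2)] by simp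
    moreover have "y + t *\<^sub>R e \<in> \<Omega> \<inter> V" using d2(2)[of t] d3(2)[of t] t by simp
    ultimately show False using \<Omega>V by force
  qed
  have no_neg: "\<not> f \<bullet> ?a < 0" if f: "f \<bullet> ?b = 0" for f
  proof
    assume neg: "f \<bullet> ?a < 0"
    define \<epsilon> where "\<epsilon> = - (f \<bullet> ?a) / (2 * (\<bar>?b \<bullet> ?a\<bar> + 1))"
    have \<epsilon>: "0 < \<epsilon>" using neg unfolding \<epsilon>_def by (intro divide_pos_pos) auto
    have "\<epsilon> * (?b \<bullet> ?a) \<le> \<epsilon> * (\<bar>?b \<bullet> ?a\<bar> + 1)" using \<epsilon> by (intro mult_left_mono) auto
    also have "\<dots> = - (f \<bullet> ?a) / 2" by (simp add: \<epsilon>_def field_simps)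
    finally have "(f + \<epsilon> *\<^sub>R ?b) \<bullet> ?a < 0" using neg by (simp add: inner_add_left)
    then have "(f + \<epsilon> *\<^sub>R ?b) \<bullet> ?b \<le> 0" by (rule half)
    moreover have "0 < \<epsilon> * (?b \<bullet> ?b)" using \<epsilon> b0 by simp
    ultimately show False using f by (simp add: inner_add_left)
  qed
  show ?thesis using no_neg[of e] no_neg[of "- e"] assms(5) by simp
qed

lemma smooth_up_to_boundary_derivative_extensions:
  assumes "smooth_up_to_boundary \<Omega> w"
  obtains G L where "continuous_on (closure \<Omega>) G" "continuous_on (closure \<Omega>) L"
    "\<And>x. x \<in> \<Omega> \<Longrightarrow> G x = gradient w x" "\<And>x. x \<in> \<Omega> \<Longrightarrow> L x = laplacian w x"
proof -
  have ext: "\<exists>g. continuous_on (closure \<Omega>) g \<and> (\<forall>x\<in>\<Omega>. g x = partial_derivs bs w x)" if "set bs \<subseteq> Basis" for bs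
    using assms that by (simp add: smooth_up_to_boundary_def)
  have "\<forall>b\<in>Basis. \<exists>g. continuous_on (closure \<Omega>) g \<and> (\<forall>x\<in>\<Omega>. g x = partial_derivs [b] w x)"
    using ext[of "[b]" for b] by auto
  then obtain g where g: "\<And>b. b \<in> Basis \<Longrightarrow> continuous_on (closure \<Omega>) (g b)"
      "\<And>b x. b \<in> Basis \<Longrightarrow> x \<in> \<Omega> \<Longrightarrow> g b x = partial_derivs [b] w x" by metis
  have "\<forall>b\<in>Basis. \<exists>g. continuous_on (closure \<Omega>) g \<and> (\<forall>x\<in>\<Omega>. g x = partial_derivs [b,b] w x)"
    using ext[of "[b,b]" for b] by auto
  then obtain l where l: "\<And>b. b \<in> Basis \<Longrightarrow> continuous_on (closure \<Omega>) (l b)"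
      "\<And>b x. b \<in> Basis \<Longrightarrow> x \<in> \<Omega> \<Longrightarrow> l b x = partial_derivs [b,b] w x" by metis
  show ?thesis
  proof (rule that)
    show "continuous_on (closure \<Omega>) (\<lambda>x. \<Sum>b\<in>Basis. g b x *\<^sub>R b)" "continuous_on (closure \<Omega>) (\<lambda>x. \<Sum>b\<in>Basis. l b x)"
      using g l by (auto intro!: continuous_intros)
  qed (use g l in \<open>auto simp: gradient_def laplacian_def\<close>)
qed

text \<open>The Neumann condition speaks of difference quotients along the normal; by the mean value theorem
  these are values of \<open>G \<bullet> \<nu>\<close> at interior points, and \<open>G\<close> is continuous up to the boundary.\<close>

lemma neumann_gradient_tangential:
  assumes dom: "bounded_smooth_domain \<Omega>" and \<nu>: "unit_outer_normal \<Omega> \<nu>"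
    and w: "smooth_up_to_boundary \<Omega> w" and y: "y \<in> frontier \<Omega>" and nd: "has_normal_derivative \<nu> w 0 y"
    and G: "continuous_on (closure \<Omega>) G" "\<And>x. x \<in> \<Omega> \<Longrightarrow> G x = gradient w x"
    and \<phi>: "local_defining_function \<Omega> y U \<phi>"
  shows "G y \<bullet> gradient \<phi> y = 0"
proof -
  have \<Omega>: "open \<Omega>" using dom by (simp add: bounded_smooth_domain_def)
  have wc: "continuous_on (closure \<Omega>) w" and ws: "smooth_on \<Omega> w"
    using w by (auto simp: smooth_up_to_boundary_def)
  obtain V \<psi> where \<psi>: "local_defining_function \<Omega> y V \<psi>" and \<nu>y: "\<nu> y = gradient \<psi> y /\<^sub>R norm (gradient \<psi> y)"
    using \<nu> y by (auto simp: unit_outer_normal_def)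
  have b0: "gradient \<psi> y \<noteq> 0" using \<psi> by (simp add: local_defining_function_def)
  have "gradient \<psi> y \<bullet> (- \<nu> y) < 0" using b0 by (simp add: \<nu>y)
  then obtain d where d: "0 < d" "\<And>t. 0 < t \<Longrightarrow> t < d \<Longrightarrow> y + t *\<^sub>R (- \<nu> y) \<in> \<Omega>"
    using inward_segment_in_domain[OF \<Omega> \<psi> y] by blast
  have ycl: "y \<in> closure \<Omega>" using y by (simp add: frontier_def)
  have seg: "y + t *\<^sub>R \<nu> y \<in> \<Omega>" if "- d < t" "t < 0" for t using d(2)[of "-t"] that by simp
  have lim: "((\<lambda>t. (w (y + t *\<^sub>R \<nu> y) - w y) / t) \<longlongrightarrow> 0) (at_left 0)"
    using nd by (simp add: has_normal_derivative_def has_field_derivative_iff)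
  have "\<exists>s. t < s \<and> s < 0 \<and> (w (y + t *\<^sub>R \<nu> y) - w y) / t = G (y + s *\<^sub>R \<nu> y) \<bullet> \<nu> y"
    if t: "- d < t" "t < 0" for t
  proof -
    have c1: "continuous_on {t..0} (\<lambda>t. w (y + t *\<^sub>R \<nu> y))"
    proof (rule continuous_on_compose2[OF wc])
      show "(\<lambda>t. y + t *\<^sub>R \<nu> y) ` {t..0} \<subseteq> closure \<Omega>"
      proof clarify
        fix s assume "s \<in> {t..0}"
        then show "y + s *\<^sub>R \<nu> y \<in> closure \<Omega>"
          using seg[of s] t ycl closure_subset by (cases "s = 0") auto
      qed
    qed (intro continuous_intros)
    have c2: "((\<lambda>t. w (y + t *\<^sub>R \<nu> y)) has_derivative (\<lambda>h. gradient w (y + s *\<^sub>R \<nu> y) \<bullet> (h *\<^sub>R \<nu> y))) (at s)"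
      if "t < s" "s < 0" for s
      using smooth_on_has_gradient[OF ws, of "y + s *\<^sub>R \<nu> y"] seg[of s] t that
      by (intro has_derivative_compose[of "\<lambda>t. y + t *\<^sub>R \<nu> y" "\<lambda>t. t *\<^sub>R \<nu> y" s UNIV w, simplified])
         (auto intro!: derivative_eq_intros)
    obtain s where s: "t < s" "s < 0"
      "w (y + 0 *\<^sub>R \<nu> y) - w (y + t *\<^sub>R \<nu> y) = gradient w (y + s *\<^sub>R \<nu> y) \<bullet> ((0 - t) *\<^sub>R \<nu> y)"
      using mvt[OF t(2) c1 c2] by blast
    then have "(w (y + t *\<^sub>R \<nu> y) - w y) / t = G (y + s *\<^sub>R \<nu> y) \<bullet> \<nu> y"
      using t seg[of s] G(2) by (simp add: field_simps)
    then show ?thesis using s by blast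
  qed
  then obtain s where s: "\<And>t. - d < t \<Longrightarrow> t < 0 \<Longrightarrow> t < s t \<and> s t < 0 \<and>
      (w (y + t *\<^sub>R \<nu> y) - w y) / t = G (y + s t *\<^sub>R \<nu> y) \<bullet> \<nu> y" by metis
  have ev: "\<forall>\<^sub>F t in at_left 0. - d < t \<and> t < (0::real)"
    using eventually_at_left_real[of "-d" 0] d(1) by simp
  have "(s \<longlongrightarrow> 0) (at_left 0)"
  proof (rule tendsto_sandwich)
    show "\<forall>\<^sub>F t in at_left 0. t \<le> s t" "\<forall>\<^sub>F t in at_left 0. s t \<le> 0"
      using ev by (auto elim!: eventually_mono dest: s)
  qed (auto intro!: tendsto_eq_intros)
  then have "((\<lambda>t. y + s t *\<^sub>R \<nu> y) \<longlongrightarrow> y) (at_left 0)"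
    by (auto intro!: tendsto_eq_intros)
  moreover have "\<forall>\<^sub>F t in at_left 0. y + s t *\<^sub>R \<nu> y \<in> closure \<Omega>"
  proof (rule eventually_mono[OF ev])
    fix t assume t: "- d < t \<and> t < 0"
    then have "y + s t *\<^sub>R \<nu> y \<in> \<Omega>" using s[of t] seg[of "s t"] by auto
    then show "y + s t *\<^sub>R \<nu> y \<in> closure \<Omega>" using closure_subset by blast
  qed
  ultimately have "((\<lambda>t. G (y + s t *\<^sub>R \<nu> y)) \<longlongrightarrow> G y) (at_left 0)"
    using continuous_on_tendsto_compose[OF G(1) _ ycl] by blast
  then have "((\<lambda>t. G (y + s t *\<^sub>R \<nu> y) \<bullet> \<nu> y) \<longlongrightarrow> G y \<bullet> \<nu> y) (at_left 0)"
    by (intro tendsto_intros)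
  moreover have "\<forall>\<^sub>F t in at_left 0. G (y + s t *\<^sub>R \<nu> y) \<bullet> \<nu> y = (w (y + t *\<^sub>R \<nu> y) - w y) / t"
    using ev by (auto elim!: eventually_mono dest: s)
  ultimately have "((\<lambda>t. (w (y + t *\<^sub>R \<nu> y) - w y) / t) \<longlongrightarrow> G y \<bullet> \<nu> y) (at_left 0)"
    by (rule Lim_transform_eventually)
  with lim have "G y \<bullet> \<nu> y = 0"
    using tendsto_unique[OF trivial_limit_at_left_real] by blast
  then have "G y \<bullet> gradient \<psi> y = 0" using b0 by (simp add: \<nu>y)
  then show ?thesis using defining_function_tangent_unique[OF \<Omega> y \<phi> \<psi>] by simp
qed

text \<open>Integration by parts, stated only for test functions of the form \<open>T \<circ> w\<close>. All later estimates come
  from a choice of \<open>T\<close>: \<open>T = - 1 / y\<close> gives the integral bound for the inhibitor equation, squared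
  positive parts give the maximum principle, and smooth steps give the energy estimate on level sets.\<close>

theorem neumann_weak_form:
  fixes w :: "'a::euclidean_space \<Rightarrow> real" and T T' :: "real \<Rightarrow> real"
  assumes dom: "bounded_smooth_domain \<Omega>" and \<nu>: "unit_outer_normal \<Omega> \<nu>"
    and w: "smooth_up_to_boundary \<Omega> w" and nd: "\<And>y. y \<in> frontier \<Omega> \<Longrightarrow> has_normal_derivative \<nu> w 0 y"
    and T: "\<And>x. x \<in> closure \<Omega> \<Longrightarrow> (T has_real_derivative T' (w x)) (at (w x))"
    and T'c: "continuous_on (w ` closure \<Omega>) T'"
  shows "set_integrable lborel \<Omega> (\<lambda>x. T (w x) * laplacian w x)"
    and "set_integrable lborel \<Omega> (\<lambda>x. T' (w x) * (norm (gradient w x))\<^sup>2)"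
    and "(LINT x:\<Omega>|lborel. T (w x) * laplacian w x) = - (LINT x:\<Omega>|lborel. T' (w x) * (norm (gradient w x))\<^sup>2)"
proof -
  have \<Omega>: "open \<Omega>" "bounded \<Omega>" using dom by (auto simp: bounded_smooth_domain_def)
  have wc: "continuous_on (closure \<Omega>) w" and ws: "smooth_on \<Omega> w"
    using w by (auto simp: smooth_up_to_boundary_def)
  obtain G L where GL: "continuous_on (closure \<Omega>) G" "continuous_on (closure \<Omega>) L"
    "\<And>x. x \<in> \<Omega> \<Longrightarrow> G x = gradient w x" "\<And>x. x \<in> \<Omega> \<Longrightarrow> L x = laplacian w x"
    using smooth_up_to_boundary_derivative_extensions[OF w] by metis
  have "continuous_on (w ` closure \<Omega>) T"
    unfolding continuous_on_eq_continuous_within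
    using T DERIV_isCont continuous_at_imp_continuous_at_within by blast
  then have Tc: "continuous_on (closure \<Omega>) (\<lambda>x. T (w x))"
    using wc by (rule continuous_on_compose2) simp
  have T'c': "continuous_on (closure \<Omega>) (\<lambda>x. T' (w x))"
    using T'c wc by (rule continuous_on_compose2) simp
  show i1: "set_integrable lborel \<Omega> (\<lambda>x. T (w x) * laplacian w x)"
    by (rule set_integrable_continuous_closure[OF \<Omega>, where g="\<lambda>x. T (w x) * L x"])
       (auto intro!: continuous_intros Tc GL simp: GL)
  show i2: "set_integrable lborel \<Omega> (\<lambda>x. T' (w x) * (norm (gradient w x))\<^sup>2)"
    by (rule set_integrable_continuous_closure[OF \<Omega>, where g="\<lambda>x. T' (w x) * (norm (G x))\<^sup>2"])
       (auto intro!: continuous_intros T'c' GL simp: GL)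
  define X where "X x = T (w x) *\<^sub>R G x" for x
  define X' where "X' b x h = T (w x) * (\<Sum>c\<in>Basis. (h \<bullet> c) * partial_derivs [c, b] w x)
      + (T' (w x) * (gradient w x \<bullet> h)) * (gradient w x \<bullet> b)" for b x h
  have X'b: "X' b x b = T (w x) * partial_derivs [b, b] w x + T' (w x) * (gradient w x \<bullet> b)\<^sup>2" if "b \<in> Basis" for b x
  proof -
    have "(\<Sum>c\<in>Basis. (b \<bullet> c) * partial_derivs [c, b] w x) = partial_derivs [b, b] w x"
    proof -
      have "(\<Sum>c\<in>Basis. (b \<bullet> c) * partial_derivs [c, b] w x) = (\<Sum>c\<in>Basis. if c = b then partial_derivs [b, b] w x else 0)"
        using that by (intro sum.cong) (auto simp: inner_Basis simp del: partial_derivs.simps)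
      then show ?thesis using that by (simp del: partial_derivs.simps)
    qed
    then show ?thesis by (simp add: X'_def power2_eq_square)
  qed
  have div: "divergence X' x = T (w x) * laplacian w x + T' (w x) * (norm (gradient w x))\<^sup>2" for x
  proof -
    have "(norm (gradient w x))\<^sup>2 = (\<Sum>b\<in>Basis. (gradient w x \<bullet> b)\<^sup>2)"
      unfolding power2_norm_eq_inner by (subst euclidean_inner) (simp add: power2_eq_square)
    then show ?thesis
      unfolding divergence_def laplacian_def by (simp add: X'b sum.distrib sum_distrib_left del: partial_derivs.simps)
  qed
  have "C1_field_on \<Omega> X X'"
    unfolding C1_field_on_def
  proof (intro ballI conjI)
    fix b :: 'a and x assume b: "b \<in> Basis" and x: "x \<in> \<Omega>"
    have 1: "((\<lambda>y. T (w y)) has_derivative (\<lambda>h. T' (w x) * (gradient w x \<bullet> h))) (at x)"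
      using DERIV_compose_FDERIV[OF T smooth_on_has_gradient[OF ws x]] x closure_subset[of \<Omega>]
      by (auto simp: mult.commute)
    have 2: "(partial_derivs [b] w has_derivative (\<lambda>h. \<Sum>c\<in>Basis. (h \<bullet> c) * partial_derivs [c, b] w x)) (at x)"
      using smooth_on_partial_has_derivative[OF ws x, of "[b]"] b by simp
    have "((\<lambda>y. T (w y) * partial_derivs [b] w y) has_derivative X' b x) (at x)"
      using has_derivative_mult[OF 1 2] b unfolding X'_def[abs_def] by (simp add: gradient_inner_Basis)
    then show "((\<lambda>y. X y \<bullet> b) has_derivative X' b x) (at x)"
      by (rule has_derivative_transform_within_open[OF _ \<Omega>(1) x])
         (simp add: X_def GL(3) gradient_inner_Basis b)
  next
    fix b :: 'a assume b: "b \<in> Basis"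
    have "continuous_on \<Omega> (\<lambda>x. T (w x) * partial_derivs [b, b] w x + T' (w x) * (gradient w x \<bullet> b)\<^sup>2)"
      by (intro continuous_intros continuous_on_subset[OF Tc closure_subset] continuous_on_subset[OF T'c' closure_subset]
          smooth_on_continuous_partial[OF ws] smooth_on_continuous_gradient[OF ws]) (use b in auto)
    then show "continuous_on \<Omega> (\<lambda>x. X' b x b)" using X'b[OF b] by simp
  qed
  moreover have "continuous_on (closure \<Omega>) X" unfolding X_def by (intro continuous_intros Tc GL)
  moreover have "continuous_on (closure \<Omega>) (\<lambda>x. T (w x) * L x + T' (w x) * (norm (G x))\<^sup>2)"
    by (intro continuous_intros Tc T'c' GL)
  moreover have "divergence X' x = T (w x) * L x + T' (w x) * (norm (G x))\<^sup>2" if "x \<in> \<Omega>" for x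
    using that by (simp add: div GL)
  moreover have "X y \<bullet> gradient \<phi> y = 0" if "y \<in> frontier \<Omega>" "local_defining_function \<Omega> y U \<phi>" for y U \<phi>
    using neumann_gradient_tangential[OF dom \<nu> w that(1) nd[OF that(1)] GL(1,3) that(2)] by (simp add: X_def)
  ultimately have "(LINT x:\<Omega>|lborel. divergence X' x) = 0"
    by (rule integral_divergence_tangential_eq_0[OF dom])
  then show "(LINT x:\<Omega>|lborel. T (w x) * laplacian w x) = - (LINT x:\<Omega>|lborel. T' (w x) * (norm (gradient w x))\<^sup>2)"
    using set_integral_add(2)[OF i1 i2] by (simp add: div)
qed

section \<open>Measure of superlevel sets\<close>

text \<open>From every point of \<open>\<Omega>\<close> near \<open>z\<close>, all segments in a fixed open cone of directions, up to a fixed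
  length, stay in \<open>\<Omega>\<close>. The cone is cut into balls, one for each scale \<open>t\<close>, since it is the ball at one
  scale over which the function is averaged.\<close>

definition interior_cone :: "'a::euclidean_space set \<Rightarrow> 'a \<Rightarrow> real \<Rightarrow> 'a \<Rightarrow> real \<Rightarrow> real \<Rightarrow> bool" where
  "interior_cone \<Omega> z r e \<kappa> \<rho> \<longleftrightarrow>
     (\<forall>x\<in>\<Omega> \<inter> ball z r. \<forall>t\<in>{0<..\<rho>}. \<forall>h\<in>ball (t *\<^sub>R e) (t * \<kappa>). \<forall>\<tau>\<in>{0..1}. x - \<tau> *\<^sub>R h \<in> \<Omega>)"

text \<open>At a boundary point the cone is centred at the gradient \<open>a\<close> of the defining function: while the
  gradient stays within a quarter of its length, moving along \<open>- h\<close> decreases the defining function.\<close>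

lemma interior_cone_exists:
  assumes dom: "bounded_smooth_domain \<Omega>" and z: "z \<in> closure \<Omega>"
  obtains r e \<kappa> \<rho> where "0 < r" "0 < \<kappa>" "0 < \<rho>" "interior_cone \<Omega> z r e \<kappa> \<rho>"
proof (cases "z \<in> \<Omega>")
  case True
  have "open \<Omega>" using dom by (simp add: bounded_smooth_domain_def)
  then obtain r where r: "0 < r" "ball z r \<subseteq> \<Omega>" using True open_contains_ball by blast
  have "interior_cone \<Omega> z (r/2) 0 1 (r/2)"
    unfolding interior_cone_def
  proof (intro ballI)
    fix x h :: 'a and t \<tau> :: real assume "x \<in> \<Omega> \<inter> ball z (r/2)" "t \<in> {0<..r/2}" "h \<in> ball (t *\<^sub>R 0) (t * 1)" "\<tau> \<in> {0..1}"
    then have x: "dist z x < r / 2" and h: "norm h < r / 2" and \<tau>: "0 \<le> \<tau>" "\<tau> \<le> 1" by auto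
    have "norm (\<tau> *\<^sub>R h) \<le> norm h" using \<tau> by (simp add: mult_left_le_one_le)
    then have "dist x (x - \<tau> *\<^sub>R h) < r / 2" using h by (simp add: dist_norm)
    then have "dist z (x - \<tau> *\<^sub>R h) < r" using x dist_triangle[of z "x - \<tau> *\<^sub>R h" x] by linarith
    then show "x - \<tau> *\<^sub>R h \<in> \<Omega>" using r by auto
  qed
  then show ?thesis using that[of "r/2" 1 "r/2" 0] r by auto
next
  case False
  have \<Omega>: "open \<Omega>" using dom by (simp add: bounded_smooth_domain_def)
  have "z \<in> frontier \<Omega>" using z False \<Omega> by (simp add: frontier_def interior_open)
  then obtain U \<phi> where ch: "local_defining_function \<Omega> z U \<phi>"
    using dom unfolding bounded_smooth_domain_def by blast
  then have U: "open U" "z \<in> U" "smooth_on U \<phi>" and g0: "gradient \<phi> z \<noteq> 0"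
    and \<Omega>U: "\<Omega> \<inter> U = {y \<in> U. \<phi> y < 0}"
    by (auto simp: local_defining_function_def)
  define a where "a = gradient \<phi> z"
  define A where "A = norm a"
  have A: "0 < A" using g0 by (simp add: A_def a_def)
  have "open (U \<inter> gradient \<phi> -` ball a (A/4))"
    using smooth_on_continuous_gradient[OF U(3)] U(1) by (intro continuous_open_preimage) auto
  moreover have "z \<in> U \<inter> gradient \<phi> -` ball a (A/4)" using U(2) A by (simp add: a_def)
  ultimately obtain r where r: "0 < r" "ball z r \<subseteq> U \<inter> gradient \<phi> -` ball a (A/4)"
    using open_contains_ball by blast
  define \<rho> where "\<rho> = r / (4 * A)"
  have "interior_cone \<Omega> z (r/2) a (A/4) \<rho>"
    unfolding interior_cone_def
  proof (intro ballI)
    fix x h :: 'a and t \<tau> :: real assume "x \<in> \<Omega> \<inter> ball z (r/2)" and t0: "t \<in> {0<..\<rho>}"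
      and h0: "h \<in> ball (t *\<^sub>R a) (t * (A/4))" and \<tau>0: "\<tau> \<in> {0..1}"
    then have x: "dist z x < r / 2" "x \<in> \<Omega>" and t: "0 < t" "t \<le> \<rho>" and \<tau>: "0 \<le> \<tau>" "\<tau> \<le> 1"
      and h: "norm (h - t *\<^sub>R a) < t * (A/4)" by (auto simp: dist_norm norm_minus_commute)
    have nh: "norm h \<le> t * (5/4 * A)"
      using norm_triangle_ineq[of "h - t *\<^sub>R a" "t *\<^sub>R a"] h t(1) by (simp add: A_def algebra_simps)
    also have "\<dots> \<le> \<rho> * (5/4 * A)" using t A by (intro mult_right_mono) auto
    also have "\<dots> < r / 2" using A r(1) by (simp add: \<rho>_def)
    finally have hr: "norm h < r / 2" .
    have seg: "x - s *\<^sub>R h \<in> U" "norm (gradient \<phi> (x - s *\<^sub>R h) - a) < A/4" if "0 \<le> s" "s \<le> \<tau>" for s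
    proof -
      have "norm (s *\<^sub>R h) \<le> norm h" using that \<tau> by (simp add: mult_left_le_one_le)
      then have "dist x (x - s *\<^sub>R h) < r / 2" using hr by (simp add: dist_norm)
      then have "dist z (x - s *\<^sub>R h) < r" using x dist_triangle[of z "x - s *\<^sub>R h" x] by linarith
      then have "x - s *\<^sub>R h \<in> U \<inter> gradient \<phi> -` ball a (A/4)" using r(2) by auto
      then show "x - s *\<^sub>R h \<in> U" "norm (gradient \<phi> (x - s *\<^sub>R h) - a) < A/4"
        by (auto simp: dist_norm norm_minus_commute)
    qed
    have pos: "0 \<le> g \<bullet> h" if "norm (g - a) < A/4" for g
    proof -
      have "- (norm (g - a) * norm h) \<le> (g - a) \<bullet> h" using Cauchy_Schwarz_ineq2[of "g - a" h] by linarith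
      moreover have "norm (g - a) * norm h \<le> A/4 * (t * (5/4 * A))"
        using that nh A by (intro mult_mono) auto
      moreover have "- (A * (t * (A/4))) \<le> a \<bullet> (h - t *\<^sub>R a)"
      proof -
        have "norm a * norm (h - t *\<^sub>R a) \<le> A * (t * (A/4))" using h A t by (intro mult_mono) (auto simp: A_def)
        then show ?thesis using Cauchy_Schwarz_ineq2[of a "h - t *\<^sub>R a"] by linarith
      qed
      moreover have "a \<bullet> (h - t *\<^sub>R a) = a \<bullet> h - t * A\<^sup>2"
        by (simp add: A_def inner_diff_right power2_norm_eq_inner)
      moreover have "0 \<le> t * A\<^sup>2" using t by simp
      moreover have "A/4 * (t * (5/4 * A)) = 5/16 * (t * A\<^sup>2)" "A * (t * (A/4)) = 1/4 * (t * A\<^sup>2)"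
        by (simp_all add: power2_eq_square)
      moreover have "(g - a) \<bullet> h = g \<bullet> h - a \<bullet> h" by (rule inner_diff_left)
      ultimately show ?thesis by linarith
    qed
    have "\<phi> (x - \<tau> *\<^sub>R h) \<le> \<phi> (x - 0 *\<^sub>R h)"
    proof (rule DERIV_nonpos_imp_nonincreasing[OF \<tau>(1)])
      fix s assume s: "0 \<le> s" "s \<le> \<tau>"
      have "((\<lambda>s. \<phi> (x - s *\<^sub>R h)) has_derivative (\<lambda>k. gradient \<phi> (x - s *\<^sub>R h) \<bullet> (- (k *\<^sub>R h)))) (at s)"
        using smooth_on_has_gradient[OF U(3) seg(1)[OF s]]
        by (intro has_derivative_compose[of "\<lambda>s. x - s *\<^sub>R h" "\<lambda>k. - (k *\<^sub>R h)" s UNIV \<phi>, simplified])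
           (auto intro!: derivative_eq_intros)
      then have "DERIV (\<lambda>s. \<phi> (x - s *\<^sub>R h)) s :> - (gradient \<phi> (x - s *\<^sub>R h) \<bullet> h)"
        unfolding has_field_derivative_def by (rule has_derivative_eq_rhs) (auto simp: fun_eq_iff)
      then show "\<exists>y. DERIV (\<lambda>s. \<phi> (x - s *\<^sub>R h)) s :> y \<and> y \<le> 0"
        using pos[OF seg(2)[OF s]] by (intro exI conjI) auto
    qed
    also have "\<phi> (x - 0 *\<^sub>R h) < 0"
    proof -
      have "x \<in> U" using seg(1)[of 0] \<tau> by simp
      then show ?thesis using x(2) \<Omega>U by auto
    qed
    finally show "x - \<tau> *\<^sub>R h \<in> \<Omega>" using seg(1)[of \<tau>] \<tau> \<Omega>U by auto
  qed
  then show ?thesis using that[of "r/2" "A/4" \<rho> a] r A by (auto simp: \<rho>_def)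
qed

lemma emeasure_lborel_reflect:
  fixes A :: "'a::euclidean_space set"
  assumes "A \<in> sets borel"
  shows "emeasure lborel {h. x - h \<in> A} = emeasure lborel A"
proof -
  have "lborel = distr lborel borel (\<lambda>h::'a. x - h)"
    using lborel_affine[of "-1" x] by (simp add: density_1)
  then have "emeasure lborel A = emeasure (distr lborel borel (\<lambda>h. x - h)) A" by simp
  also have "\<dots> = emeasure lborel {h. x - h \<in> A}"
    using assms by (subst emeasure_distr) (auto simp: vimage_def)
  finally show ?thesis ..
qed

text \<open>The integral of the derivative along the segment is at least 1, and \<open>q \<le> (q\<^sup>2 + 1) / 2\<close> turns this
  into a lower bound for the integral of the square.\<close>

lemma energy_along_transition_segment:
  fixes w :: "'a::euclidean_space \<Rightarrow> real"
  assumes "\<And>x. x \<in> \<Omega> \<Longrightarrow> (w has_derivative (\<lambda>h. W x \<bullet> h)) (at x)" "continuous_on \<Omega> W"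
    and seg: "\<And>\<tau>. 0 \<le> \<tau> \<Longrightarrow> \<tau> \<le> 1 \<Longrightarrow> x - \<tau> *\<^sub>R h \<in> \<Omega>"
    and "1 \<le> w x" "w (x - h) = 0"
  shows "1 \<le> (\<integral>\<^sup>+\<tau>. indicator {0..1} \<tau> * ennreal ((W (x - \<tau> *\<^sub>R h) \<bullet> h)\<^sup>2) \<partial>lborel)"
proof -
  define q where "q \<tau> = W (x - \<tau> *\<^sub>R h) \<bullet> h" for \<tau>
  have "continuous_on {0..1} (\<lambda>\<tau>. W (x - \<tau> *\<^sub>R h))"
    by (rule continuous_on_compose2[OF assms(2)]) (auto intro!: continuous_intros seg)
  then have qc: "continuous_on {0..1} q" unfolding q_def by (intro continuous_intros)
  have "((\<lambda>\<tau>. - w (x - \<tau> *\<^sub>R h)) has_vector_derivative q \<tau>) (at \<tau> within {0..1})" if "0 \<le> \<tau>" "\<tau> \<le> 1" for \<tau>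
  proof -
    have "((\<lambda>s. w (x - s *\<^sub>R h)) has_derivative (\<lambda>k. W (x - \<tau> *\<^sub>R h) \<bullet> (- (k *\<^sub>R h)))) (at \<tau>)"
      using assms(1)[OF seg[OF that]]
      by (intro has_derivative_compose[of "\<lambda>s. x - s *\<^sub>R h" "\<lambda>k. - (k *\<^sub>R h)" \<tau> UNIV w, simplified])
         (auto intro!: derivative_eq_intros)
    from has_derivative_minus[OF this]
    have "((\<lambda>\<tau>. - w (x - \<tau> *\<^sub>R h)) has_vector_derivative q \<tau>) (at \<tau>)"
      unfolding has_vector_derivative_def by (rule has_derivative_eq_rhs) (auto simp: q_def fun_eq_iff)
    then show ?thesis by (rule has_vector_derivative_at_within)
  qed
  then have "(\<integral>\<tau>. indicator {0..1} \<tau> *\<^sub>R q \<tau> \<partial>lborel) = - w (x - 1 *\<^sub>R h) - (- w (x - 0 *\<^sub>R h))"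
    by (intro integral_FTC_Icc[of 0 1 "\<lambda>\<tau>. - w (x - \<tau> *\<^sub>R h)" q] qc) auto
  then have "1 \<le> (\<integral>\<tau>. indicator {0..1} \<tau> *\<^sub>R q \<tau> \<partial>lborel)" using assms(4,5) by simp
  also have "\<dots> \<le> (\<integral>\<tau>. indicator {0..1} \<tau> *\<^sub>R ((q \<tau>)\<^sup>2 / 2 + 1 / 2) \<partial>lborel)"
  proof (rule integral_mono)
    show "indicat_real {0..1} \<tau> *\<^sub>R q \<tau> \<le> indicat_real {0..1} \<tau> *\<^sub>R ((q \<tau>)\<^sup>2 / 2 + 1 / 2)" for \<tau>
      using zero_le_power2[of "q \<tau> - 1"] by (auto simp: indicator_def power2_diff)
  qed ((intro borel_integrable_compact compact_Icc continuous_intros qc; simp)+)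
  also have "\<dots> = (\<integral>\<tau>. indicator {0..1} \<tau> *\<^sub>R (q \<tau>)\<^sup>2 \<partial>lborel) / 2 + 1 / 2"
  proof -
    have i: "integrable lborel (\<lambda>\<tau>. indicator {0..1::real} \<tau> *\<^sub>R ((q \<tau>)\<^sup>2 / 2))"
      "integrable lborel (\<lambda>\<tau>. indicator {0..1::real} \<tau> *\<^sub>R (1 / 2 :: real))"
      by (intro borel_integrable_compact compact_Icc continuous_intros qc; simp)+
    have "(\<integral>\<tau>. indicator {0..1} \<tau> *\<^sub>R ((q \<tau>)\<^sup>2 / 2 + 1 / 2) \<partial>lborel) =
      (\<integral>\<tau>. indicator {0..1} \<tau> *\<^sub>R ((q \<tau>)\<^sup>2 / 2) \<partial>lborel) + (\<integral>\<tau>. indicator {0..1::real} \<tau> *\<^sub>R (1/2) \<partial>lborel)"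
      using Bochner_Integration.integral_add[OF i] by (simp only: scaleR_add_right)
    then show ?thesis by simp
  qed
  finally have *: "1 \<le> (\<integral>\<tau>. indicator {0..1} \<tau> *\<^sub>R (q \<tau>)\<^sup>2 \<partial>lborel)" by linarith
  have "integrable lborel (\<lambda>\<tau>. indicator {0..1::real} \<tau> *\<^sub>R (q \<tau>)\<^sup>2)"
    by (intro borel_integrable_compact compact_Icc continuous_intros qc)
  then have "(\<integral>\<^sup>+\<tau>. ennreal (indicator {0..1} \<tau> *\<^sub>R (q \<tau>)\<^sup>2) \<partial>lborel) = ennreal (\<integral>\<tau>. indicator {0..1} \<tau> *\<^sub>R (q \<tau>)\<^sup>2 \<partial>lborel)"
    by (rule nn_integral_eq_integral) auto
  moreover have "(\<lambda>\<tau>. ennreal (indicator {0..1} \<tau> *\<^sub>R (q \<tau>)\<^sup>2)) = (\<lambda>\<tau>. indicator {0..1} \<tau> * ennreal ((W (x - \<tau> *\<^sub>R h) \<bullet> h)\<^sup>2))"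
    by (auto simp: fun_eq_iff q_def indicator_def)
  ultimately show ?thesis using * by simp
qed

text \<open>If the ball of displacements has at least twice the volume of \<open>A\<close>, then from each point of \<open>E\<close> at least half of
  the displacements lead to a point where \<open>w = 0\<close>, so \<open>w\<close> drops by 1 on the way. Integrating the energy
  along these segments over all points and displacements, and exchanging the integrals, bounds the
  measure of \<open>E\<close> by the Dirichlet integral times the square of the scale.\<close>

lemma superlevel_measure_local:
  fixes \<Omega> :: "'a::euclidean_space set"
  assumes \<Omega>: "open \<Omega>" and cone: "interior_cone \<Omega> z r e \<kappa> \<rho>" and pos: "0 < \<kappa>" "0 < t" "t \<le> \<rho>"
    and w: "\<And>x. x \<in> \<Omega> \<Longrightarrow> (w has_derivative (\<lambda>h. W x \<bullet> h)) (at x)" "continuous_on \<Omega> W"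
    and A: "A \<in> sets borel" "\<And>x. x \<in> \<Omega> - A \<Longrightarrow> w x = 0"
    and small: "emeasure lborel A \<le> ennreal (unit_ball_vol DIM('a) * (t * \<kappa>) ^ DIM('a) / 2)"
    and E: "E \<in> sets borel" "E \<subseteq> \<Omega> \<inter> ball z r" "\<And>x. x \<in> E \<Longrightarrow> 1 \<le> w x"
  shows "emeasure lborel E \<le> ennreal (2 * ((norm e + \<kappa>) * t)\<^sup>2) * (\<integral>\<^sup>+x. indicator \<Omega> x * ennreal ((norm (W x))\<^sup>2) \<partial>lborel)"
proof -
  define K where "K = ball (t *\<^sub>R e) (t * \<kappa>)"
  define k where "k = unit_ball_vol DIM('a) * (t * \<kappa>) ^ DIM('a)"
  define R where "R = ((norm e + \<kappa>) * t)\<^sup>2"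
  have k: "0 < k" using pos by (simp add: k_def)
  have Kk: "emeasure lborel K = ennreal k" using pos by (simp add: K_def k_def emeasure_ball)
  have [measurable]: "K \<in> sets borel" "E \<in> sets borel" "A \<in> sets borel" "\<Omega> \<in> sets borel"
    using A E \<Omega> by (auto simp: K_def)
  define g :: "'a \<Rightarrow> ennreal" where "g x = ennreal (indicator \<Omega> x *\<^sub>R (norm (W x))\<^sup>2)" for x
  have [measurable]: "g \<in> borel_measurable borel"
    unfolding g_def by (intro measurable_compose[OF _ measurable_ennreal] borel_measurable_continuous_on_indicator)
       (auto intro!: continuous_intros w(2))
  have geq: "g x = indicator \<Omega> x * ennreal ((norm (W x))\<^sup>2)" for x by (simp add: g_def indicator_def)
  define P where "P x h = indicator K h * (ennreal R * (\<integral>\<^sup>+\<tau>. indicator {0..1::real} \<tau> * g (x - \<tau> *\<^sub>R h) \<partial>lborel))" for x h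
  have [measurable]: "case_prod P \<in> borel_measurable (lborel \<Otimes>\<^sub>M lborel)"
    unfolding P_def by measurable
  have lower: "ennreal (k / 2) \<le> (\<integral>\<^sup>+h. P x h \<partial>lborel)" if "x \<in> E" for x
  proof -
    have x: "x \<in> \<Omega> \<inter> ball z r" "1 \<le> w x" using E that by auto
    define H where "H = {h \<in> K. x - h \<notin> A}"
    have [measurable]: "H \<in> sets borel" "{h. x - h \<in> A} \<in> sets borel" unfolding H_def by measurable
    have "ennreal k \<le> emeasure lborel (H \<union> {h. x - h \<in> A})"
      unfolding Kk[symmetric] by (intro emeasure_mono) (auto simp: H_def)
    also have "\<dots> \<le> emeasure lborel H + emeasure lborel {h. x - h \<in> A}"
      by (intro emeasure_subadditive) auto
    also have "\<dots> \<le> emeasure lborel H + ennreal (k / 2)"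
      using small by (intro add_left_mono) (simp add: emeasure_lborel_reflect k_def)
    finally have "ennreal k \<le> emeasure lborel H + ennreal (k / 2)" .
    moreover have "ennreal k = ennreal (k/2) + ennreal (k/2)" using k by (simp flip: ennreal_plus)
    ultimately have "ennreal (k / 2) \<le> emeasure lborel H"
      by (metis add.commute ennreal_add_left_cancel_le ennreal_neq_top infinity_ennreal_def)
    also have "\<dots> = (\<integral>\<^sup>+h. indicator H h \<partial>lborel)" by simp
    also have "\<dots> \<le> (\<integral>\<^sup>+h. P x h \<partial>lborel)"
    proof (rule nn_integral_mono)
      fix h
      show "indicator H h \<le> P x h"
      proof (cases "h \<in> H")
        case True
        then have h: "h \<in> K" "x - h \<notin> A" by (auto simp: H_def)
        have seg: "x - \<tau> *\<^sub>R h \<in> \<Omega>" if "0 \<le> \<tau>" "\<tau> \<le> 1" for \<tau>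
          using cone x(1) h(1) that pos unfolding interior_cone_def K_def by auto
        have "x - h \<in> \<Omega>" using seg[of 1] by simp
        then have "w (x - h) = 0" using A(2) h(2) by blast
        have nh: "(norm h)\<^sup>2 \<le> R"
        proof -
          have "norm h \<le> norm (t *\<^sub>R e) + norm (h - t *\<^sub>R e)" by (metis add.commute diff_add_cancel norm_triangle_ineq)
          also have "\<dots> \<le> (norm e + \<kappa>) * t" using h(1) pos by (simp add: K_def dist_norm norm_minus_commute algebra_simps)
          finally show ?thesis unfolding R_def by (intro power_mono) auto
        qed
        have "1 \<le> (\<integral>\<^sup>+\<tau>. indicator {0..1} \<tau> * ennreal ((W (x - \<tau> *\<^sub>R h) \<bullet> h)\<^sup>2) \<partial>lborel)"
          using energy_along_transition_segment[OF w seg x(2) \<open>w (x - h) = 0\<close>] .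
        also have "\<dots> \<le> (\<integral>\<^sup>+\<tau>. ennreal R * (indicator {0..1} \<tau> * g (x - \<tau> *\<^sub>R h)) \<partial>lborel)"
        proof (rule nn_integral_mono)
          fix \<tau> :: real
          show "indicator {0..1} \<tau> * ennreal ((W (x - \<tau> *\<^sub>R h) \<bullet> h)\<^sup>2) \<le> ennreal R * (indicator {0..1} \<tau> * g (x - \<tau> *\<^sub>R h))"
          proof (cases "\<tau> \<in> {0..1}")
            case True
            have "(W (x - \<tau> *\<^sub>R h) \<bullet> h)\<^sup>2 \<le> (norm (W (x - \<tau> *\<^sub>R h)))\<^sup>2 * (norm h)\<^sup>2"
              using Cauchy_Schwarz_ineq[of "W (x - \<tau> *\<^sub>R h)" h] by (simp add: power2_norm_eq_inner)
            also have "\<dots> \<le> (norm (W (x - \<tau> *\<^sub>R h)))\<^sup>2 * R" using nh by (intro mult_left_mono) auto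
            finally show ?thesis using True seg[of \<tau>]
              by (simp add: g_def ennreal_mult[symmetric] R_def mult.commute ennreal_leI)
          qed simp
        qed
        also have "\<dots> = ennreal R * (\<integral>\<^sup>+\<tau>. indicator {0..1} \<tau> * g (x - \<tau> *\<^sub>R h) \<partial>lborel)"
          by (rule nn_integral_cmult) measurable
        finally show ?thesis using True h by (simp add: P_def)
      qed simp
    qed
    finally show ?thesis .
  qed
  have "ennreal (k / 2) * emeasure lborel E = (\<integral>\<^sup>+x. ennreal (k/2) * indicator E x \<partial>lborel)"
    by (simp add: nn_integral_cmult)
  also have "\<dots> \<le> (\<integral>\<^sup>+x. (\<integral>\<^sup>+h. P x h \<partial>lborel) \<partial>lborel)"
    using lower by (intro nn_integral_mono) (auto simp: indicator_def)
  also have "\<dots> = (\<integral>\<^sup>+h. (\<integral>\<^sup>+x. P x h \<partial>lborel) \<partial>lborel)"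
    by (rule lborel_pair.Fubini'[symmetric]) measurable
  also have "\<dots> = (\<integral>\<^sup>+h. indicator K h * (ennreal R * (\<integral>\<^sup>+x. g x \<partial>lborel)) \<partial>lborel)"
  proof (rule nn_integral_cong)
    fix h
    have "(\<integral>\<^sup>+x. (\<integral>\<^sup>+\<tau>. indicator {0..1::real} \<tau> * g (x - \<tau> *\<^sub>R h) \<partial>lborel) \<partial>lborel)
      = (\<integral>\<^sup>+\<tau>. (\<integral>\<^sup>+x. indicator {0..1::real} \<tau> * g (x - \<tau> *\<^sub>R h) \<partial>lborel) \<partial>lborel)"
      by (rule lborel_pair.Fubini'[symmetric]) measurable
    also have "\<dots> = (\<integral>\<^sup>+\<tau>. indicator {0..1::real} \<tau> * (\<integral>\<^sup>+x. g x \<partial>lborel) \<partial>lborel)"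
    proof (rule nn_integral_cong)
      fix \<tau> :: real
      have "(\<integral>\<^sup>+x. g (x - \<tau> *\<^sub>R h) \<partial>lborel) = (\<integral>\<^sup>+x. g x \<partial>lborel)"
        using nn_integral_lborel_translation[of g "- (\<tau> *\<^sub>R h)"] by simp
      then show "(\<integral>\<^sup>+x. indicator {0..1} \<tau> * g (x - \<tau> *\<^sub>R h) \<partial>lborel) = indicator {0..1} \<tau> * (\<integral>\<^sup>+x. g x \<partial>lborel)"
        by (subst nn_integral_cmult) auto
    qed
    also have "\<dots> = (\<integral>\<^sup>+x. g x \<partial>lborel)" by (simp add: nn_integral_multc)
    finally show "(\<integral>\<^sup>+x. P x h \<partial>lborel) = indicator K h * (ennreal R * (\<integral>\<^sup>+x. g x \<partial>lborel))"
      unfolding P_def by (simp add: nn_integral_cmult)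
  qed
  also have "\<dots> = ennreal k * (ennreal R * (\<integral>\<^sup>+x. g x \<partial>lborel))"
    by (simp add: nn_integral_multc Kk)
  also have "\<dots> = ennreal (k / 2) * (ennreal (2 * R) * (\<integral>\<^sup>+x. g x \<partial>lborel))"
    using k by (simp add: mult.assoc[symmetric] ennreal_mult[symmetric] R_def)
  finally show ?thesis
    using k by (simp add: ennreal_mult_le_mult_iff R_def geq)
qed

text \<open>An inequality of Faber--Krahn type that replaces the Sobolev embedding. The scale \<open>t\<close> in the local
  estimate is tied to the measure of \<open>A\<close> by \<open>t\<^sup>n \<sim> |A|\<close>, so its square is the power \<open>2 / n\<close>; the restriction
  to small \<open>|A|\<close> keeps the displacements inside the interior cones.\<close>

theorem superlevel_measure_estimate:
  fixes \<Omega> :: "'a::euclidean_space set"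
  assumes dom: "bounded_smooth_domain \<Omega>"
  obtains C \<alpha>\<^sub>0 where "0 < C" "0 < \<alpha>\<^sub>0"
    "\<And>w W A E. (\<And>x. x \<in> \<Omega> \<Longrightarrow> (w has_derivative (\<lambda>h. W x \<bullet> h)) (at x)) \<Longrightarrow> continuous_on \<Omega> W \<Longrightarrow>
      set_integrable lborel \<Omega> (\<lambda>x. (norm (W x))\<^sup>2) \<Longrightarrow>
      A \<in> sets borel \<Longrightarrow> A \<subseteq> \<Omega> \<Longrightarrow> (\<And>x. x \<in> \<Omega> - A \<Longrightarrow> w x = 0) \<Longrightarrow> measure lborel A \<le> \<alpha>\<^sub>0 \<Longrightarrow>
      E \<in> sets borel \<Longrightarrow> E \<subseteq> \<Omega> \<Longrightarrow> (\<And>x. x \<in> E \<Longrightarrow> 1 \<le> w x) \<Longrightarrow>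
      measure lborel E \<le> C * measure lborel A powr (2 / real DIM('a)) * (LINT x:\<Omega>|lborel. (norm (W x))\<^sup>2)"
proof -
  have \<Omega>: "open \<Omega>" "bounded \<Omega>" using dom by (auto simp: bounded_smooth_domain_def)
  have ccl: "compact (closure \<Omega>)" using \<Omega> by simp
  define \<omega> where "\<omega> = unit_ball_vol (real DIM('a))"
  have \<omega>: "0 < \<omega>" by (simp add: \<omega>_def)
  have n: "0 < DIM('a)" by simp
  have "\<forall>z\<in>closure \<Omega>. \<exists>r e \<kappa> \<rho>. 0 < r \<and> 0 < \<kappa> \<and> 0 < \<rho> \<and> interior_cone \<Omega> z r e \<kappa> \<rho>"
    using interior_cone_exists[OF dom] by metis
  then obtain r e \<kappa> \<rho> where cone: "\<And>z. z \<in> closure \<Omega> \<Longrightarrow> 0 < r z" "\<And>z. z \<in> closure \<Omega> \<Longrightarrow> 0 < \<kappa> z"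
      "\<And>z. z \<in> closure \<Omega> \<Longrightarrow> 0 < \<rho> z" "\<And>z. z \<in> closure \<Omega> \<Longrightarrow> interior_cone \<Omega> z (r z) (e z) (\<kappa> z) (\<rho> z)"
    by metis
  have "closure \<Omega> \<subseteq> (\<Union>z\<in>closure \<Omega>. ball z (r z))" using cone(1) by force
  then obtain T where T: "T \<subseteq> closure \<Omega>" "finite T" "closure \<Omega> \<subseteq> (\<Union>z\<in>T. ball z (r z))"
    using compactE_image[OF ccl, of "closure \<Omega>" "\<lambda>z. ball z (r z)"] by auto
  define c where "c z = 2 * ((norm (e z) + \<kappa> z) / \<kappa> z)\<^sup>2 * (2 / \<omega>) powr (2 / DIM('a))" for z
  define a where "a z = \<omega> * (\<rho> z * \<kappa> z) ^ DIM('a) / 2" for z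
  define C where "C = (\<Sum>z\<in>T. c z) + 1"
  define \<alpha>\<^sub>0 where "\<alpha>\<^sub>0 = Min (insert 1 (a ` T))"
  have c0: "0 \<le> c z" for z by (simp add: c_def)
  have "0 < C" using c0 sum_nonneg[of T c] by (simp add: C_def add_nonneg_pos)
  moreover have "0 < \<alpha>\<^sub>0" using T cone \<omega> by (auto simp: \<alpha>\<^sub>0_def a_def)
  moreover have "measure lborel E \<le> C * measure lborel A powr (2 / real DIM('a)) * (LINT x:\<Omega>|lborel. (norm (W x))\<^sup>2)"
    if w: "\<And>x. x \<in> \<Omega> \<Longrightarrow> (w has_derivative (\<lambda>h. W x \<bullet> h)) (at x)" "continuous_on \<Omega> W"
      and int: "set_integrable lborel \<Omega> (\<lambda>x. (norm (W x))\<^sup>2)"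
      and A: "A \<in> sets borel" "A \<subseteq> \<Omega>" "\<And>x. x \<in> \<Omega> - A \<Longrightarrow> w x = 0" "measure lborel A \<le> \<alpha>\<^sub>0"
      and E: "E \<in> sets borel" "E \<subseteq> \<Omega>" "\<And>x. x \<in> E \<Longrightarrow> 1 \<le> w x" for w W A E
  proof -
    define \<alpha> where "\<alpha> = measure lborel A"
    define D where "D = (LINT x:\<Omega>|lborel. (norm (W x))\<^sup>2)"
    have D0: "0 \<le> D" unfolding D_def set_lebesgue_integral_def by (intro integral_nonneg_AE AE_I2) auto
    have Afin: "emeasure lborel A = ennreal \<alpha>"
      unfolding \<alpha>_def using emeasure_bounded_finite[OF bounded_subset[OF \<Omega>(2) A(2)]]
      by (intro emeasure_eq_ennreal_measure) (auto simp: less_top)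
    have EA: "E \<subseteq> A" using E A(3) by force
    show ?thesis
    proof (cases "\<alpha> = 0")
      case True
      have "measure lborel E \<le> measure lborel A"
        using EA A(1) E(1) Afin by (intro measure_mono_fmeasurable) (auto simp: fmeasurable_def)
      then show ?thesis using True by (simp add: \<alpha>_def)
    next
      case False
      then have \<alpha>: "0 < \<alpha>" by (simp add: \<alpha>_def zero_less_measure_iff)
      have Dn: "(\<integral>\<^sup>+x. indicator \<Omega> x * ennreal ((norm (W x))\<^sup>2) \<partial>lborel) = ennreal D"
      proof -
        have "(\<integral>\<^sup>+x. ennreal (indicator \<Omega> x *\<^sub>R (norm (W x))\<^sup>2) \<partial>lborel) = ennreal D"
          unfolding D_def set_lebesgue_integral_def
          using int by (intro nn_integral_eq_integral) (auto simp: set_integrable_def)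
        moreover have "(\<lambda>x. ennreal (indicator \<Omega> x *\<^sub>R (norm (W x))\<^sup>2)) = (\<lambda>x. indicator \<Omega> x * ennreal ((norm (W x))\<^sup>2))"
          by (auto simp: indicator_def fun_eq_iff)
        ultimately show ?thesis by simp
      qed
      have piece: "measure lborel (E \<inter> ball z (r z)) \<le> c z * \<alpha> powr (2 / DIM('a)) * D" if z: "z \<in> T" for z
      proof -
        have zc: "z \<in> closure \<Omega>" using z T(1) by blast
        \<comment> \<open>\<open>m\<close> is the radius at which the ball of displacements has measure \<open>2 * \<alpha>\<close>.\<close>
        define m where "m = (2 * \<alpha> / \<omega>) powr (1 / DIM('a))"
        define t where "t = m / \<kappa> z"
        have m: "0 < m" using \<alpha> \<omega> by (simp add: m_def)
        have mn: "m ^ DIM('a) = 2 * \<alpha> / \<omega>"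
          using \<alpha> \<omega> n unfolding m_def by (simp add: powr_realpow[symmetric] powr_powr)
        have "\<alpha> \<le> a z" using A(4) z T(2) by (auto simp: \<alpha>\<^sub>0_def \<alpha>_def[symmetric])
        then have "m ^ DIM('a) \<le> (\<rho> z * \<kappa> z) ^ DIM('a)"
          unfolding mn a_def using \<omega> by (simp add: field_simps)
        then have "m \<le> \<rho> z * \<kappa> z"
          using power_mono_iff[of m "\<rho> z * \<kappa> z" "DIM('a)"] m cone(2,3)[OF zc] n by simp
        then have t: "0 < t" "t \<le> \<rho> z" using m cone(2)[OF zc] by (auto simp: t_def field_simps)
        have "emeasure lborel (E \<inter> ball z (r z)) \<le> ennreal (2 * ((norm (e z) + \<kappa> z) * t)\<^sup>2) * ennreal D"
          unfolding Dn[symmetric]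
        proof (rule superlevel_measure_local[OF \<Omega>(1) cone(4)[OF zc] cone(2)[OF zc] t w A(1,3)])
          show "emeasure lborel A \<le> ennreal (unit_ball_vol (real DIM('a)) * (t * \<kappa> z) ^ DIM('a) / 2)"
            using mn cone(2)[OF zc] \<omega> unfolding Afin by (simp add: t_def \<omega>_def[symmetric])
        qed (use E in auto)
        also have "\<dots> = ennreal (2 * ((norm (e z) + \<kappa> z) * t)\<^sup>2 * D)" using D0 by (simp add: ennreal_mult)
        finally have "measure lborel (E \<inter> ball z (r z)) \<le> 2 * ((norm (e z) + \<kappa> z) * t)\<^sup>2 * D"
          unfolding measure_def using D0 by (intro enn2real_leI) auto
        also have "2 * ((norm (e z) + \<kappa> z) * t)\<^sup>2 = c z * \<alpha> powr (2 / DIM('a))"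
        proof -
          have "m\<^sup>2 = (2 * \<alpha> / \<omega>) powr (2 / DIM('a))"
            using \<alpha> \<omega> unfolding m_def by (simp add: powr_realpow[symmetric] powr_powr)
          also have "\<dots> = (2 / \<omega>) powr (2 / DIM('a)) * \<alpha> powr (2 / DIM('a))"
            using \<alpha> \<omega> by (simp add: powr_mult[symmetric])
          finally show ?thesis by (simp add: t_def c_def power_mult_distrib power_divide)
        qed
        finally show ?thesis .
      qed
      have "E = (\<Union>z\<in>T. E \<inter> ball z (r z))" using E(2) T(3) closure_subset by blast
      then have "measure lborel E \<le> (\<Sum>z\<in>T. measure lborel (E \<inter> ball z (r z)))"
        using measure_UNION_le[OF T(2), of "\<lambda>z. E \<inter> ball z (r z)" lborel] E(1) by simp
      also have "\<dots> \<le> (\<Sum>z\<in>T. c z * \<alpha> powr (2 / DIM('a)) * D)" by (intro sum_mono piece)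
      also have "\<dots> \<le> C * \<alpha> powr (2 / DIM('a)) * D"
        unfolding C_def sum_distrib_right[symmetric] using D0 by (intro mult_right_mono) auto
      finally show ?thesis by (simp add: \<alpha>_def D_def)
    qed
  qed
  ultimately show ?thesis by (rule that)
qed

section \<open>De Giorgi iteration\<close>

text \<open>De Giorgi's fast geometric convergence: with steps \<open>H / 2 ^ j\<close>, a superlinear recursion beats the
  growing factor \<open>2 ^ j\<close>, and \<open>H\<close> is chosen so that the decay rate \<open>\<theta>\<close> reproduces itself.\<close>

lemma level_iteration_vanishes:
  fixes a :: "real \<Rightarrow> real"
  assumes nonneg: "\<And>l. 0 \<le> a l" and mono: "\<And>l l'. l \<le> l' \<Longrightarrow> a l' \<le> a l"
    and pos: "0 < B" "0 < \<beta>" "0 < \<alpha>\<^sub>0" and start: "a l\<^sub>0 \<le> \<alpha>\<^sub>0"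
    and step: "\<And>l h. l\<^sub>0 \<le> l \<Longrightarrow> 0 < h \<Longrightarrow> a (l + h) \<le> B / h * a l powr (1 + \<beta>)"
  shows "a (l\<^sub>0 + 2 * (B * \<alpha>\<^sub>0 powr \<beta> * 2 powr (1 / \<beta>))) = 0"
proof -
  define H where "H = B * \<alpha>\<^sub>0 powr \<beta> * 2 powr (1 / \<beta>)"
  define \<theta> where "\<theta> = 2 powr (- 1 / \<beta>)"
  define lev where "lev j = l\<^sub>0 + H * (2 - 2 / 2 ^ j)" for j :: nat
  have H: "0 < H" using pos by (simp add: H_def)
  have \<theta>: "0 < \<theta>" "\<theta> < 1" using pos powr_less_one[of 2 "- 1 / \<beta>"] by (auto simp: \<theta>_def)
  have \<theta>\<beta>: "\<theta> powr \<beta> = 1 / 2" using pos unfolding \<theta>_def powr_powr by (simp add: powr_neg_one)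
  have H\<theta>: "B * \<alpha>\<^sub>0 powr \<beta> = H * \<theta>" by (simp add: H_def \<theta>_def powr_minus)
  have geo: "a (lev j) \<le> \<alpha>\<^sub>0 * \<theta> ^ j" for j
  proof (induction j)
    case 0 then show ?case using start by (simp add: lev_def)
  next
    case (Suc j)
    have "(1::real) \<le> 2 ^ j" by simp
    then have "2 / 2 ^ j \<le> (2::real)" by (simp add: divide_le_eq)
    then have "l\<^sub>0 \<le> lev j" using H by (simp add: lev_def)
    have "lev (Suc j) = lev j + H / 2 ^ j" by (simp add: lev_def field_simps)
    then have "a (lev (Suc j)) \<le> B / (H / 2 ^ j) * a (lev j) powr (1 + \<beta>)"
      using step[OF \<open>l\<^sub>0 \<le> lev j\<close>, of "H / 2 ^ j"] H by simp
    also have "\<dots> \<le> B / (H / 2 ^ j) * (\<alpha>\<^sub>0 * \<theta> ^ j) powr (1 + \<beta>)"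
      using Suc nonneg pos H by (intro mult_left_mono powr_mono2) auto
    also have "(\<alpha>\<^sub>0 * \<theta> ^ j) powr (1 + \<beta>) = \<alpha>\<^sub>0 * \<theta> ^ j * (\<alpha>\<^sub>0 powr \<beta> * (1 / 2) ^ j)"
    proof -
      have "(\<theta> ^ j) powr \<beta> = (\<theta> powr \<beta>) ^ j"
        using \<theta> by (simp add: powr_realpow[symmetric] powr_powr mult.commute)
      then have "(\<theta> ^ j) powr \<beta> = (1 / 2) ^ j" using \<theta>\<beta> by simp
      then show ?thesis using pos \<theta> by (simp add: powr_add powr_mult)
    qed
    also have "B / (H / 2 ^ j) * (\<alpha>\<^sub>0 * \<theta> ^ j * (\<alpha>\<^sub>0 powr \<beta> * (1 / 2) ^ j)) = \<alpha>\<^sub>0 * \<theta> ^ j * ((B * \<alpha>\<^sub>0 powr \<beta>) / H)"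
      by (simp add: field_simps power_one_over)
    also have "\<dots> = \<alpha>\<^sub>0 * \<theta> ^ Suc j" unfolding H\<theta> using H by simp
    finally show ?case .
  qed
  have "a (l\<^sub>0 + 2 * H) \<le> \<alpha>\<^sub>0 * \<theta> ^ j" for j
    using mono[of "lev j" "l\<^sub>0 + 2 * H"] geo[of j] H by (auto simp: lev_def algebra_simps)
  moreover have "(\<lambda>j. \<alpha>\<^sub>0 * \<theta> ^ j) \<longlonglongrightarrow> \<alpha>\<^sub>0 * 0"
    using \<theta> by (intro tendsto_intros LIMSEQ_power_zero) auto
  ultimately have "a (l\<^sub>0 + 2 * H) \<le> 0"
    by (intro LIMSEQ_le_const[of "\<lambda>j. \<alpha>\<^sub>0 * \<theta> ^ j"]) auto
  then show ?thesis using nonneg[of "l\<^sub>0 + 2 * H"] by (simp add: H_def)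
qed

lemma open_measure_eq_0_imp_empty:
  fixes S :: "'a::euclidean_space set"
  assumes "open S" "emeasure lborel S = 0"
  shows "S = {}"
proof -
  have "S \<in> null_sets lborel" using assms by (intro null_setsI) auto
  then have "negligible S" by (simp add: negligible_iff_null_sets null_sets_completionI)
  then show ?thesis using open_not_negligible[OF assms(1)] by blast
qed

text \<open>De Giorgi's truncation argument. Testing with a smooth step from level \<open>l\<close> to \<open>l + h\<close> bounds the
  Dirichlet integral of the truncation by the integral of \<open>f\<close> over \<open>{w > l}\<close> divided by \<open>h * d\<close>, up to a factor 2. The
  hypothesis on \<open>f\<close>, a weak form of \<open>f \<in> L\<^bsup>1/\<kappa>\<^esup>\<close>, then gives a recursion for the measures of the level sets with
  exponent \<open>1 + 2 / n - \<kappa>\<close>, which exceeds 1 exactly because \<open>\<kappa> < 2 / n\<close>. The starting level, beyond which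
  the level sets are small, comes from testing with the step from 1 to 2.\<close>

theorem neumann_sup_bound:
  fixes \<Omega> :: "'a::euclidean_space set"
  assumes dom: "bounded_smooth_domain \<Omega>" and \<nu>: "unit_outer_normal \<Omega> \<nu>"
    and \<kappa>: "0 < \<kappa>" "\<kappa> < 1" "\<kappa> < 2 / real DIM('a)"
  obtains C where "1 \<le> C"
    "\<And>d N w f x. 0 < d \<Longrightarrow> 1 \<le> N \<Longrightarrow> smooth_up_to_boundary \<Omega> w \<Longrightarrow>
      (\<And>y. y \<in> frontier \<Omega> \<Longrightarrow> has_normal_derivative \<nu> w 0 y) \<Longrightarrow>
      continuous_on (closure \<Omega>) f \<Longrightarrow> (\<And>x. x \<in> \<Omega> \<Longrightarrow> 0 \<le> f x) \<Longrightarrow>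
      (\<And>x. x \<in> \<Omega> \<Longrightarrow> 1 < w x \<Longrightarrow> w x - f x \<le> d * laplacian w x) \<Longrightarrow>
      (\<And>A. A \<in> sets borel \<Longrightarrow> A \<subseteq> \<Omega> \<Longrightarrow> (LINT x:A|lborel. f x) \<le> N * measure lborel A powr (1 - \<kappa>)) \<Longrightarrow>
      x \<in> closure \<Omega> \<Longrightarrow> w x \<le> C * N * (1 + 1 / d)"
proof -
  have \<Omega>: "open \<Omega>" "bounded \<Omega>" using dom by (auto simp: bounded_smooth_domain_def)
  obtain C0 \<alpha>\<^sub>0 where C0: "0 < C0" and \<alpha>\<^sub>0: "0 < \<alpha>\<^sub>0" and sup:
    "\<And>w W A E. (\<And>x. x \<in> \<Omega> \<Longrightarrow> (w has_derivative (\<lambda>h. W x \<bullet> h)) (at x)) \<Longrightarrow> continuous_on \<Omega> W \<Longrightarrow>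
      set_integrable lborel \<Omega> (\<lambda>x. (norm (W x))\<^sup>2) \<Longrightarrow>
      A \<in> sets borel \<Longrightarrow> A \<subseteq> \<Omega> \<Longrightarrow> (\<And>x. x \<in> \<Omega> - A \<Longrightarrow> w x = 0) \<Longrightarrow> measure lborel A \<le> \<alpha>\<^sub>0 \<Longrightarrow>
      E \<in> sets borel \<Longrightarrow> E \<subseteq> \<Omega> \<Longrightarrow> (\<And>x. x \<in> E \<Longrightarrow> 1 \<le> w x) \<Longrightarrow>
      measure lborel E \<le> C0 * measure lborel A powr (2 / real DIM('a)) * (LINT x:\<Omega>|lborel. (norm (W x))\<^sup>2)"
    using superlevel_measure_estimate[OF dom] by blast
  define \<mu> where "\<mu> = measure lborel \<Omega>"
  define \<beta> where "\<beta> = 2 / real DIM('a) - \<kappa>"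
  have \<beta>: "0 < \<beta>" using \<kappa> by (simp add: \<beta>_def)
  define H0 where "H0 = 2 * (2 * C0 * \<alpha>\<^sub>0 powr \<beta> * 2 powr (1 / \<beta>))"
  define L0 where "L0 = \<mu> powr (1 - \<kappa>) / \<alpha>\<^sub>0"
  define C where "C = 2 + L0 + H0"
  have H0: "0 \<le> H0" using C0 by (simp add: H0_def)
  have L0: "0 \<le> L0" using \<alpha>\<^sub>0 by (simp add: L0_def)
  have fin: "emeasure lborel A < \<infinity>" if "A \<subseteq> \<Omega>" for A
    using emeasure_bounded_finite[OF bounded_subset[OF \<Omega>(2) that]] .
  have "w x \<le> C * N * (1 + 1 / d)"
    if d: "0 < d" and N: "1 \<le> N" and ws: "smooth_up_to_boundary \<Omega> w"
      and nd: "\<And>y. y \<in> frontier \<Omega> \<Longrightarrow> has_normal_derivative \<nu> w 0 y"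
      and fc: "continuous_on (closure \<Omega>) f" and f0: "\<And>x. x \<in> \<Omega> \<Longrightarrow> 0 \<le> f x"
      and ineq: "\<And>x. x \<in> \<Omega> \<Longrightarrow> 1 < w x \<Longrightarrow> w x - f x \<le> d * laplacian w x"
      and fN: "\<And>A. A \<in> sets borel \<Longrightarrow> A \<subseteq> \<Omega> \<Longrightarrow> (LINT x:A|lborel. f x) \<le> N * measure lborel A powr (1 - \<kappa>)"
      and x: "x \<in> closure \<Omega>" for d N w f x
  proof -
    have wc: "continuous_on (closure \<Omega>) w" and wsm: "smooth_on \<Omega> w"
      using ws by (auto simp: smooth_up_to_boundary_def)
    have wc': "continuous_on \<Omega> w" by (rule continuous_on_subset[OF wc closure_subset])
    define A where "A l = {x \<in> \<Omega>. l < w x}" for l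
    define a where "a l = measure lborel (A l)" for l
    have Ao: "open (A l)" for l
    proof -
      have "open (\<Omega> \<inter> w -` {l<..})" using wc' \<Omega>(1) by (intro continuous_open_preimage) auto
      moreover have "\<Omega> \<inter> w -` {l<..} = A l" by (auto simp: A_def)
      ultimately show ?thesis by simp
    qed
    have Ab: "A l \<in> sets borel" "A l \<subseteq> \<Omega>" for l using Ao[of l] by (auto simp: A_def)
    have fint: "set_integrable lborel \<Omega> f"
      by (rule set_integrable_continuous_closure[OF \<Omega> fc]) simp
    have fintA: "set_integrable lborel (A l) f" for l
      using set_integrable_subset[OF fint, of "A l"] Ab[of l] by auto
    have amono: "a l' \<le> a l" if "l \<le> l'" for l l'
      unfolding a_def using that Ab[of l] Ab[of l'] fin[OF Ab(2)[of l]]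
      by (intro measure_mono_fmeasurable) (auto simp: A_def fmeasurable_def)
    have a0: "0 \<le> a l" for l by (simp add: a_def)
    have test: "set_integrable lborel \<Omega> (\<lambda>x. smoothstep ((w x - l) / h) * laplacian w x)"
       "set_integrable lborel \<Omega> (\<lambda>x. smoothstep' ((w x - l) / h) / h * (norm (gradient w x))\<^sup>2)"
       "(LINT x:\<Omega>|lborel. smoothstep ((w x - l) / h) * laplacian w x)
         = - (LINT x:\<Omega>|lborel. smoothstep' ((w x - l) / h) / h * (norm (gradient w x))\<^sup>2)" if h: "0 < h" for l h
    proof -
      have 1: "((\<lambda>y. smoothstep ((y - l) / h)) has_real_derivative smoothstep' ((y - l) / h) / h) (at y)" for y
      proof -
        have "((\<lambda>y. (y - l) / h) has_real_derivative 1 / h) (at y)"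
          using h by (auto intro!: derivative_eq_intros)
        from DERIV_chain'[OF this smoothstep_has_real_derivative] show ?thesis by simp
      qed
      have 2: "continuous_on (w ` closure \<Omega>) (\<lambda>y. smoothstep' ((y - l) / h) / h)"
        using h by (auto intro!: continuous_intros)
      show "set_integrable lborel \<Omega> (\<lambda>x. smoothstep ((w x - l) / h) * laplacian w x)"
       "set_integrable lborel \<Omega> (\<lambda>x. smoothstep' ((w x - l) / h) / h * (norm (gradient w x))\<^sup>2)"
       "(LINT x:\<Omega>|lborel. smoothstep ((w x - l) / h) * laplacian w x)
         = - (LINT x:\<Omega>|lborel. smoothstep' ((w x - l) / h) / h * (norm (gradient w x))\<^sup>2)"
        using neumann_weak_form[OF dom \<nu> ws nd 1 2] by auto
    qed
    have energy: "(LINT x:\<Omega>|lborel. smoothstep' ((w x - l) / h) / h * (norm (gradient w x))\<^sup>2)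
        + (LINT x:\<Omega>|lborel. smoothstep ((w x - l) / h) * w x) / d \<le> (LINT x:A l|lborel. f x) / d"
      if l: "1 \<le> l" and h: "0 < h" for l h
    proof -
      let ?T = "\<lambda>x. smoothstep ((w x - l) / h)"
      have i1: "set_integrable lborel \<Omega> (\<lambda>x. ?T x * w x)"
        by (rule set_integrable_continuous_closure[OF \<Omega>, where g="\<lambda>x. ?T x * w x"])
           (use h in \<open>auto intro!: continuous_intros wc\<close>)
      have i2: "set_integrable lborel \<Omega> (\<lambda>x. indicator (A l) x * f x)"
      proof -
        have "(\<lambda>x. indicat_real \<Omega> x *\<^sub>R (indicator (A l) x * f x)) = (\<lambda>x. indicat_real (A l) x *\<^sub>R f x)"
          using Ab(2)[of l] by (auto simp: indicator_def fun_eq_iff)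
        then show ?thesis using fintA[of l] by (simp add: set_integrable_def)
      qed
      have "(LINT x:\<Omega>|lborel. ?T x * w x) - (LINT x:\<Omega>|lborel. indicator (A l) x * f x)
        = (LINT x:\<Omega>|lborel. ?T x * w x - indicator (A l) x * f x)"
        by (rule set_integral_diff(2)[OF i1 i2, symmetric])
      also have "\<dots> \<le> (LINT x:\<Omega>|lborel. d * (?T x * laplacian w x))"
      proof (rule set_integral_mono)
        show "set_integrable lborel \<Omega> (\<lambda>x. ?T x * w x - indicator (A l) x * f x)"
          by (rule set_integral_diff(1)[OF i1 i2])
        show "set_integrable lborel \<Omega> (\<lambda>x. d * (?T x * laplacian w x))"
          using test(1)[OF h] by simp
        fix x assume x: "x \<in> \<Omega>"
        show "?T x * w x - indicator (A l) x * f x \<le> d * (?T x * laplacian w x)"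
        proof (cases "x \<in> A l")
          case True
          then have "w x - f x \<le> d * laplacian w x" using ineq[OF x] l by (auto simp: A_def)
          then have "?T x * (w x - f x) \<le> ?T x * (d * laplacian w x)"
            by (intro mult_left_mono smoothstep_bounds)
          moreover have "?T x * f x \<le> f x"
            using smoothstep_bounds[of "(w x - l) / h"] f0[OF x] by (intro mult_left_le_one_le)
          ultimately show ?thesis using True by (simp add: algebra_simps)
        next
          case False
          then have "(w x - l) / h \<le> 0" using x h by (auto simp: A_def divide_le_0_iff)
          then show ?thesis using False by (simp add: smoothstep_le_0)
        qed
      qed
      also have "\<dots> = - (d * (LINT x:\<Omega>|lborel. smoothstep' ((w x - l) / h) / h * (norm (gradient w x))\<^sup>2))"
        using test(3)[OF h, of l] by simp
      also have "(LINT x:\<Omega>|lborel. indicator (A l) x * f x) = (LINT x:A l|lborel. f x)"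
        unfolding set_lebesgue_integral_def
        by (rule Bochner_Integration.integral_cong) (use Ab(2)[of l] in \<open>auto simp: indicator_def\<close>)
      finally have "d * (LINT x:\<Omega>|lborel. smoothstep' ((w x - l) / h) / h * (norm (gradient w x))\<^sup>2)
          + (LINT x:\<Omega>|lborel. ?T x * w x) \<le> (LINT x:A l|lborel. f x)" by linarith
      from divide_right_mono[OF this, of d] show ?thesis
        using d unfolding add_divide_distrib by simp
    qed
    have step: "a (l + h) \<le> (2 * C0 * N / d) / h * a l powr (1 + \<beta>)" if l: "1 \<le> l" and h: "0 < h" and small: "a l \<le> \<alpha>\<^sub>0" for l h
    proof -
      let ?T = "\<lambda>x. smoothstep ((w x - l) / h)" and ?T' = "\<lambda>x. smoothstep' ((w x - l) / h) / h"
      define W where "W x = ?T' x *\<^sub>R gradient w x" for x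
      have T'0: "0 \<le> ?T' x" "?T' x \<le> 2 / h" for x
        using h smoothstep'_nonneg smoothstep'_le by (auto simp: divide_le_cancel)
      have Wd: "(?T has_derivative (\<lambda>k. W x \<bullet> k)) (at x)" if "x \<in> \<Omega>" for x
      proof -
        have "((\<lambda>x. (w x - l) / h) has_derivative (\<lambda>k. (gradient w x \<bullet> k) / h)) (at x)"
          using smooth_on_has_gradient[OF wsm that] h by (auto intro!: derivative_eq_intros)
        from DERIV_compose_FDERIV[OF smoothstep_has_real_derivative this]
        show ?thesis by (simp add: W_def mult.commute)
      qed
      have Wc: "continuous_on \<Omega> W"
        unfolding W_def using h by (intro continuous_intros wc' smooth_on_continuous_gradient[OF wsm]) auto
      have Wle: "(norm (W x))\<^sup>2 \<le> 2 / h * (?T' x * (norm (gradient w x))\<^sup>2)" for x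
      proof -
        have "(norm (W x))\<^sup>2 = ?T' x * (?T' x * (norm (gradient w x))\<^sup>2)"
          using T'0(1)[of x] by (simp add: W_def power_mult_distrib power2_eq_square)
        also have "\<dots> \<le> 2 / h * (?T' x * (norm (gradient w x))\<^sup>2)"
          using T'0 by (intro mult_right_mono mult_nonneg_nonneg) auto
        finally show ?thesis .
      qed
      have i2: "set_integrable lborel \<Omega> (\<lambda>x. 2 / h * (?T' x * (norm (gradient w x))\<^sup>2))"
        using test(2)[OF h, of l] by (rule set_integrable_mult_right)
      have i1: "set_integrable lborel \<Omega> (\<lambda>x. (norm (W x))\<^sup>2)"
        unfolding set_integrable_def
      proof (rule Bochner_Integration.integrable_bound)
        show "integrable lborel (\<lambda>x. indicat_real \<Omega> x *\<^sub>R (2 / h * (?T' x * (norm (gradient w x))\<^sup>2)))"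
          using i2 by (simp add: set_integrable_def)
        have "continuous_on \<Omega> (\<lambda>x. (norm (W x))\<^sup>2)" by (intro continuous_intros Wc)
        from borel_measurable_continuous_on_indicator[OF _ this]
        show "(\<lambda>x. indicat_real \<Omega> x *\<^sub>R (norm (W x))\<^sup>2) \<in> borel_measurable lborel" using \<Omega> by simp
        show "AE x in lborel. norm (indicat_real \<Omega> x *\<^sub>R (norm (W x))\<^sup>2) \<le> norm (indicat_real \<Omega> x *\<^sub>R (2 / h * (?T' x * (norm (gradient w x))\<^sup>2)))"
          using order_trans[OF Wle abs_ge_self] by (intro AE_I2) (simp add: indicator_def)
      qed
      have "(LINT x:\<Omega>|lborel. (norm (W x))\<^sup>2) \<le> (LINT x:\<Omega>|lborel. 2 / h * (?T' x * (norm (gradient w x))\<^sup>2))"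
        by (rule set_integral_mono[OF i1 i2 Wle])
      also have "\<dots> = 2 / h * (LINT x:\<Omega>|lborel. ?T' x * (norm (gradient w x))\<^sup>2)" by (rule set_integral_mult_right)
      also have "\<dots> \<le> 2 / h * ((LINT x:A l|lborel. f x) / d)"
      proof (rule mult_left_mono)
        have "0 \<le> (LINT x:\<Omega>|lborel. ?T x * w x)"
          unfolding set_lebesgue_integral_def
        proof (intro integral_nonneg_AE AE_I2)
          fix x
          have "0 \<le> ?T x * w x"
          proof (cases "w x \<le> l")
            case True
            then have "(w x - l) / h \<le> 0" using h by (auto simp: divide_le_0_iff)
            then show ?thesis by (simp add: smoothstep_le_0)
          next
            case False
            then show ?thesis using smoothstep_bounds l by auto
          qed
          then show "0 \<le> indicat_real \<Omega> x *\<^sub>R (?T x * w x)" by (simp add: indicator_def)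
        qed
        then have "0 \<le> (LINT x:\<Omega>|lborel. ?T x * w x) / d" using d by simp
        then show "(LINT x:\<Omega>|lborel. ?T' x * (norm (gradient w x))\<^sup>2) \<le> (LINT x:A l|lborel. f x) / d"
          using energy[OF l h] by linarith
      qed (use h in simp)
      also have "\<dots> \<le> 2 / h * (N * a l powr (1 - \<kappa>) / d)"
        using fN[OF Ab, of l] h d unfolding a_def by (intro mult_left_mono divide_right_mono) auto
      finally have D: "(LINT x:\<Omega>|lborel. (norm (W x))\<^sup>2) \<le> 2 / h * (N * a l powr (1 - \<kappa>) / d)" .
      have "a (l + h) \<le> C0 * a l powr (2 / real DIM('a)) * (LINT x:\<Omega>|lborel. (norm (W x))\<^sup>2)"
        unfolding a_def
      proof (rule sup[OF Wd Wc i1 Ab])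
        fix x assume "x \<in> \<Omega> - A l"
        then have "(w x - l) / h \<le> 0" using h by (auto simp: A_def divide_le_0_iff)
        then show "?T x = 0" by (rule smoothstep_le_0)
      next
        fix x assume "x \<in> A (l + h)"
        then have "1 \<le> (w x - l) / h" using h by (auto simp: A_def le_divide_eq)
        then show "1 \<le> ?T x" by (simp add: smoothstep_ge_1)
      qed (use Ab small a_def in auto)
      also have "\<dots> \<le> C0 * a l powr (2 / real DIM('a)) * (2 / h * (N * a l powr (1 - \<kappa>) / d))"
        using D C0 by (intro mult_left_mono) auto
      also have "\<dots> = (2 * C0 * N / d) / h * (a l powr (2 / real DIM('a)) * a l powr (1 - \<kappa>))"
        by (simp add: field_simps)
      also have "a l powr (2 / real DIM('a)) * a l powr (1 - \<kappa>) = a l powr (1 + \<beta>)"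
        by (simp add: \<beta>_def powr_add[symmetric] algebra_simps)
      finally show ?thesis .
    qed
    define l\<^sub>0 where "l\<^sub>0 = 2 + N * L0"
    have l\<^sub>0: "2 \<le> l\<^sub>0" using N L0 by (simp add: l\<^sub>0_def)
    have start: "a l\<^sub>0 \<le> \<alpha>\<^sub>0"
    proof -
      let ?T = "\<lambda>x. smoothstep ((w x - 1) / 1)"
      have i1: "set_integrable lborel \<Omega> (\<lambda>x. ?T x * w x)"
        by (rule set_integrable_continuous_closure[OF \<Omega>, where g="\<lambda>x. ?T x * w x"])
           (auto intro!: continuous_intros wc)
      have "l\<^sub>0 * a l\<^sub>0 = (\<integral>x. l\<^sub>0 * indicator (A l\<^sub>0) x \<partial>lborel)"
        using Ab fin[OF Ab(2)] by (simp add: a_def)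
      also have "\<dots> \<le> (LINT x:\<Omega>|lborel. ?T x * w x)"
        unfolding set_lebesgue_integral_def
      proof (rule integral_mono)
        show "integrable lborel (\<lambda>x. l\<^sub>0 * indicat_real (A l\<^sub>0) x)"
          using Ab[of l\<^sub>0] fin[OF Ab(2)[of l\<^sub>0]] by simp
        show "integrable lborel (\<lambda>x. indicat_real \<Omega> x *\<^sub>R (?T x * w x))" using i1 by (simp add: set_integrable_def)
        fix x
        show "l\<^sub>0 * indicat_real (A l\<^sub>0) x \<le> indicat_real \<Omega> x *\<^sub>R (?T x * w x)"
        proof (cases "x \<in> A l\<^sub>0")
          case True
          then have "?T x = 1" using l\<^sub>0 by (intro smoothstep_ge_1) (auto simp: A_def)
          then show ?thesis using True by (auto simp: A_def)
        next
          case False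
          have "0 \<le> ?T x * w x"
            by (cases "w x \<le> 1") (use smoothstep_bounds[of "w x - 1"] in \<open>auto simp: smoothstep_le_0\<close>)
          then show ?thesis using False by (auto simp: indicator_def)
        qed
      qed
      also have "\<dots> \<le> (LINT x:A 1|lborel. f x)"
      proof -
        have "0 \<le> (LINT x:\<Omega>|lborel. smoothstep' ((w x - 1) / 1) / 1 * (norm (gradient w x))\<^sup>2)"
          unfolding set_lebesgue_integral_def using smoothstep'_nonneg
          by (intro integral_nonneg_AE AE_I2) auto
        then have "(LINT x:\<Omega>|lborel. ?T x * w x) / d \<le> (LINT x:A 1|lborel. f x) / d"
          using energy[of 1 1] by simp
        then show ?thesis using d by (simp add: divide_le_cancel)
      qed
      also have "\<dots> \<le> N * a 1 powr (1 - \<kappa>)" unfolding a_def by (rule fN[OF Ab])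
      also have "\<dots> \<le> N * \<mu> powr (1 - \<kappa>)"
      proof -
        have "a 1 \<le> \<mu>" unfolding a_def \<mu>_def using Ab[of 1] fin[of \<Omega>] \<Omega>(1)
          by (intro measure_mono_fmeasurable) (auto simp: fmeasurable_def)
        then show ?thesis using a0 \<kappa> N by (intro mult_left_mono powr_mono2) auto
      qed
      also have "\<dots> = (N * L0) * \<alpha>\<^sub>0" using \<alpha>\<^sub>0 by (simp add: L0_def)
      also have "\<dots> \<le> l\<^sub>0 * \<alpha>\<^sub>0" using \<alpha>\<^sub>0 by (intro mult_right_mono) (auto simp: l\<^sub>0_def)
      finally show ?thesis using l\<^sub>0 by simp
    qed
    define H where "H = 2 * C0 * N / d * \<alpha>\<^sub>0 powr \<beta> * 2 powr (1 / \<beta>)"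
    have "a (l\<^sub>0 + 2 * H) = 0"
      unfolding H_def
    proof (rule level_iteration_vanishes[where a=a, OF a0 amono _ \<beta> \<alpha>\<^sub>0 start])
      show "0 < 2 * C0 * N / d" using C0 N d by simp
      show "a (l + h) \<le> 2 * C0 * N / d / h * a l powr (1 + \<beta>)" if "l\<^sub>0 \<le> l" "0 < h" for l h
        using step[of l h] that l\<^sub>0 amono[OF that(1)] start by auto
    qed
    then have "emeasure lborel (A (l\<^sub>0 + 2 * H)) = 0"
      using fin[OF Ab(2)[of "l\<^sub>0 + 2 * H"]] by (simp add: a_def measure_def enn2real_eq_0_iff less_top[symmetric])
    then have "A (l\<^sub>0 + 2 * H) = {}" by (rule open_measure_eq_0_imp_empty[OF Ao])
    then have "w x \<le> l\<^sub>0 + 2 * H" if "x \<in> \<Omega>" for x using that by (force simp: A_def)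
    then have "w x \<le> l\<^sub>0 + 2 * H"
      using continuous_le_on_closure[OF wc x] by blast
    also have "\<dots> = 2 + N * L0 + N * H0 * (1 / d)" by (simp add: l\<^sub>0_def H_def H0_def)
    also have "\<dots> \<le> C * N * (1 + 1 / d)"
    proof -
      have "0 \<le> N * L0 * (1 / d)" "0 \<le> N * H0" "0 \<le> N * 2 * (1 / d)" using N L0 H0 d by auto
      then show ?thesis using N by (simp add: C_def algebra_simps)
    qed
    finally show ?thesis .
  qed
  moreover have "1 \<le> C" using H0 L0 by (simp add: C_def)
  ultimately show ?thesis using that by blast
qed

section \<open>Maximum principle\<close>

text \<open>The weak form shows that the integral of \<open>T w \<Delta>w\<close> is nonpositive, while the sign condition makes the
  integrand positive wherever \<open>T w \<noteq> 0\<close>. Since boundary points enter only through the Neumann condition,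
  extrema on the boundary need no separate argument (no Hopf lemma).\<close>

theorem neumann_maximum_principle:
  fixes \<Omega> :: "'a::euclidean_space set" and T T' :: "real \<Rightarrow> real"
  assumes dom: "bounded_smooth_domain \<Omega>" and \<nu>: "unit_outer_normal \<Omega> \<nu>"
    and w: "smooth_up_to_boundary \<Omega> w" and nd: "\<And>y. y \<in> frontier \<Omega> \<Longrightarrow> has_normal_derivative \<nu> w 0 y"
    and T: "\<And>y. (T has_real_derivative T' y) (at y)" and T'c: "continuous_on UNIV T'" and T'0: "\<And>y. 0 \<le> T' y"
    and sign: "\<And>x. x \<in> \<Omega> \<Longrightarrow> T (w x) \<noteq> 0 \<Longrightarrow> 0 < T (w x) * laplacian w x"
    and x: "x \<in> closure \<Omega>"
  shows "T (w x) = 0"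
proof -
  have \<Omega>: "open \<Omega>" "bounded \<Omega>" using dom by (auto simp: bounded_smooth_domain_def)
  have wc: "continuous_on (closure \<Omega>) w" using w by (auto simp: smooth_up_to_boundary_def)
  have Tc: "continuous_on UNIV T"
    unfolding continuous_on_eq_continuous_at[OF open_UNIV] using T DERIV_isCont by blast
  have Twc: "continuous_on (closure \<Omega>) (\<lambda>x. T (w x))"
    by (rule continuous_on_compose2[OF Tc wc]) simp
  note wf = neumann_weak_form[OF dom \<nu> w nd T continuous_on_subset[OF T'c subset_UNIV]]
  let ?F = "\<lambda>x. indicat_real \<Omega> x *\<^sub>R (T (w x) * laplacian w x)"
  have F0: "0 \<le> ?F x" for x
  proof (cases "x \<in> \<Omega> \<and> T (w x) \<noteq> 0")
    case True then show ?thesis using sign[of x] by simp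
  qed auto
  have "0 \<le> (LINT x:\<Omega>|lborel. T' (w x) * (norm (gradient w x))\<^sup>2)"
    unfolding set_lebesgue_integral_def using T'0 by (intro integral_nonneg_AE AE_I2) auto
  then have "integral\<^sup>L lborel ?F \<le> 0" using wf(3) by (simp add: set_lebesgue_integral_def)
  moreover have "0 \<le> integral\<^sup>L lborel ?F" using F0 by (intro integral_nonneg_AE AE_I2)
  ultimately have "integral\<^sup>L lborel ?F = 0" by linarith
  moreover have int: "integrable lborel ?F" using wf(1) by (simp add: set_integrable_def)
  ultimately have "AE x in lborel. ?F x = 0"
    using integral_nonneg_eq_0_iff_AE[OF int] F0 by auto
  moreover have meas: "?F \<in> borel_measurable lborel" using int by auto
  moreover have ns: "{x \<in> space lborel. ?F x \<noteq> 0} \<in> sets lborel"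
  proof -
    have "?F -` (- {0}) \<inter> space lborel \<in> sets lborel" by (rule measurable_sets[OF meas]) auto
    moreover have "?F -` (- {0}) \<inter> space lborel = {x \<in> space lborel. ?F x \<noteq> 0}" by auto
    ultimately show ?thesis by simp
  qed
  ultimately have null: "emeasure lborel {x \<in> space lborel. ?F x \<noteq> 0} = 0"
    using AE_iff_measurable[OF ns, of "\<lambda>x. ?F x = 0"] by simp
  define S where "S = \<Omega> \<inter> (\<lambda>x. T (w x)) -` (- {0})"
  have "open S" unfolding S_def
    using continuous_on_subset[OF Twc closure_subset] \<Omega>(1) by (intro continuous_open_preimage) auto
  moreover have "S \<subseteq> {x \<in> space lborel. ?F x \<noteq> 0}"
    using sign by (force simp: S_def)
  then have "emeasure lborel S \<le> emeasure lborel {x \<in> space lborel. ?F x \<noteq> 0}"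
    using ns by (intro emeasure_mono)
  then have "emeasure lborel S = 0" using null by simp
  ultimately have "S = {}" by (rule open_measure_eq_0_imp_empty)
  then have "T (w x) = 0" if "x \<in> \<Omega>" for x using that by (auto simp: S_def)
  then show ?thesis using continuous_constant_on_closure[OF Twc _ x] by blast
qed

corollary neumann_upper_bound:
  assumes "bounded_smooth_domain \<Omega>" "unit_outer_normal \<Omega> \<nu>" "smooth_up_to_boundary \<Omega> w"
    "\<And>y. y \<in> frontier \<Omega> \<Longrightarrow> has_normal_derivative \<nu> w 0 y"
    "\<And>x. x \<in> \<Omega> \<Longrightarrow> k < w x \<Longrightarrow> 0 < laplacian w x" "x \<in> closure \<Omega>"
  shows "w x \<le> k"
proof -
  have "pos_sq (w x - k) = 0"
  proof (rule neumann_maximum_principle[OF assms(1-4) _ _ _ _ assms(6), where T="\<lambda>y. pos_sq (y - k)" and T'="\<lambda>y. 2 * max 0 (y - k)"])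
    show "((\<lambda>y. pos_sq (y - k)) has_real_derivative 2 * max 0 (y - k)) (at y)" for y
    proof -
      have "((\<lambda>y. y - k) has_real_derivative 1) (at y)" by (auto intro!: derivative_eq_intros)
      from DERIV_chain'[OF this pos_sq_has_real_derivative] show ?thesis by simp
    qed
    show "0 < pos_sq (w x - k) * laplacian w x" if "x \<in> \<Omega>" "pos_sq (w x - k) \<noteq> 0" for x
    proof -
      have "k < w x" using that(2) pos_sq_simps(1)[of "w x - k"] by force
      then show ?thesis using assms(5)[OF that(1)] pos_sq_simps(4)[of "w x - k"] by simp
    qed
  qed (auto intro!: continuous_intros)
  then show ?thesis using pos_sq_simps(4)[of "w x - k"] by force
qed

corollary neumann_lower_bound:
  assumes "bounded_smooth_domain \<Omega>" "unit_outer_normal \<Omega> \<nu>" "smooth_up_to_boundary \<Omega> w"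
    "\<And>y. y \<in> frontier \<Omega> \<Longrightarrow> has_normal_derivative \<nu> w 0 y"
    "\<And>x. x \<in> \<Omega> \<Longrightarrow> w x < k \<Longrightarrow> laplacian w x < 0" "x \<in> closure \<Omega>"
  shows "k \<le> w x"
proof -
  have "- pos_sq (k - w x) = 0"
  proof (rule neumann_maximum_principle[OF assms(1-4) _ _ _ _ assms(6), where T="\<lambda>y. - pos_sq (k - y)" and T'="\<lambda>y. 2 * max 0 (k - y)"])
    show "((\<lambda>y. - pos_sq (k - y)) has_real_derivative 2 * max 0 (k - y)) (at y)" for y
    proof -
      have "((\<lambda>y. k - y) has_real_derivative - 1) (at y)" by (auto intro!: derivative_eq_intros)
      from DERIV_minus[OF DERIV_chain'[OF this pos_sq_has_real_derivative]] show ?thesis by simp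
    qed
    show "0 < - pos_sq (k - w x) * laplacian w x" if "x \<in> \<Omega>" "- pos_sq (k - w x) \<noteq> 0" for x
    proof -
      have "w x < k" using that(2) pos_sq_simps(1)[of "k - w x"] by force
      then show ?thesis using assms(5)[OF that(1)] pos_sq_simps(4)[of "k - w x"] by (simp add: mult_pos_neg)
    qed
  qed (auto intro!: continuous_intros)
  then show ?thesis using pos_sq_simps(4)[of "k - w x"] by force
qed

section \<open>Bounds for the activator-inhibitor system\<close>

text \<open>Hoelder's inequality up to a factor 2, from the elementary bound
  \<open>y powr \<kappa> \<le> \<theta> powr \<kappa> + \<theta> powr (\<kappa> - 1) * y\<close> with the choice \<open>\<theta> = \<mu> / |A|\<close>.\<close>

lemma integral_powr_le:
  fixes g :: "'a::euclidean_space \<Rightarrow> real"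
  assumes A: "A \<in> sets borel" "A \<subseteq> \<Omega>" and \<Omega>: "\<Omega> \<in> sets borel" "bounded \<Omega>" and \<kappa>: "0 < \<kappa>" "\<kappa> < 1" and \<mu>: "0 < \<mu>"
    and g: "\<And>x. x \<in> \<Omega> \<Longrightarrow> 0 < g x" "set_integrable lborel \<Omega> g" "(LINT x:\<Omega>|lborel. g x) \<le> \<mu>"
    and gi: "set_integrable lborel \<Omega> (\<lambda>x. g x powr \<kappa>)"
  shows "(LINT x:A|lborel. g x powr \<kappa>) \<le> 2 * \<mu> powr \<kappa> * measure lborel A powr (1 - \<kappa>)"
proof -
  define \<alpha> where "\<alpha> = measure lborel A"
  have fin: "emeasure lborel A < \<infinity>" using emeasure_bounded_finite[OF bounded_subset[OF \<Omega>(2) A(2)]] .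
  have iA: "set_integrable lborel A g" "set_integrable lborel A (\<lambda>x. g x powr \<kappa>)"
    using set_integrable_subset[OF g(2), of A] set_integrable_subset[OF gi, of A] A by auto
  show ?thesis
  proof (cases "\<alpha> = 0")
    case True
    then have "emeasure lborel A = 0" using fin by (auto simp: \<alpha>_def measure_def enn2real_eq_0_iff)
    then have "A \<in> null_sets lborel" using A by auto
    then have "AE x in lborel. x \<notin> A" by (rule AE_not_in)
    then have "AE x in lborel. indicat_real A x *\<^sub>R g x powr \<kappa> = 0" by (rule AE_mp) (auto intro!: AE_I2)
    then have "(LINT x:A|lborel. g x powr \<kappa>) = 0"
      unfolding set_lebesgue_integral_def by (intro integral_eq_zero_AE)
    then show ?thesis by simp
  next
    case False
    then have \<alpha>: "0 < \<alpha>" by (simp add: \<alpha>_def zero_less_measure_iff)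
    define \<theta> where "\<theta> = \<mu> / \<alpha>"
    have \<theta>: "0 < \<theta>" using \<mu> \<alpha> by (simp add: \<theta>_def)
    have pt: "y powr \<kappa> \<le> \<theta> powr \<kappa> + \<theta> powr (\<kappa> - 1) * y" if y: "0 < y" for y
    proof (cases "y \<le> \<theta>")
      case True
      then have "y powr \<kappa> \<le> \<theta> powr \<kappa>" using y \<kappa> by (intro powr_mono2) auto
      then show ?thesis using y by (simp add: add_increasing2)
    next
      case False
      have "y powr \<kappa> = y powr (\<kappa> - 1) * y" using y by (simp add: powr_diff)
      also have "\<dots> \<le> \<theta> powr (\<kappa> - 1) * y"
        using False \<theta> \<kappa> y by (intro mult_right_mono powr_mono2') auto
      finally show ?thesis by (simp add: add_increasing)
    qed
    have ic: "set_integrable lborel A (\<lambda>x. \<theta> powr \<kappa>)"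
      using A fin by (simp add: set_integrable_def)
    have ig: "set_integrable lborel A (\<lambda>x. \<theta> powr (\<kappa> - 1) * g x)" using iA(1) by simp
    have "(LINT x:A|lborel. g x powr \<kappa>) \<le> (LINT x:A|lborel. \<theta> powr \<kappa> + \<theta> powr (\<kappa> - 1) * g x)"
      using iA(2) set_integral_add(1)[OF ic ig] by (rule set_integral_mono) (use pt g(1) A(2) in auto)
    also have "\<dots> = (LINT x:A|lborel. \<theta> powr \<kappa>) + (LINT x:A|lborel. \<theta> powr (\<kappa> - 1) * g x)"
      by (rule set_integral_add(2)[OF ic ig])
    also have "\<dots> = \<theta> powr \<kappa> * \<alpha> + \<theta> powr (\<kappa> - 1) * (LINT x:A|lborel. g x)"
      using A fin by (simp add: set_lebesgue_integral_def \<alpha>_def)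
    also have "\<dots> \<le> \<theta> powr \<kappa> * \<alpha> + \<theta> powr (\<kappa> - 1) * \<mu>"
    proof -
      have "(LINT x:A|lborel. g x) \<le> (LINT x:\<Omega>|lborel. g x)"
        unfolding set_lebesgue_integral_def
      proof (rule integral_mono)
        fix x
        show "indicat_real A x *\<^sub>R g x \<le> indicat_real \<Omega> x *\<^sub>R g x"
          using A(2) g(1)[of x] by (auto simp: indicator_def)
      qed (use iA g(2) in \<open>auto simp: set_integrable_def\<close>)
      then show ?thesis using g(3) by (intro add_left_mono mult_left_mono) auto
    qed
    also have "\<dots> = 2 * \<mu> powr \<kappa> * \<alpha> powr (1 - \<kappa>)"
    proof -
      have "\<theta> powr \<kappa> * \<alpha> = \<mu> powr \<kappa> * \<alpha> powr (1 - \<kappa>)"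
        using \<mu> \<alpha> by (simp add: \<theta>_def powr_divide powr_diff)
      moreover have "\<theta> powr (\<kappa> - 1) * \<mu> = \<mu> powr \<kappa> * \<alpha> powr (1 - \<kappa>)"
        using \<mu> \<alpha> by (simp add: \<theta>_def powr_divide powr_diff)
      ultimately show ?thesis by simp
    qed
    finally show ?thesis by (simp add: \<alpha>_def)
  qed
qed

text \<open>Dividing the second equation by \<open>v\<close> and integrating gives the claim, because \<open>\<Delta>v / v\<close> has nonnegative
  integral under the Neumann condition. The bound does not see \<open>d\<^sub>2\<close>.\<close>

lemma solution_ratio_integral_le:
  fixes \<Omega> :: "'a::euclidean_space set"
  assumes dom: "bounded_smooth_domain \<Omega>" and \<nu>: "unit_outer_normal \<Omega> \<nu>" and d: "0 < d\<^sub>2"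
    and sol: "positive_smooth_solution \<Omega> \<nu> d\<^sub>1 d\<^sub>2 \<sigma> p q r s u v"
  shows "set_integrable lborel \<Omega> (\<lambda>x. u x powr r / v x powr (s + 1))"
    and "(LINT x:\<Omega>|lborel. u x powr r / v x powr (s + 1)) \<le> measure lborel \<Omega>"
proof -
  have \<Omega>: "open \<Omega>" "bounded \<Omega>" using dom by (auto simp: bounded_smooth_domain_def)
  have u: "smooth_up_to_boundary \<Omega> u" and v: "smooth_up_to_boundary \<Omega> v"
    and pos: "\<And>x. x \<in> closure \<Omega> \<Longrightarrow> 0 < u x" "\<And>x. x \<in> closure \<Omega> \<Longrightarrow> 0 < v x"
    and eq: "\<And>x. x \<in> \<Omega> \<Longrightarrow> d\<^sub>2 * laplacian v x - v x + u x powr r / v x powr s = 0"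
    and nd: "\<And>y. y \<in> frontier \<Omega> \<Longrightarrow> has_normal_derivative \<nu> v 0 y"
    using sol unfolding positive_smooth_solution_def by auto
  have uc: "continuous_on (closure \<Omega>) u" and vc: "continuous_on (closure \<Omega>) v"
    using u v by (auto simp: smooth_up_to_boundary_def)
  have nz: "\<And>x. x \<in> closure \<Omega> \<Longrightarrow> u x \<noteq> 0" "\<And>x. x \<in> closure \<Omega> \<Longrightarrow> v x \<noteq> 0" using pos by force+
  show gi: "set_integrable lborel \<Omega> (\<lambda>x. u x powr r / v x powr (s + 1))"
    by (rule set_integrable_continuous_closure[OF \<Omega>, where g="\<lambda>x. u x powr r / v x powr (s + 1)"])
       (use nz in \<open>auto intro!: continuous_intros uc vc\<close>)
  have 1: "((\<lambda>y. - 1 / y) has_real_derivative 1 / (v x)\<^sup>2) (at (v x))" if "x \<in> closure \<Omega>" for x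
    using nz(2)[OF that] by (auto intro!: derivative_eq_intros simp: power2_eq_square)
  have 2: "continuous_on (v ` closure \<Omega>) (\<lambda>y. 1 / y\<^sup>2)"
    using nz(2) by (auto intro!: continuous_intros)
  note wf = neumann_weak_form[OF dom \<nu> v nd 1 2]
  have "0 \<le> (LINT x:\<Omega>|lborel. 1 / (v x)\<^sup>2 * (norm (gradient v x))\<^sup>2)"
    unfolding set_lebesgue_integral_def by (intro integral_nonneg_AE AE_I2) auto
  then have le: "(LINT x:\<Omega>|lborel. - 1 / v x * laplacian v x) \<le> 0" using wf(3) by simp
  have "(LINT x:\<Omega>|lborel. u x powr r / v x powr (s + 1)) - (LINT x:\<Omega>|lborel. 1)
      = (LINT x:\<Omega>|lborel. u x powr r / v x powr (s + 1) - 1)"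
    using set_integral_diff(2)[OF gi, of "\<lambda>_. 1"] \<Omega> emeasure_bounded_finite[OF \<Omega>(2)]
    by (simp add: set_integrable_def)
  also have "\<dots> = (LINT x:\<Omega>|lborel. d\<^sub>2 * (- 1 / v x * laplacian v x))"
  proof (rule set_lebesgue_integral_cong)
    show "\<forall>x. x \<in> \<Omega> \<longrightarrow> u x powr r / v x powr (s + 1) - 1 = d\<^sub>2 * (- 1 / v x * laplacian v x)"
    proof (intro allI impI)
      fix x assume x: "x \<in> \<Omega>"
      then have v0: "0 < v x" using pos closure_subset by blast
      have "d\<^sub>2 * (- 1 / v x * laplacian v x) = - (d\<^sub>2 * laplacian v x) / v x" by simp
      also have "d\<^sub>2 * laplacian v x = v x - u x powr r / v x powr s" using eq[OF x] by linarith
      also have "- (v x - u x powr r / v x powr s) / v x = u x powr r / v x powr (s + 1) - 1"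
        using v0 by (simp add: powr_add field_simps)
      finally show "u x powr r / v x powr (s + 1) - 1 = d\<^sub>2 * (- 1 / v x * laplacian v x)" ..
    qed
  qed (use \<Omega> in auto)
  also have "\<dots> = d\<^sub>2 * (LINT x:\<Omega>|lborel. - 1 / v x * laplacian v x)" by (rule set_integral_mult_right)
  also have "\<dots> \<le> 0" using le d by (simp add: mult_nonneg_nonpos)
  finally show "(LINT x:\<Omega>|lborel. u x powr r / v x powr (s + 1)) \<le> measure lborel \<Omega>"
    using \<Omega> emeasure_bounded_finite[OF \<Omega>(2)] by (simp add: set_lebesgue_integral_def)
qed

lemma powr_less_iff_root_less:
  fixes y z :: real
  assumes "0 < y" "0 < z" "0 \<le> s"
  shows "z powr (1 / (s + 1)) < y \<longleftrightarrow> z / y powr s < y" "y < z powr (1 / (s + 1)) \<longleftrightarrow> y < z / y powr s"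
proof -
  have eq: "(z powr (1 / (s + 1))) powr (s + 1) = z" using assms by (simp add: powr_powr)
  have y: "y powr (s + 1) = y * y powr s" using assms by (simp add: powr_add)
  have mono: "a < b \<longleftrightarrow> a powr (s + 1) < b powr (s + 1)" if "0 < a" "0 < b" for a b :: real
    using powr_less_mono2[of "s + 1" a b] powr_mono2[of "s + 1" b a] that assms by fastforce
  have "z powr (1 / (s + 1)) < y \<longleftrightarrow> z < y powr (s + 1)"
    using mono[of "z powr (1/(s+1))" y] assms unfolding eq by simp
  then show "z powr (1 / (s + 1)) < y \<longleftrightarrow> z / y powr s < y"
    using assms y by (simp add: pos_divide_less_eq)
  have "y < z powr (1 / (s + 1)) \<longleftrightarrow> y powr (s + 1) < z"
    using mono[of y "z powr (1/(s+1))"] assms unfolding eq by simp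
  then show "y < z powr (1 / (s + 1)) \<longleftrightarrow> y < z / y powr s"
    using assms y by (simp add: pos_less_divide_eq)
qed

lemma solution_inhibitor_upper_bound:
  assumes dom: "bounded_smooth_domain \<Omega>" and \<nu>: "unit_outer_normal \<Omega> \<nu>" and d: "0 < d\<^sub>2" and "0 \<le> r" "0 \<le> s"
    and sol: "positive_smooth_solution \<Omega> \<nu> d\<^sub>1 d\<^sub>2 \<sigma> p q r s u v"
    and M: "\<And>x. x \<in> closure \<Omega> \<Longrightarrow> u x \<le> M" and x: "x \<in> closure \<Omega>"
  shows "v x \<le> M powr (r / (s + 1))"
proof (rule neumann_upper_bound[OF dom \<nu> _ _ _ x])
  show "smooth_up_to_boundary \<Omega> v" "\<And>y. y \<in> frontier \<Omega> \<Longrightarrow> has_normal_derivative \<nu> v 0 y"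
    using sol by (auto simp: positive_smooth_solution_def)
  fix x assume x: "x \<in> \<Omega>" "M powr (r / (s + 1)) < v x"
  then have pos: "0 < u x" "0 < v x" and uM: "u x \<le> M" using sol M closure_subset[of \<Omega>] by (auto simp: positive_smooth_solution_def)
  have "(u x powr r) powr (1 / (s + 1)) \<le> M powr (r / (s + 1))"
    using pos uM assms by (simp add: powr_powr) (intro powr_mono2, auto)
  then have "u x powr r / v x powr s < v x"
    using powr_less_iff_root_less(1)[of "v x" "u x powr r" s] pos x(2) assms by auto
  moreover have "d\<^sub>2 * laplacian v x - v x + u x powr r / v x powr s = 0"
    using sol x(1) by (auto simp: positive_smooth_solution_def)
  ultimately have "0 < d\<^sub>2 * laplacian v x" by linarith
  then show "0 < laplacian v x" using d by (simp add: zero_less_mult_iff)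
qed

lemma solution_lower_bounds:
  assumes dom: "bounded_smooth_domain \<Omega>" and \<nu>: "unit_outer_normal \<Omega> \<nu>" and d: "0 < d\<^sub>1" "0 < d\<^sub>2" and "0 \<le> r" "0 \<le> s"
    and sol: "positive_smooth_solution \<Omega> \<nu> d\<^sub>1 d\<^sub>2 \<sigma> p q r s u v" and \<sigma>: "0 < \<sigma>" and x: "x \<in> closure \<Omega>"
  shows "\<sigma> \<le> u x" "\<sigma> powr (r / (s + 1)) \<le> v x"
proof -
  have pos: "0 < u x" "0 < v x" if "x \<in> \<Omega>" for x
    using that sol closure_subset[of \<Omega>] by (auto simp: positive_smooth_solution_def)
  have u\<sigma>: "\<sigma> \<le> u x" if x: "x \<in> closure \<Omega>" for x
  proof (rule neumann_lower_bound[OF dom \<nu> _ _ _ x])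
    show "smooth_up_to_boundary \<Omega> u" "\<And>y. y \<in> frontier \<Omega> \<Longrightarrow> has_normal_derivative \<nu> u 0 y"
      using sol by (auto simp: positive_smooth_solution_def)
    fix x assume x: "x \<in> \<Omega>" "u x < \<sigma>"
    have "d\<^sub>1 * laplacian u x - u x + u x powr p / v x powr q + \<sigma> = 0"
      using sol x(1) by (auto simp: positive_smooth_solution_def)
    moreover have "0 \<le> u x powr p / v x powr q" by simp
    ultimately have "d\<^sub>1 * laplacian u x < 0" using x(2) by linarith
    then show "laplacian u x < 0" using d by (simp add: mult_less_0_iff)
  qed
  then show "\<sigma> \<le> u x" using x .
  show "\<sigma> powr (r / (s + 1)) \<le> v x"
  proof (rule neumann_lower_bound[OF dom \<nu> _ _ _ x])
    show "smooth_up_to_boundary \<Omega> v" "\<And>y. y \<in> frontier \<Omega> \<Longrightarrow> has_normal_derivative \<nu> v 0 y"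
      using sol by (auto simp: positive_smooth_solution_def)
    fix x assume x: "x \<in> \<Omega>" "v x < \<sigma> powr (r / (s + 1))"
    have "\<sigma> \<le> u x" using u\<sigma> x(1) closure_subset by blast
    then have "\<sigma> powr (r / (s + 1)) \<le> (u x powr r) powr (1 / (s + 1))"
      using \<sigma> assms by (simp add: powr_powr) (intro powr_mono2, auto)
    then have "v x < u x powr r / v x powr s"
      using powr_less_iff_root_less(2)[of "v x" "u x powr r" s] pos[OF x(1)] x(2) assms by auto
    moreover have "d\<^sub>2 * laplacian v x - v x + u x powr r / v x powr s = 0"
      using sol x(1) by (auto simp: positive_smooth_solution_def)
    ultimately have "d\<^sub>2 * laplacian v x < 0" by linarith
    then show "laplacian v x < 0" using d by (simp add: mult_less_0_iff)
  qed
qed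

text \<open>Write \<open>g = u powr r / v powr (s + 1)\<close>, which has integral at most \<open>|\<Omega>|\<close>. Then
  \<open>u powr p / v powr q = g powr \<kappa> * u powr (p - r * \<kappa>) * v powr ((s + 1) * \<kappa> - q)\<close>. The last factor is
  bounded by \<open>K\<close>, and \<open>p - r * \<kappa> < 1\<close>, so where \<open>u > 1\<close> the reaction term is sublinear in \<open>u\<close> with a coefficient
  in \<open>L\<^bsup>1/\<kappa>\<^esup>\<close>. With \<open>M\<close> the maximum of \<open>u\<close>, the sup bound reads \<open>M \<le> C * M powr (1 - \<delta>) * (1 + 1 / d\<^sub>1)\<close>, and
  solving for \<open>M\<close> gives the estimate with \<open>\<gamma> = 1 / \<delta>\<close>.\<close>

theorem solution_a_priori_bound:
  fixes \<Omega> :: "'a::euclidean_space set" and \<sigma> p q r s \<kappa> K :: real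
  assumes dom: "bounded_smooth_domain \<Omega>" and \<nu>: "unit_outer_normal \<Omega> \<nu>"
    and \<sigma>: "0 \<le> \<sigma>" and r: "0 < r" and s: "0 \<le> s" and p: "1 < p"
    and \<kappa>: "(p - 1) / r < \<kappa>" "\<kappa> < 1" "\<kappa> < 2 / real DIM('a)" and K: "0 < K"
    and vK: "\<And>d\<^sub>1 d\<^sub>2 u v x. 0 < d\<^sub>1 \<Longrightarrow> 0 < d\<^sub>2 \<Longrightarrow> positive_smooth_solution \<Omega> \<nu> d\<^sub>1 d\<^sub>2 \<sigma> p q r s u v \<Longrightarrow>
      x \<in> \<Omega> \<Longrightarrow> v x powr ((s + 1) * \<kappa> - q) \<le> K"
  shows "\<exists>c>0. \<exists>\<gamma>>0. \<forall>d\<^sub>1>0. \<forall>d\<^sub>2>0. \<forall>u v.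
           positive_smooth_solution \<Omega> \<nu> d\<^sub>1 d\<^sub>2 \<sigma> p q r s u v \<longrightarrow>
           (\<forall>x\<in>closure \<Omega>. u x \<le> c * (1 + d\<^sub>1 powr (- \<gamma>)) \<and>
              v x \<le> c * (1 + d\<^sub>1 powr (- (r / (s + 1) * \<gamma>))))"
proof -
  have \<Omega>: "open \<Omega>" "bounded \<Omega>" "\<Omega> \<noteq> {}" using dom by (auto simp: bounded_smooth_domain_def)
  have ccl: "compact (closure \<Omega>)" "closure \<Omega> \<noteq> {}" using \<Omega> by auto
  define \<mu> where "\<mu> = measure lborel \<Omega>"
  have fin\<Omega>: "emeasure lborel A < \<infinity>" if "A \<subseteq> \<Omega>" for A
    using emeasure_bounded_finite[OF bounded_subset[OF \<Omega>(2) that]] .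
  have \<mu>: "0 < \<mu>"
  proof -
    have "emeasure lborel \<Omega> \<noteq> 0" using open_measure_eq_0_imp_empty[OF \<Omega>(1)] \<Omega>(3) by blast
    then show ?thesis using fin\<Omega>[of \<Omega>] unfolding \<mu>_def measure_def
      by (simp add: enn2real_positive_iff less_top zero_less_iff_neq_zero)
  qed
  have "0 < (p - 1) / r" using p r by simp
  then have \<kappa>0: "0 < \<kappa>" using \<kappa>(1) by linarith
  \<comment> \<open>The cap \<open>1 / 2\<close> keeps the exponent \<open>1 - \<delta>\<close> positive, so that \<open>u powr (1 - \<delta>)\<close> is bounded by the same power of the maximum.\<close>
  define \<delta> where "\<delta> = min (r * \<kappa> - (p - 1)) (1 / 2)"
  have "p - 1 < r * \<kappa>" using \<kappa>(1) r by (simp add: pos_divide_less_eq mult.commute)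
  then have \<delta>: "0 < \<delta>" "\<delta> < 1" "\<delta> \<le> r * \<kappa> - (p - 1)" by (auto simp: \<delta>_def)
  obtain C where C: "1 \<le> C" and bound: "\<And>d N w f x. 0 < d \<Longrightarrow> 1 \<le> N \<Longrightarrow> smooth_up_to_boundary \<Omega> w \<Longrightarrow>
      (\<And>y. y \<in> frontier \<Omega> \<Longrightarrow> has_normal_derivative \<nu> w 0 y) \<Longrightarrow>
      continuous_on (closure \<Omega>) f \<Longrightarrow> (\<And>x. x \<in> \<Omega> \<Longrightarrow> 0 \<le> f x) \<Longrightarrow>
      (\<And>x. x \<in> \<Omega> \<Longrightarrow> 1 < w x \<Longrightarrow> w x - f x \<le> d * laplacian w x) \<Longrightarrow>
      (\<And>A. A \<in> sets borel \<Longrightarrow> A \<subseteq> \<Omega> \<Longrightarrow> (LINT x:A|lborel. f x) \<le> N * measure lborel A powr (1 - \<kappa>)) \<Longrightarrow>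
      x \<in> closure \<Omega> \<Longrightarrow> w x \<le> C * N * (1 + 1 / d)"
    using neumann_sup_bound[OF dom \<nu> \<kappa>0 \<kappa>(2,3)] by blast
  define N0 where "N0 = (2 * K + \<sigma>) * \<mu> powr \<kappa> + 1"
  have N0: "1 \<le> N0" using K \<sigma> by (simp add: N0_def)
  define \<gamma> where "\<gamma> = 1 / \<delta>"
  define c0 where "c0 = (2 * C * N0) powr \<gamma>"
  define c where "c = max c0 ((2 * c0) powr (r / (s + 1)))"
  have \<gamma>: "0 < \<gamma>" using \<delta> by (simp add: \<gamma>_def)
  have c0: "0 < c0" using C N0 by (simp add: c0_def)
  have c: "0 < c" "c0 \<le> c" "(2 * c0) powr (r / (s + 1)) \<le> c" using c0 by (auto simp: c_def)
  have two: "(1 + t) powr e \<le> 2 powr e * (1 + t powr e)" if "0 < t" "0 < e" for t e :: real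
  proof -
    have "(1 + t) powr e \<le> (2 * max 1 t) powr e" using that by (intro powr_mono2) auto
    also have "\<dots> = 2 powr e * (max 1 t) powr e" by (simp add: powr_mult)
    also have "\<dots> \<le> 2 powr e * (1 + t powr e)" by (intro mult_left_mono) (auto simp: max_def)
    finally show ?thesis .
  qed
  have "u x \<le> c * (1 + d\<^sub>1 powr (- \<gamma>)) \<and> v x \<le> c * (1 + d\<^sub>1 powr (- (r / (s + 1) * \<gamma>)))"
    if d: "0 < d\<^sub>1" "0 < d\<^sub>2" and sol: "positive_smooth_solution \<Omega> \<nu> d\<^sub>1 d\<^sub>2 \<sigma> p q r s u v" and x: "x \<in> closure \<Omega>"
    for d\<^sub>1 d\<^sub>2 u v x
  proof -
    have us: "smooth_up_to_boundary \<Omega> u" and vs: "smooth_up_to_boundary \<Omega> v"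
      and pos: "\<And>x. x \<in> closure \<Omega> \<Longrightarrow> 0 < u x" "\<And>x. x \<in> closure \<Omega> \<Longrightarrow> 0 < v x"
      and eq: "\<And>x. x \<in> \<Omega> \<Longrightarrow> d\<^sub>1 * laplacian u x - u x + u x powr p / v x powr q + \<sigma> = 0"
      and nd: "\<And>y. y \<in> frontier \<Omega> \<Longrightarrow> has_normal_derivative \<nu> u 0 y"
      using sol unfolding positive_smooth_solution_def by auto
    have uc: "continuous_on (closure \<Omega>) u" and vc: "continuous_on (closure \<Omega>) v"
      using us vs by (auto simp: smooth_up_to_boundary_def)
    have nz: "\<And>x. x \<in> closure \<Omega> \<Longrightarrow> u x \<noteq> 0" "\<And>x. x \<in> closure \<Omega> \<Longrightarrow> v x \<noteq> 0" using pos by force+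
    obtain y where y: "y \<in> closure \<Omega>" "\<And>x. x \<in> closure \<Omega> \<Longrightarrow> u x \<le> u y"
      using continuous_attains_sup[OF ccl uc] by blast
    define M where "M = max 1 (u y)"
    have M: "1 \<le> M" "\<And>x. x \<in> closure \<Omega> \<Longrightarrow> u x \<le> M" using y by (auto simp: M_def intro: max.coboundedI2)
    define g where "g x = u x powr r / v x powr (s + 1)" for x
    have gpos: "0 < g x" if "x \<in> closure \<Omega>" for x using nz[OF that] by (simp add: g_def)
    have gc: "continuous_on (closure \<Omega>) g"
      unfolding g_def using nz by (auto intro!: continuous_intros uc vc)
    have gkc: "continuous_on (closure \<Omega>) (\<lambda>x. g x powr \<kappa>)"
      using gpos by (intro continuous_intros gc) force
    define f where "f x = M powr (1 - \<delta>) * (K * g x powr \<kappa> + \<sigma>)" for x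
    have fc: "continuous_on (closure \<Omega>) f" unfolding f_def by (intro continuous_intros gkc)
    have M1: "1 \<le> M powr (1 - \<delta>)" using M \<delta> by (simp add: ge_one_powr_ge_zero)
    have uineq: "u x - f x \<le> d\<^sub>1 * laplacian u x" if x: "x \<in> \<Omega>" "1 < u x" for x
    proof -
      have xc: "x \<in> closure \<Omega>" using x(1) closure_subset by blast
      have p0: "0 < u x" "0 < v x" using pos xc by auto
      have gk: "g x powr \<kappa> = u x powr (r * \<kappa>) / v x powr ((s + 1) * \<kappa>)"
        using p0 by (simp add: g_def powr_divide powr_powr)
      have "u x powr p / v x powr q = g x powr \<kappa> * u x powr (p - r * \<kappa>) * v x powr ((s + 1) * \<kappa> - q)"
        unfolding gk using p0 by (simp add: powr_diff)
      also have "\<dots> \<le> g x powr \<kappa> * M powr (1 - \<delta>) * K"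
      proof (intro mult_mono mult_nonneg_nonneg)
        have "u x powr (p - r * \<kappa>) \<le> u x powr (1 - \<delta>)" using x(2) \<delta> by (intro powr_mono) auto
        also have "\<dots> \<le> M powr (1 - \<delta>)" using M(2)[OF xc] p0 \<delta> by (intro powr_mono2) auto
        finally show "u x powr (p - r * \<kappa>) \<le> M powr (1 - \<delta>)" .
        show "v x powr ((s + 1) * \<kappa> - q) \<le> K" by (rule vK[OF d sol x(1)])
      qed auto
      finally have 1: "u x powr p / v x powr q \<le> M powr (1 - \<delta>) * (K * g x powr \<kappa>)" by (simp add: mult_ac)
      have 2: "1 * \<sigma> \<le> M powr (1 - \<delta>) * \<sigma>" using M1 \<sigma> by (rule mult_right_mono)
      have "f x = M powr (1 - \<delta>) * (K * g x powr \<kappa>) + M powr (1 - \<delta>) * \<sigma>"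
        by (simp add: f_def distrib_left)
      then show ?thesis using eq[OF x(1)] 1 2 by linarith
    qed
    note gint = solution_ratio_integral_le[OF dom \<nu> d(2) sol, folded g_def \<mu>_def]
    have gki: "set_integrable lborel \<Omega> (\<lambda>x. g x powr \<kappa>)"
      by (rule set_integrable_continuous_closure[OF \<Omega>(1,2) gkc]) simp
    have fN: "(LINT x:A|lborel. f x) \<le> (M powr (1 - \<delta>) * N0) * measure lborel A powr (1 - \<kappa>)"
      if A: "A \<in> sets borel" "A \<subseteq> \<Omega>" for A
    proof -
      let ?\<alpha> = "measure lborel A"
      have gp: "\<And>x. x \<in> \<Omega> \<Longrightarrow> 0 < g x" using gpos closure_subset by blast
      have g1: "(LINT x:A|lborel. g x powr \<kappa>) \<le> 2 * \<mu> powr \<kappa> * ?\<alpha> powr (1 - \<kappa>)"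
        using integral_powr_le[OF A _ \<Omega>(2) \<kappa>0 \<kappa>(2) \<mu> gp gint gki] \<Omega>(1) by auto
      have i1: "set_integrable lborel A (\<lambda>x. K * g x powr \<kappa>)"
        using set_integrable_subset[OF gki, of A] A by auto
      have i2: "set_integrable lborel A (\<lambda>x. \<sigma>)" using A fin\<Omega>[OF A(2)] by (simp add: set_integrable_def)
      have "?\<alpha> \<le> \<mu>" unfolding \<mu>_def using A fin\<Omega>[of \<Omega>] \<Omega>(1)
        by (intro measure_mono_fmeasurable) (auto simp: fmeasurable_def)
      have "?\<alpha> = ?\<alpha> powr \<kappa> * ?\<alpha> powr (1 - \<kappa>)" by (simp add: powr_add[symmetric])
      also have "\<dots> \<le> \<mu> powr \<kappa> * ?\<alpha> powr (1 - \<kappa>)"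
        using \<open>?\<alpha> \<le> \<mu>\<close> \<kappa>0 by (intro mult_right_mono powr_mono2) auto
      finally have a1: "?\<alpha> \<le> \<mu> powr \<kappa> * ?\<alpha> powr (1 - \<kappa>)" .
      have "(LINT x:A|lborel. f x) = M powr (1 - \<delta>) * (LINT x:A|lborel. K * g x powr \<kappa> + \<sigma>)"
        unfolding f_def by (rule set_integral_mult_right)
      also have "(LINT x:A|lborel. K * g x powr \<kappa> + \<sigma>) = K * (LINT x:A|lborel. g x powr \<kappa>) + \<sigma> * ?\<alpha>"
        using set_integral_add(2)[OF i1 i2] A fin\<Omega>[OF A(2)] by (simp add: set_lebesgue_integral_def)
      also have "\<dots> \<le> K * (2 * \<mu> powr \<kappa> * ?\<alpha> powr (1 - \<kappa>)) + \<sigma> * (\<mu> powr \<kappa> * ?\<alpha> powr (1 - \<kappa>))"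
        using g1 a1 K \<sigma> by (intro add_mono mult_left_mono) auto
      also have "\<dots> = ((2 * K + \<sigma>) * \<mu> powr \<kappa>) * ?\<alpha> powr (1 - \<kappa>)" by (simp add: algebra_simps)
      also have "\<dots> \<le> N0 * ?\<alpha> powr (1 - \<kappa>)" by (intro mult_right_mono) (auto simp: N0_def)
      finally show ?thesis by (simp add: mult.assoc mult_left_mono)
    qed
    have "1 \<le> M powr (1 - \<delta>) * N0" using mult_mono[OF M1 N0] by simp
    then have ub: "u z \<le> C * (M powr (1 - \<delta>) * N0) * (1 + 1 / d\<^sub>1)" if "z \<in> closure \<Omega>" for z
    proof (rule bound[OF d(1) _ us nd fc _ uineq fN that])
      show "0 \<le> f x" if "x \<in> \<Omega>" for x
        using K \<sigma> by (simp add: f_def)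
    qed
    have "1 \<le> C * (M powr (1 - \<delta>) * N0)" using mult_mono[OF C \<open>1 \<le> M powr (1 - \<delta>) * N0\<close>] C by simp
    then have "1 \<le> C * (M powr (1 - \<delta>) * N0) * (1 + 1 / d\<^sub>1)"
      using mult_mono[of 1 "C * (M powr (1 - \<delta>) * N0)" 1 "1 + 1 / d\<^sub>1"] d by simp
    then have "M \<le> C * (M powr (1 - \<delta>) * N0) * (1 + 1 / d\<^sub>1)" using ub[OF y(1)] by (simp add: M_def)
    moreover have "M powr \<delta> * M powr (1 - \<delta>) = M" using M by (simp add: powr_add[symmetric])
    ultimately have "M powr \<delta> * M powr (1 - \<delta>) \<le> (C * N0 * (1 + 1 / d\<^sub>1)) * M powr (1 - \<delta>)"
      by (simp add: mult_ac)
    then have "M powr \<delta> \<le> C * N0 * (1 + 1 / d\<^sub>1)"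
      by (rule mult_right_le_imp_le) (use M1 in linarith)
    then have "(M powr \<delta>) powr \<gamma> \<le> (C * N0 * (1 + 1 / d\<^sub>1)) powr \<gamma>" using \<gamma> by (intro powr_mono2) auto
    moreover have "(M powr \<delta>) powr \<gamma> = M" using M \<delta> by (simp add: powr_powr \<gamma>_def)
    ultimately have "M \<le> (C * N0) powr \<gamma> * (1 + 1 / d\<^sub>1) powr \<gamma>" using C N0 d by (simp add: powr_mult)
    also have "\<dots> \<le> (C * N0) powr \<gamma> * (2 powr \<gamma> * (1 + (1 / d\<^sub>1) powr \<gamma>))"
      using two[of "1 / d\<^sub>1" \<gamma>] d \<gamma> by (intro mult_left_mono) auto
    also have "\<dots> = c0 * (1 + d\<^sub>1 powr (- \<gamma>))"
      using C N0 d by (simp add: c0_def powr_mult powr_divide powr_minus_divide)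
    finally have MB: "M \<le> c0 * (1 + d\<^sub>1 powr (- \<gamma>))" .
    have "u x \<le> c * (1 + d\<^sub>1 powr (- \<gamma>))"
    proof -
      have "u x \<le> c0 * (1 + d\<^sub>1 powr (- \<gamma>))" using M(2)[OF x] MB by linarith
      also have "\<dots> \<le> c * (1 + d\<^sub>1 powr (- \<gamma>))" using c by (intro mult_right_mono) auto
      finally show ?thesis .
    qed
    moreover have "v x \<le> c * (1 + d\<^sub>1 powr (- (r / (s + 1) * \<gamma>)))"
    proof -
      have e: "0 < r / (s + 1)" using r s by simp
      have "v x \<le> M powr (r / (s + 1))"
        using solution_inhibitor_upper_bound[OF dom \<nu> d(2) _ s sol M(2) x] r by simp
      also have "\<dots> \<le> (c0 * (1 + d\<^sub>1 powr (- \<gamma>))) powr (r / (s + 1))"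
        using MB M e by (intro powr_mono2) auto
      also have "\<dots> = c0 powr (r / (s + 1)) * (1 + d\<^sub>1 powr (- \<gamma>)) powr (r / (s + 1))"
        using c0 by (simp add: powr_mult)
      also have "\<dots> \<le> c0 powr (r / (s + 1)) * (2 powr (r / (s + 1)) * (1 + (d\<^sub>1 powr (- \<gamma>)) powr (r / (s + 1))))"
        using two[of "d\<^sub>1 powr (- \<gamma>)" "r / (s + 1)"] d e by (intro mult_left_mono) auto
      also have "\<dots> = (2 * c0) powr (r / (s + 1)) * (1 + d\<^sub>1 powr (- (r / (s + 1) * \<gamma>)))"
        using c0 by (simp add: powr_mult powr_powr mult_ac)
      also have "\<dots> \<le> c * (1 + d\<^sub>1 powr (- (r / (s + 1) * \<gamma>)))" using c by (intro mult_right_mono) auto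
      finally show ?thesis .
    qed
    ultimately show ?thesis ..
  qed
  then show ?thesis
    by (intro exI[of _ c] conjI[OF c(1)] exI[of _ \<gamma>] conjI[OF \<gamma>] allI impI ballI)
qed

theorem theorem1p5:
  fixes \<Omega> :: "(real ^ 'n) set" and \<nu> :: "real ^ 'n \<Rightarrow> real ^ 'n"
    and \<sigma> p q r s :: real
  assumes "bounded_smooth_domain \<Omega>" and "unit_outer_normal \<Omega> \<nu>"
    and "\<sigma> \<ge> 0" and "p \<ge> 0" and "q \<ge> 0" and "r \<ge> 0" and "s \<ge> 0"
    and "0 < (p - 1) / r" and "(p - 1) / r < q / (s + 1)"
  shows
    "(\<sigma> = 0 \<and> q / (s + 1) < min 1 (2 / real CARD('n)) \<longrightarrow>
        (\<exists>c>0. \<exists>\<gamma>>0. \<forall>d\<^sub>1>0. \<forall>d\<^sub>2>0. \<forall>u v.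
           positive_smooth_solution \<Omega> \<nu> d\<^sub>1 d\<^sub>2 \<sigma> p q r s u v \<longrightarrow>
           (\<forall>x\<in>closure \<Omega>. u x \<le> c * (1 + d\<^sub>1 powr (- \<gamma>)) \<and>
              v x \<le> c * (1 + d\<^sub>1 powr (- (r / (s + 1) * \<gamma>))))))
     \<and> (\<sigma> > 0 \<and> (p - 1) / r < min 1 (2 / real CARD('n)) \<longrightarrow>
        (\<exists>c>0. \<exists>\<gamma>>0. \<forall>d\<^sub>1>0. \<forall>d\<^sub>2>0. \<forall>u v.
           positive_smooth_solution \<Omega> \<nu> d\<^sub>1 d\<^sub>2 \<sigma> p q r s u v \<longrightarrow>
           (\<forall>x\<in>closure \<Omega>. u x \<le> c * (1 + d\<^sub>1 powr (- \<gamma>)) \<and>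
              v x \<le> c * (1 + d\<^sub>1 powr (- (r / (s + 1) * \<gamma>))))))"
proof (intro conjI impI)
  have r: "0 < r" using assms(6,8) by (cases "r = 0") auto
  have p: "1 < p" using assms(8) r by (simp add: zero_less_divide_iff)
  note bound = solution_a_priori_bound[OF assms(1,2,3) r assms(7) p]
  {
    assume i: "\<sigma> = 0 \<and> q / (s + 1) < min 1 (2 / real CARD('n))"
    show "\<exists>c>0. \<exists>\<gamma>>0. \<forall>d\<^sub>1>0. \<forall>d\<^sub>2>0. \<forall>u v.
           positive_smooth_solution \<Omega> \<nu> d\<^sub>1 d\<^sub>2 \<sigma> p q r s u v \<longrightarrow>
           (\<forall>x\<in>closure \<Omega>. u x \<le> c * (1 + d\<^sub>1 powr (- \<gamma>)) \<and>
              v x \<le> c * (1 + d\<^sub>1 powr (- (r / (s + 1) * \<gamma>))))"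
    \<comment> \<open>With this \<open>\<kappa>\<close> the exponent of \<open>v\<close> is 0, and the power of \<open>v\<close> is constant.\<close>
    proof (rule bound[of "q / (s + 1)" 1])
      show "v x powr ((s + 1) * (q / (s + 1)) - q) \<le> 1" for v :: "real ^ 'n \<Rightarrow> real" and x
        using assms(7) by simp
    qed (use i assms in auto)
  next
    assume ii: "\<sigma> > 0 \<and> (p - 1) / r < min 1 (2 / real CARD('n))"
    then have "(p - 1) / r < min (q / (s + 1)) (min 1 (2 / real CARD('n)))" using assms(9) by simp
    then obtain \<kappa> where \<kappa>: "(p - 1) / r < \<kappa>" "\<kappa> < min (q / (s + 1)) (min 1 (2 / real CARD('n)))"
      using dense by blast
    \<comment> \<open>The exponent of \<open>v\<close> is now negative; the source term bounds \<open>v\<close> from below.\<close>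
    have e: "(s + 1) * \<kappa> - q \<le> 0" using \<kappa>(2) assms(7) by (simp add: field_simps)
    show "\<exists>c>0. \<exists>\<gamma>>0. \<forall>d\<^sub>1>0. \<forall>d\<^sub>2>0. \<forall>u v.
           positive_smooth_solution \<Omega> \<nu> d\<^sub>1 d\<^sub>2 \<sigma> p q r s u v \<longrightarrow>
           (\<forall>x\<in>closure \<Omega>. u x \<le> c * (1 + d\<^sub>1 powr (- \<gamma>)) \<and>
              v x \<le> c * (1 + d\<^sub>1 powr (- (r / (s + 1) * \<gamma>))))"
    proof (rule bound[of \<kappa> "(\<sigma> powr (r / (s + 1))) powr ((s + 1) * \<kappa> - q)"])
      fix d\<^sub>1 d\<^sub>2 u v x assume a: "0 < d\<^sub>1" "0 < d\<^sub>2" "positive_smooth_solution \<Omega> \<nu> d\<^sub>1 d\<^sub>2 \<sigma> p q r s u v" "x \<in> \<Omega>"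
      have "\<sigma> powr (r / (s + 1)) \<le> v x"
        using solution_lower_bounds(2)[OF assms(1,2) a(1,2) assms(6,7) a(3)] ii a(4) closure_subset by blast
      then show "v x powr ((s + 1) * \<kappa> - q) \<le> (\<sigma> powr (r / (s + 1))) powr ((s + 1) * \<kappa> - q)"
        using e ii by (intro powr_mono2') auto
    qed (use ii \<kappa> in auto)
  }
qed

end
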